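(* Let $k$ be a field of characteristic not $2$ and let $\langle A,\Delta\rangle$ be a Jordan coalgebra over $k$ whose dual algebra $A^*$ has a unity. Let $L(A)$, the Lie algebra $L(A^* )$, and the pairing $\langle\cdot,\cdot\rangle\colon L(A^* )\times L(A)\to k$ (which identifies $L(A^* )$ with the space of all linear functionals on $L(A)$) be as defined in the context. Then a comultiplication $\Delta_L\colon L(A)\to L(A)\otimes L(A)$ (a linear map) can be defined on the linear space $L(A)$ in such a way that $\langle L(A),\Delta_L\rangle$ is a Lie coalgebra whose dual algebra is $L(A^* )$; that is, under the identification $L(A)^*=L(A^* )$, the product induced by $\Delta_L$ on $L(A)^*$ is the Lie bracket $[\,,\,]$ of $L(A^* )$.
   Context: **Coalgebras.** A coalgebra $\langle A,\Delta\rangle$ over $k$ is a $k$-vector space $A$ with a linear map $\Delta\colon A\to A\otimes A$ (no coassociativity is assumed); write $\Delta(a)=\sum a_{(1)}\otimes a_{(2)}$. For $f\in A^*$, $a\in A$, $\langle f,a\rangle$ is the value of $f$ at $a$. The dual algebra is the full linear dual $A^*$ with product $\langle fg,a\rangle=\sum\langle f,a_{(1)}\rangle\langle g,a_{(2)}\rangle$. A coalgebra is a Jordan (resp. Lie) coalgebra if its dual algebra is a Jordan (resp. Lie) algebra. A subcoalgebra is a subspace $B$ with $\Delta(B)\subseteq B\otimes B$. **Operators.** Operators are written on the right and composed left to right. For an element $a$ of a Jordan algebra $J$, $a'$ is the operator $x\mapsto xa$, and $X'=\{a'\mid a\in X\}$ for $X\subseteq J$. Put $[a,b]=a'b'-b'a'$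 for $a,b\in J$, and for subsets $X,Y$ let $[X,Y]$ be the linear span of the operators $[x,y]$, $x\in X,y\in Y$. Each $[a,b]$ is a derivation of $J$; $\mathrm{IntDer}(J)$ is the space of finite sums $\sum[a_i,b_i]$. **Weakly inner derivations.** A derivation $\mathrm d$ of $A^*$ is weakly inner if for any finite-dimensional subcoalgebra $B$ of $\langle A,\Delta\rangle$ there is $\mathrm i\in\mathrm{IntDer}(A^* )$ with $\langle f\mathrm d,b\rangle=\langle f\mathrm i,b\rangle$ for all $f\in A^*$, $b\in B$. $\mathrm{WIntDer}(A^* )$ is the space of all weakly inner derivations (a Lie algebra under commutation). **Null extension.** $C=A^*\oplus A$ is the Jordan algebra with the given product on $A^*$, $f\cdot a=a\cdot f=\sum a_{(1)}\langle f,a_{(2)}\rangle$ for $f\in A^*,a\in A$, and $A\cdot A=0$. For $a\in A$, $f\in A^*$, the operators $a'$ and $[f,a]$ are taken on $C$. **The Lie algebra $L(A^* )$.** $R(A^* )=(A^* )'\oplus\mathrm{WIntDer}(A^* )$ (operators on $A^*$), a Lie algebra under commutation, with $\varepsilon(f'+\mathrm d)=-f'+\mathrm d$. $L(A^* )=A^*\oplus R(A^* )\oplus\bar A^*$, where $\bar A^*$ is an isomorphic copy of $A^*$, with the Lie bracket $$[a_1+\mathrm d_1+\bar b_1,a_2+\mathrm d_2+\bar b_2]=a_1\mathrm d_2-a_2\mathrm d_1+a_1\nabla b_2-a_2\nabla b_1+[\mathrm d_1,\mathrm d_2]+\overline{b_1\varepsilon(\mathrm d_2)}-\overline{b_2\varepsilon(\mathrm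 d_1)},$$ where $a_i,b_i\in A^*$, $\mathrm d_i\in R(A^* )$, $a\nabla b=(ab)'-[a,b]$. **The space $L(A)$ and the pairing.** $L(A)=A\oplus R(A)\oplus\bar A$, where $\bar A$ is an isomorphic copy of $A$ and $R(A)=A'\oplus[A^*,A]$. The space $\mathrm{WIntDer}(A^* )$ is identified with $[A^*,A]^*$ through $\langle\mathrm d,[f,a]\rangle=\langle f\mathrm d,a\rangle$. The pairing is $\langle f+g'+\mathrm d+\bar h,\;a+b'+v+\bar c\rangle=\langle f,a\rangle+\langle g,b\rangle+\langle\mathrm d,v\rangle+\langle h,c\rangle$ for $f,g,h\in A^*$, $\mathrm d\in\mathrm{WIntDer}(A^* )$, $a,b,c\in A$, $v\in[A^*,A]$. *)

theory Defs
  imports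
    "HOL-Analysis.Product_Vector"
    "HOL-Library.Function_Algebras"
begin

section \<open>Linear maps on subspaces, pointwise scaling\<close>

definition fun_scale :: "('k \<Rightarrow> 'b \<Rightarrow> 'b) \<Rightarrow> 'k \<Rightarrow> ('a \<Rightarrow> 'b) \<Rightarrow> ('a \<Rightarrow> 'b)" where
  "fun_scale s c f = (\<lambda>x. s c (f x))"

definition linear_on ::
  "('k \<Rightarrow> 'a::plus \<Rightarrow> 'a) \<Rightarrow> ('k \<Rightarrow> 'b::plus \<Rightarrow> 'b) \<Rightarrow> 'a set \<Rightarrow> ('a \<Rightarrow> 'b) \<Rightarrow> bool" where
  "linear_on s1 s2 V f \<longleftrightarrow>
     (\<forall>x\<in>V. \<forall>y\<in>V. f (x + y) = f x + f y) \<and> (\<forall>c. \<forall>x\<in>V. f (s1 c x) = s2 c (f x))"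

definition bilinear_on ::
  "('k \<Rightarrow> 'a::plus \<Rightarrow> 'a) \<Rightarrow> ('k \<Rightarrow> 'b::plus \<Rightarrow> 'b) \<Rightarrow> ('k \<Rightarrow> 'c::plus \<Rightarrow> 'c) \<Rightarrow>
     'a set \<Rightarrow> 'b set \<Rightarrow> ('a \<Rightarrow> 'b \<Rightarrow> 'c) \<Rightarrow> bool" where
  "bilinear_on s1 s2 s3 V W m \<longleftrightarrow>
     (\<forall>y\<in>W. linear_on s1 s3 V (\<lambda>x. m x y)) \<and> (\<forall>x\<in>V. linear_on s2 s3 W (m x))"

lemma vector_space_field: "vector_space ((*) :: 'k::field \<Rightarrow> 'k \<Rightarrow> 'k)"
  by unfold_locales (simp_all add: algebra_simps)

lemma vector_space_fun_scale: "vector_space s \<Longrightarrow> vector_space (fun_scale s)"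
  unfolding vector_space_def fun_scale_def by (simp add: fun_eq_iff)


lemma sum_fun_apply: "(\<Sum>i\<in>I. f i) x = (\<Sum>i\<in>I. f i x :: 'b::comm_monoid_add)"
  by (induction I rule: infinite_finite_induct) simp_all


section \<open>Tensor products\<close>

text \<open>
  Over a field, the tensor product of two spaces embeds into the dual of the space of bilinear
  forms by sending \<open>x \<otimes> y\<close> to evaluation at \<open>(x, y)\<close>. We take the linear span of these evaluations
  as the tensor product, so that for subspaces \<open>V\<close>, \<open>W\<close> the space \<open>V \<otimes> W\<close> is literally a subspace
  of the tensor product of the ambient spaces. The universal property is proved below as
  \<open>tensor_lift_linear\<close>, \<open>tensor_lift_pure\<close> and \<open>tensor_lift_unique\<close>.
\<close>

type_synonym ('a, 'b, 'k) tensor = "('a \<Rightarrow> 'b \<Rightarrow> 'k) \<Rightarrow> 'k"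

abbreviation tensor_scale :: "'k::field \<Rightarrow> ('a, 'b, 'k) tensor \<Rightarrow> ('a, 'b, 'k) tensor" where
  "tensor_scale \<equiv> fun_scale (*)"

definition pure_tensor ::
  "('k::field \<Rightarrow> 'a::ab_group_add \<Rightarrow> 'a) \<Rightarrow> ('k \<Rightarrow> 'b::ab_group_add \<Rightarrow> 'b) \<Rightarrow>
     'a \<Rightarrow> 'b \<Rightarrow> ('a, 'b, 'k) tensor" where
  "pure_tensor s1 s2 x y = (\<lambda>\<beta>. if bilinear_on s1 s2 (*) UNIV UNIV \<beta> then \<beta> x y else 0)"

definition tensor_product ::
  "('k::field \<Rightarrow> 'a::ab_group_add \<Rightarrow> 'a) \<Rightarrow> ('k \<Rightarrow> 'b::ab_group_add \<Rightarrow> 'b) \<Rightarrow>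
     'a set \<Rightarrow> 'b set \<Rightarrow> ('a, 'b, 'k) tensor set" where
  "tensor_product s1 s2 V W = module.span tensor_scale {pure_tensor s1 s2 x y | x y. x \<in> V \<and> y \<in> W}"

text \<open>
  For a map \<open>m\<close> that is bilinear on \<open>V \<times> W\<close>, the value \<open>\<Sum> m t' t''\<close> of the induced linear map at
  \<open>t = \<Sum> t' \<otimes> t''\<close> in \<open>V \<otimes> W\<close>.
\<close>

definition tensor_lift ::
  "('k::field \<Rightarrow> 'a::ab_group_add \<Rightarrow> 'a) \<Rightarrow> ('k \<Rightarrow> 'b::ab_group_add \<Rightarrow> 'b) \<Rightarrow>
     'a set \<Rightarrow> 'b set \<Rightarrow> ('a \<Rightarrow> 'b \<Rightarrow> 'c::ab_group_add) \<Rightarrow> ('a, 'b, 'k) tensor \<Rightarrow> 'c" where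
  "tensor_lift s1 s2 V W m t =
     (THE z. \<exists>(n::nat) x y. (\<forall>i<n. x i \<in> V \<and> y i \<in> W) \<and>
        t = (\<Sum>i<n. pure_tensor s1 s2 (x i) (y i)) \<and> z = (\<Sum>i<n. m (x i) (y i)))"

context
  fixes s1 :: "'k::field \<Rightarrow> 'a::ab_group_add \<Rightarrow> 'a"
    and s2 :: "'k \<Rightarrow> 'b::ab_group_add \<Rightarrow> 'b"
    and s3 :: "'k \<Rightarrow> 'c::ab_group_add \<Rightarrow> 'c"
    and V W m
  assumes s1: "vector_space s1" and s2: "vector_space s2" and s3: "vector_space s3"
    and V: "module.subspace s1 V" and W: "module.subspace s2 W"
    and m: "bilinear_on s1 s2 s3 V W m"
begin

interpretation v1: vector_space s1 by (rule s1)
interpretation v2: vector_space s2 by (rule s2)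
interpretation v3: vector_space s3 by (rule s3)
interpretation k: vector_space "(*) :: 'k \<Rightarrow> 'k \<Rightarrow> 'k" by (rule vector_space_field)
interpretation t: vector_space "tensor_scale :: 'k \<Rightarrow> ('a, 'b, 'k) tensor \<Rightarrow> _"
  by (rule vector_space_fun_scale[OF vector_space_field])

lemma tensor_sum_cong:
  fixes n n' :: nat
  assumes xy: "\<And>i. i < n \<Longrightarrow> x i \<in> V \<and> y i \<in> W" and xy': "\<And>i. i < n' \<Longrightarrow> x' i \<in> V \<and> y' i \<in> W"
    and eq: "(\<Sum>i<n. pure_tensor s1 s2 (x i) (y i)) = (\<Sum>i<n'. pure_tensor s1 s2 (x' i) (y' i))"
  shows "(\<Sum>i<n. m (x i) (y i)) = (\<Sum>i<n'. m (x' i) (y' i))" (is "?z = ?z'")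
proof (rule ccontr)
  assume ne: "?z \<noteq> ?z'"
  interpret v3k: vector_space_pair s3 "(*) :: 'k \<Rightarrow> 'k \<Rightarrow> 'k" by unfold_locales
  interpret v11: vector_space_pair s1 s1 by unfold_locales
  interpret v22: vector_space_pair s2 s2 by unfold_locales
  have "v3.independent {?z - ?z'}" using ne by (simp add: v3.dependent_single)
  then obtain \<phi> where \<phi>: "Vector_Spaces.linear s3 (*) \<phi>" and \<phi>1: "\<phi> (?z - ?z') = 1"
    using v3k.linear_independent_extend[of "{?z - ?z'}" "\<lambda>_. 1"] by auto
  interpret \<phi>: Vector_Spaces.linear s3 "(*)" \<phi> by (rule \<phi>)
  obtain p where p: "range p \<subseteq> V" "Vector_Spaces.linear s1 s1 p" "\<forall>v\<in>V. p v = v"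
    using v11.linear_exists_left_inverse_on[OF v1.linear_ident V] by (auto simp: inj_on_def)
  interpret p: Vector_Spaces.linear s1 s1 p by (rule p)
  obtain q where q: "range q \<subseteq> W" "Vector_Spaces.linear s2 s2 q" "\<forall>v\<in>W. q v = v"
    using v22.linear_exists_left_inverse_on[OF v2.linear_ident W] by (auto simp: inj_on_def)
  interpret q: Vector_Spaces.linear s2 s2 q by (rule q)
  define \<beta> where "\<beta> = (\<lambda>x y. \<phi> (m (p x) (q y)))"
  have pV: "p x \<in> V" for x using p(1) by auto
  have qW: "q x \<in> W" for x using q(1) by auto
  have \<beta>: "bilinear_on s1 s2 (*) UNIV UNIV \<beta>"
    using m pV qW unfolding bilinear_on_def linear_on_def \<beta>_def
    by (simp add: p.add p.scale q.add q.scale \<phi>.add \<phi>.scale)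
  have "(\<Sum>i<n. \<beta> (x i) (y i)) = (\<Sum>i<n'. \<beta> (x' i) (y' i))"
    using fun_cong[OF eq, of \<beta>] \<beta> by (simp add: sum_fun_apply pure_tensor_def)
  moreover have "(\<Sum>i<n. \<beta> (x i) (y i)) = \<phi> ?z"
    unfolding \<phi>.sum by (rule sum.cong) (use xy p(3) q(3) in \<open>auto simp: \<beta>_def\<close>)
  moreover have "(\<Sum>i<n'. \<beta> (x' i) (y' i)) = \<phi> ?z'"
    unfolding \<phi>.sum by (rule sum.cong) (use xy' p(3) q(3) in \<open>auto simp: \<beta>_def\<close>)
  ultimately show False using \<phi>1 by (simp add: \<phi>.diff)
qed


lemma tensor_lift_sum:
  fixes n :: nat
  assumes "\<And>i. i < n \<Longrightarrow> x i \<in> V \<and> y i \<in> W"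
  shows "tensor_lift s1 s2 V W m (\<Sum>i<n. pure_tensor s1 s2 (x i) (y i)) = (\<Sum>i<n. m (x i) (y i))"
  unfolding tensor_lift_def
proof (rule the_equality)
  show "\<exists>(n'::nat) x' y'. (\<forall>i<n'. x' i \<in> V \<and> y' i \<in> W) \<and>
      (\<Sum>i<n. pure_tensor s1 s2 (x i) (y i)) = (\<Sum>i<n'. pure_tensor s1 s2 (x' i) (y' i)) \<and>
      (\<Sum>i<n. m (x i) (y i)) = (\<Sum>i<n'. m (x' i) (y' i))"
    using assms by (intro exI[of _ n] exI[of _ x] exI[of _ y]) simp
next
  fix z
  assume "\<exists>(n'::nat) x' y'. (\<forall>i<n'. x' i \<in> V \<and> y' i \<in> W) \<and>
      (\<Sum>i<n. pure_tensor s1 s2 (x i) (y i)) = (\<Sum>i<n'. pure_tensor s1 s2 (x' i) (y' i)) \<and>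
      z = (\<Sum>i<n'. m (x' i) (y' i))"
  then obtain n' :: nat and x' y' where xy': "\<forall>i<n'. x' i \<in> V \<and> y' i \<in> W"
    and eq: "(\<Sum>i<n. pure_tensor s1 s2 (x i) (y i)) = (\<Sum>i<n'. pure_tensor s1 s2 (x' i) (y' i))"
    and z: "z = (\<Sum>i<n'. m (x' i) (y' i))"
    by (elim exE conjE)
  show "z = (\<Sum>i<n. m (x i) (y i))"
    unfolding z by (rule tensor_sum_cong[symmetric, OF assms _ eq]) (use xy' in auto)
qed

lemma tensor_lift_pure: "x \<in> V \<Longrightarrow> y \<in> W \<Longrightarrow> tensor_lift s1 s2 V W m (pure_tensor s1 s2 x y) = m x y"
  using tensor_lift_sum[of 1 "\<lambda>_. x" "\<lambda>_. y"] by simp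

lemma pure_tensor_scale: "tensor_scale c (pure_tensor s1 s2 x y) = pure_tensor s1 s2 (s1 c x) y"
  by (auto simp: fun_eq_iff fun_scale_def pure_tensor_def bilinear_on_def linear_on_def)

lemma pure_tensor_sum_append:
  fixes n k :: nat
  shows "(\<Sum>i<n + k. g (if i < n then x i else x' (i - n)) (if i < n then y i else y' (i - n)))
       = (\<Sum>i<n. g (x i) (y i)) + (\<Sum>i<k. g (x' i) (y' i) :: 'd::comm_monoid_add)"
proof -
  have "(\<Sum>i<n + k. g (if i < n then x i else x' (i - n)) (if i < n then y i else y' (i - n)))
      = (\<Sum>i<n. g (x i) (y i)) + (\<Sum>i=n..<n+k. g (x' (i - n)) (y' (i - n)))"
    unfolding lessThan_atLeast0
    by (subst sum.atLeastLessThan_concat[of 0 n "n + k", symmetric]) (auto intro!: arg_cong2[of _ _ _ _ "(+)"] sum.cong)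
  also have "(\<Sum>i=n..<n+k. g (x' (i - n)) (y' (i - n))) = (\<Sum>i<k. g (x' i) (y' i))"
    by (rule sum.reindex_bij_witness[of _ "\<lambda>i. i + n" "\<lambda>i. i - n"]) auto
  finally show ?thesis .
qed

lemma tensor_product_sumE:
  assumes "t \<in> tensor_product s1 s2 V W"
  obtains n :: nat and x y where "\<forall>i<n. x i \<in> V \<and> y i \<in> W"
    "t = (\<Sum>i<n. pure_tensor s1 s2 (x i) (y i))"
proof -
  have "\<exists>(n::nat) x y. (\<forall>i<n. x i \<in> V \<and> y i \<in> W) \<and> t = (\<Sum>i<n. pure_tensor s1 s2 (x i) (y i))"
    using assms unfolding tensor_product_def
  proof (induction rule: t.span_induct_alt)
    case base
    show ?case by (rule exI[of _ 0]) simp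
  next
    case (step c t u)
    then obtain n :: nat and x y a b where ab: "a \<in> V" "b \<in> W" "t = pure_tensor s1 s2 a b"
      and xy: "\<forall>i<n. x i \<in> V \<and> y i \<in> W" "u = (\<Sum>i<n. pure_tensor s1 s2 (x i) (y i))" by blast
    have "tensor_scale c t + u = (\<Sum>i<n. pure_tensor s1 s2 (x i) (y i)) + (\<Sum>i<1::nat. pure_tensor s1 s2 (s1 c a) b)"
      by (simp add: ab xy(2) pure_tensor_scale add.commute)
    also have "\<dots> = (\<Sum>i<n + 1. pure_tensor s1 s2 (if i < n then x i else s1 c a) (if i < n then y i else b))"
      using pure_tensor_sum_append[of "pure_tensor s1 s2" n x "\<lambda>_. s1 c a" y "\<lambda>_. b" 1] by simp
    finally show ?case using ab xy(1) v1.subspace_scale[OF V]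
      by (intro exI[of _ "n + 1"] exI[of _ "\<lambda>i. if i < n then x i else s1 c a"]
            exI[of _ "\<lambda>i. if i < n then y i else b"]) auto
  qed
  then show ?thesis using that by blast
qed

lemma tensor_lift_linear:
  "linear_on tensor_scale s3 (tensor_product s1 s2 V W) (tensor_lift s1 s2 V W m)"
  unfolding linear_on_def
proof (intro conjI ballI allI)
  fix t u assume t: "t \<in> tensor_product s1 s2 V W" and u: "u \<in> tensor_product s1 s2 V W"
  obtain n :: nat and x y
    where xy: "\<forall>i<n. x i \<in> V \<and> y i \<in> W" "t = (\<Sum>i<n. pure_tensor s1 s2 (x i) (y i))"
    by (rule tensor_product_sumE[OF t])
  obtain n' :: nat and x' y'
    where xy': "\<forall>i<n'. x' i \<in> V \<and> y' i \<in> W" "u = (\<Sum>i<n'. pure_tensor s1 s2 (x' i) (y' i))"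
    by (rule tensor_product_sumE[OF u])
  let ?x = "\<lambda>i. if i < n then x i else x' (i - n)" and ?y = "\<lambda>i. if i < n then y i else y' (i - n)"
  have "tensor_lift s1 s2 V W m (t + u) = (\<Sum>i<n + n'. m (?x i) (?y i))"
    unfolding xy(2) xy'(2) pure_tensor_sum_append[symmetric]
    by (rule tensor_lift_sum) (use xy(1) xy'(1) in auto)
  then show "tensor_lift s1 s2 V W m (t + u) = tensor_lift s1 s2 V W m t + tensor_lift s1 s2 V W m u"
    using tensor_lift_sum[of n x y] tensor_lift_sum[of n' x' y'] xy xy'
    by (simp add: pure_tensor_sum_append)
next
  fix c t assume t: "t \<in> tensor_product s1 s2 V W"
  obtain n :: nat and x y
    where xy: "\<forall>i<n. x i \<in> V \<and> y i \<in> W" "t = (\<Sum>i<n. pure_tensor s1 s2 (x i) (y i))"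
    by (rule tensor_product_sumE[OF t])
  have "tensor_scale c t = (\<Sum>i<n. pure_tensor s1 s2 (s1 c (x i)) (y i))"
    by (simp add: xy(2) t.scale_sum_right pure_tensor_scale)
  then have "tensor_lift s1 s2 V W m (tensor_scale c t) = (\<Sum>i<n. m (s1 c (x i)) (y i))"
    using tensor_lift_sum[of n "\<lambda>i. s1 c (x i)" y] xy(1) v1.subspace_scale[OF V] by simp
  also have "\<dots> = (\<Sum>i<n. s3 c (m (x i) (y i)))"
    using m xy(1) by (intro sum.cong) (auto simp: bilinear_on_def linear_on_def)
  also have "\<dots> = s3 c (tensor_lift s1 s2 V W m t)"
    using tensor_lift_sum[of n x y] xy by (simp add: v3.scale_sum_right)
  finally show "tensor_lift s1 s2 V W m (tensor_scale c t) = s3 c (tensor_lift s1 s2 V W m t)" .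
qed

lemma tensor_lift_unique:
  assumes h: "linear_on tensor_scale s3 (tensor_product s1 s2 V W) h"
    and hm: "\<And>x y. x \<in> V \<Longrightarrow> y \<in> W \<Longrightarrow> h (pure_tensor s1 s2 x y) = m x y"
    and t: "t \<in> tensor_product s1 s2 V W"
  shows "h t = tensor_lift s1 s2 V W m t"
proof -
  let ?T = "tensor_product s1 s2 V W"
  obtain n :: nat and x y
    where xy: "\<forall>i<n. x i \<in> V \<and> y i \<in> W" "t = (\<Sum>i<n. pure_tensor s1 s2 (x i) (y i))"
    by (rule tensor_product_sumE[OF t])
  have sub: "t.subspace ?T" unfolding tensor_product_def by (rule t.subspace_span)
  have pT: "pure_tensor s1 s2 a b \<in> ?T" if "a \<in> V" "b \<in> W" for a b
    unfolding tensor_product_def using that by (intro t.span_base) blast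
  have h0: "h 0 = 0"
  proof -
    have "h (0 + 0) = h 0 + h 0"
      using h t.subspace_0[OF sub] unfolding linear_on_def by blast
    then show ?thesis by simp
  qed
  have "h (\<Sum>i<k. pure_tensor s1 s2 (x i) (y i)) = (\<Sum>i<k. m (x i) (y i))" if "k \<le> n" for k
    using that
  proof (induction k)
    case (Suc k)
    have "(\<Sum>i<k. pure_tensor s1 s2 (x i) (y i)) \<in> ?T" "pure_tensor s1 s2 (x k) (y k) \<in> ?T"
      using Suc.prems xy(1) by (auto intro!: t.subspace_sum[OF sub] pT)
    then have "h ((\<Sum>i<k. pure_tensor s1 s2 (x i) (y i)) + pure_tensor s1 s2 (x k) (y k))
        = h (\<Sum>i<k. pure_tensor s1 s2 (x i) (y i)) + h (pure_tensor s1 s2 (x k) (y k))"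
      using h unfolding linear_on_def by blast
    then show ?case using Suc xy(1) hm by (simp only: sum.lessThan_Suc)
  qed (simp add: h0)
  from this[of n] show ?thesis using tensor_lift_sum[of n x y] xy by simp
qed

end


section \<open>Nonassociative algebras\<close>

locale nonassoc_algebra = vector_space scale
  for scale :: "'k::field \<Rightarrow> 'a::ab_group_add \<Rightarrow> 'a" (infixr \<open>*s\<close> 75) +
  fixes X :: "'a set" and mult :: "'a \<Rightarrow> 'a \<Rightarrow> 'a"
  assumes subspace_carrier: "subspace X"
    and mult_closed: "x \<in> X \<Longrightarrow> y \<in> X \<Longrightarrow> mult x y \<in> X"
    and mult_bilinear: "bilinear_on scale scale scale X X mult"

locale jordan_algebra = nonassoc_algebra +
  assumes mult_commute: "x \<in> X \<Longrightarrow> y \<in> X \<Longrightarrow> mult x y = mult y x"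
    and jordan_identity: "x \<in> X \<Longrightarrow> y \<in> X \<Longrightarrow>
      mult (mult (mult x x) y) x = mult (mult x x) (mult y x)"

locale lie_algebra = nonassoc_algebra +
  assumes mult_self: "x \<in> X \<Longrightarrow> mult x x = 0"
    and jacobi_identity: "x \<in> X \<Longrightarrow> y \<in> X \<Longrightarrow> z \<in> X \<Longrightarrow>
      mult (mult x y) z + mult (mult y z) x + mult (mult z x) y = 0"

definition algebra_iso ::
  "('k \<Rightarrow> 'a::plus \<Rightarrow> 'a) \<Rightarrow> 'a set \<Rightarrow> ('a \<Rightarrow> 'a \<Rightarrow> 'a) \<Rightarrow>
     ('k \<Rightarrow> 'b::plus \<Rightarrow> 'b) \<Rightarrow> 'b set \<Rightarrow> ('b \<Rightarrow> 'b \<Rightarrow> 'b) \<Rightarrow> ('a \<Rightarrow> 'b) \<Rightarrow> bool" where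
  "algebra_iso s1 X m1 s2 Y m2 \<phi> \<longleftrightarrow>
     linear_on s1 s2 X \<phi> \<and> bij_betw \<phi> X Y \<and> (\<forall>x\<in>X. \<forall>y\<in>X. \<phi> (m1 x y) = m2 (\<phi> x) (\<phi> y))"

text \<open>
  An operator on the carrier \<open>X\<close> is represented by the function that is \<open>0\<close> outside \<open>X\<close>, so that
  operators agree as functions iff they agree on \<open>X\<close>. Operators act on the right: the product
  \<open>F G\<close> is \<open>F\<close> followed by \<open>G\<close>, and \<open>op_commutator F G\<close> is \<open>F G - G F\<close>.
\<close>

definition right_mult :: "'a set \<Rightarrow> ('a \<Rightarrow> 'a \<Rightarrow> 'a) \<Rightarrow> 'a \<Rightarrow> 'a \<Rightarrow> 'a::zero" where
  "right_mult X m a = (\<lambda>x. if x \<in> X then m x a else 0)"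

definition op_commutator :: "('a \<Rightarrow> 'a) \<Rightarrow> ('a \<Rightarrow> 'a) \<Rightarrow> 'a \<Rightarrow> 'a::minus" where
  "op_commutator F G = (\<lambda>x. G (F x) - F (G x))"

definition mult_bracket :: "'a set \<Rightarrow> ('a \<Rightarrow> 'a \<Rightarrow> 'a) \<Rightarrow> 'a \<Rightarrow> 'a \<Rightarrow> 'a \<Rightarrow> 'a::ab_group_add" where
  "mult_bracket X m a b = op_commutator (right_mult X m a) (right_mult X m b)"

definition bracket_span ::
  "('k::field \<Rightarrow> 'a::ab_group_add \<Rightarrow> 'a) \<Rightarrow> 'a set \<Rightarrow> ('a \<Rightarrow> 'a \<Rightarrow> 'a) \<Rightarrow>
     'a set \<Rightarrow> 'a set \<Rightarrow> ('a \<Rightarrow> 'a) set" where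
  "bracket_span s X m S T = module.span (fun_scale s) {mult_bracket X m x y | x y. x \<in> S \<and> y \<in> T}"

definition inner_derivations ::
  "'a set \<Rightarrow> ('a \<Rightarrow> 'a \<Rightarrow> 'a) \<Rightarrow> ('a \<Rightarrow> 'a::ab_group_add) set" where
  "inner_derivations X m =
     {(\<Sum>i<n. mult_bracket X m (a i) (b i)) | (n::nat) a b. \<forall>i<n. a i \<in> X \<and> b i \<in> X}"

definition derivations ::
  "('k \<Rightarrow> 'a::ab_group_add \<Rightarrow> 'a) \<Rightarrow> 'a set \<Rightarrow> ('a \<Rightarrow> 'a \<Rightarrow> 'a) \<Rightarrow> ('a \<Rightarrow> 'a) set" where
  "derivations s X m =
     {d. linear_on s s X d \<and> d ` X \<subseteq> X \<and> (\<forall>x. x \<notin> X \<longrightarrow> d x = 0) \<and>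
         (\<forall>x\<in>X. \<forall>y\<in>X. d (m x y) = m (d x) y + m x (d y))}"


section \<open>Coalgebras and their dual algebras\<close>

locale coalgebra = vector_space scale
  for scale :: "'k::field \<Rightarrow> 'a::ab_group_add \<Rightarrow> 'a" (infixr \<open>*s\<close> 75) +
  fixes A :: "'a set" and \<Delta> :: "'a \<Rightarrow> ('a, 'a, 'k) tensor"
  assumes subspace_space: "subspace A"
    and comult_linear: "linear_on scale tensor_scale A \<Delta>"
    and comult_closed: "\<Delta> ` A \<subseteq> tensor_product scale scale A A"
begin

text \<open>Linear functionals on \<open>A\<close> are represented by functions that are \<open>0\<close> outside \<open>A\<close>.\<close>

definition dual :: "('a \<Rightarrow> 'k) set" where
  "dual = {f. linear_on scale (*) A f \<and> (\<forall>x. x \<notin> A \<longrightarrow> f x = 0)}"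

definition dual_mult :: "('a \<Rightarrow> 'k) \<Rightarrow> ('a \<Rightarrow> 'k) \<Rightarrow> 'a \<Rightarrow> 'k" where
  "dual_mult f g =
     (\<lambda>a. if a \<in> A then tensor_lift scale scale A A (\<lambda>x y. f x * g y) (\<Delta> a) else 0)"

definition subcoalgebra :: "'a set \<Rightarrow> bool" where
  "subcoalgebra B \<longleftrightarrow> subspace B \<and> B \<subseteq> A \<and> \<Delta> ` B \<subseteq> tensor_product scale scale B B"

end

abbreviation dual_scale :: "'k::field \<Rightarrow> ('a \<Rightarrow> 'k) \<Rightarrow> 'a \<Rightarrow> 'k" where
  "dual_scale \<equiv> fun_scale (*)"

locale jordan_coalgebra = coalgebra +
  assumes dual_jordan: "jordan_algebra dual_scale dual dual_mult"

locale lie_coalgebra = coalgebra +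
  assumes dual_lie: "lie_algebra dual_scale dual dual_mult"


section \<open>The Lie algebra of the dual and the space it is dual to\<close>

context coalgebra
begin

definition weakly_inner_derivations :: "(('a \<Rightarrow> 'k) \<Rightarrow> ('a \<Rightarrow> 'k)) set" where
  "weakly_inner_derivations =
     {d \<in> derivations dual_scale dual dual_mult.
        \<forall>B. subcoalgebra B \<and> (\<exists>S. finite S \<and> B = span S) \<longrightarrow>
          (\<exists>i \<in> inner_derivations dual dual_mult. \<forall>f\<in>dual. \<forall>b\<in>B. d f b = i f b)}"


subsection \<open>The null extension\<close>

definition action :: "('a \<Rightarrow> 'k) \<Rightarrow> 'a \<Rightarrow> 'a" where
  "action f a = tensor_lift scale scale A A (\<lambda>x y. f y *s x) (\<Delta> a)"

definition ext_carrier :: "(('a \<Rightarrow> 'k) \<times> 'a) set" where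
  "ext_carrier = dual \<times> A"

definition ext_scale :: "'k \<Rightarrow> ('a \<Rightarrow> 'k) \<times> 'a \<Rightarrow> ('a \<Rightarrow> 'k) \<times> 'a" where
  "ext_scale = module_prod.scale dual_scale scale"

definition ext_mult :: "('a \<Rightarrow> 'k) \<times> 'a \<Rightarrow> ('a \<Rightarrow> 'k) \<times> 'a \<Rightarrow> ('a \<Rightarrow> 'k) \<times> 'a" where
  "ext_mult u v =
     (dual_mult (fst u) (fst v), action (fst u) (snd v) + action (fst v) (snd u))"

definition ext_right_mult :: "'a \<Rightarrow> ('a \<Rightarrow> 'k) \<times> 'a \<Rightarrow> ('a \<Rightarrow> 'k) \<times> 'a" where
  "ext_right_mult a = right_mult ext_carrier ext_mult (0, a)"

definition ext_bracket :: "('a \<Rightarrow> 'k) \<Rightarrow> 'a \<Rightarrow> ('a \<Rightarrow> 'k) \<times> 'a \<Rightarrow> ('a \<Rightarrow> 'k) \<times> 'a" where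
  "ext_bracket f a = mult_bracket ext_carrier ext_mult (f, 0) (0, a)"


subsection \<open>The space \<open>L(A)\<close>\<close>

definition bracket_space :: "(('a \<Rightarrow> 'k) \<times> 'a \<Rightarrow> ('a \<Rightarrow> 'k) \<times> 'a) set" where
  "bracket_space = bracket_span ext_scale ext_carrier ext_mult (dual \<times> {0}) ({0} \<times> A)"

definition R_space :: "(('a \<Rightarrow> 'k) \<times> 'a \<Rightarrow> ('a \<Rightarrow> 'k) \<times> 'a) set" where
  "R_space = {ext_right_mult b + v | b v. b \<in> A \<and> v \<in> bracket_space}"

text \<open>The third factor is the copy of \<open>A\<close>; similarly for \<open>L_dual\<close> below.\<close>

definition L_space :: "('a \<times> (('a \<Rightarrow> 'k) \<times> 'a \<Rightarrow> ('a \<Rightarrow> 'k) \<times> 'a) \<times> 'a) set" where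
  "L_space = A \<times> R_space \<times> A"

definition L_scale ::
  "'k \<Rightarrow> 'a \<times> (('a \<Rightarrow> 'k) \<times> 'a \<Rightarrow> ('a \<Rightarrow> 'k) \<times> 'a) \<times> 'a \<Rightarrow>
     'a \<times> (('a \<Rightarrow> 'k) \<times> 'a \<Rightarrow> ('a \<Rightarrow> 'k) \<times> 'a) \<times> 'a" where
  "L_scale = module_prod.scale scale (module_prod.scale (fun_scale ext_scale) scale)"


subsection \<open>The Lie algebra \<open>L(A\<^sup>*)\<close>\<close>

definition R_dual :: "(('a \<Rightarrow> 'k) \<Rightarrow> ('a \<Rightarrow> 'k)) set" where
  "R_dual = {right_mult dual dual_mult f + d | f d. f \<in> dual \<and> d \<in> weakly_inner_derivations}"

text \<open>
  When \<open>A\<^sup>*\<close> has a unity, the decomposition of an element of \<open>R_dual\<close> is unique, so the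
  descriptions in \<open>R_eps\<close> and \<open>R_pairing\<close> are proper.
\<close>

definition R_eps :: "(('a \<Rightarrow> 'k) \<Rightarrow> ('a \<Rightarrow> 'k)) \<Rightarrow> ('a \<Rightarrow> 'k) \<Rightarrow> ('a \<Rightarrow> 'k)" where
  "R_eps r = (THE r'. \<exists>f\<in>dual. \<exists>d\<in>weakly_inner_derivations.
      r = right_mult dual dual_mult f + d \<and> r' = - right_mult dual dual_mult f + d)"

definition nabla :: "('a \<Rightarrow> 'k) \<Rightarrow> ('a \<Rightarrow> 'k) \<Rightarrow> ('a \<Rightarrow> 'k) \<Rightarrow> ('a \<Rightarrow> 'k)" where
  "nabla a b = right_mult dual dual_mult (dual_mult a b) - mult_bracket dual dual_mult a b"

definition L_dual :: "(('a \<Rightarrow> 'k) \<times> (('a \<Rightarrow> 'k) \<Rightarrow> ('a \<Rightarrow> 'k)) \<times> ('a \<Rightarrow> 'k)) set" where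
  "L_dual = dual \<times> R_dual \<times> dual"

definition L_dual_scale ::
  "'k \<Rightarrow> ('a \<Rightarrow> 'k) \<times> (('a \<Rightarrow> 'k) \<Rightarrow> ('a \<Rightarrow> 'k)) \<times> ('a \<Rightarrow> 'k) \<Rightarrow>
     ('a \<Rightarrow> 'k) \<times> (('a \<Rightarrow> 'k) \<Rightarrow> ('a \<Rightarrow> 'k)) \<times> ('a \<Rightarrow> 'k)" where
  "L_dual_scale = module_prod.scale dual_scale (module_prod.scale (fun_scale dual_scale) dual_scale)"

definition L_bracket ::
  "('a \<Rightarrow> 'k) \<times> (('a \<Rightarrow> 'k) \<Rightarrow> ('a \<Rightarrow> 'k)) \<times> ('a \<Rightarrow> 'k) \<Rightarrow>
   ('a \<Rightarrow> 'k) \<times> (('a \<Rightarrow> 'k) \<Rightarrow> ('a \<Rightarrow> 'k)) \<times> ('a \<Rightarrow> 'k) \<Rightarrow>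
   ('a \<Rightarrow> 'k) \<times> (('a \<Rightarrow> 'k) \<Rightarrow> ('a \<Rightarrow> 'k)) \<times> ('a \<Rightarrow> 'k)" where
  "L_bracket u v = (case (u, v) of ((a1, d1, b1), (a2, d2, b2)) \<Rightarrow>
     (d2 a1 - d1 a2,
      nabla a1 b2 - nabla a2 b1 + op_commutator d1 d2,
      R_eps d2 b1 - R_eps d1 b2))"


subsection \<open>The pairing\<close>

text \<open>
  For a Jordan coalgebra in characteristic other than \<open>2\<close>, finitely many elements of \<open>A\<close> lie in a
  finite-dimensional subcoalgebra, on which \<open>d\<close> agrees with an inner derivation; hence the sum in
  \<open>bracket_pairing\<close> does not depend on how \<open>v\<close> is written as a sum of operators \<open>[f, a]\<close>.
\<close>

definition bracket_pairing ::
  "(('a \<Rightarrow> 'k) \<Rightarrow> ('a \<Rightarrow> 'k)) \<Rightarrow> (('a \<Rightarrow> 'k) \<times> 'a \<Rightarrow> ('a \<Rightarrow> 'k) \<times> 'a) \<Rightarrow> 'k" where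
  "bracket_pairing d v = (THE p. \<exists>(n::nat) f a. (\<forall>i<n. f i \<in> dual \<and> a i \<in> A) \<and>
      v = (\<Sum>i<n. ext_bracket (f i) (a i)) \<and> p = (\<Sum>i<n. d (f i) (a i)))"

definition R_pairing ::
  "(('a \<Rightarrow> 'k) \<Rightarrow> ('a \<Rightarrow> 'k)) \<Rightarrow> (('a \<Rightarrow> 'k) \<times> 'a \<Rightarrow> ('a \<Rightarrow> 'k) \<times> 'a) \<Rightarrow> 'k" where
  "R_pairing r w = (THE p. \<exists>g\<in>dual. \<exists>d\<in>weakly_inner_derivations. \<exists>b\<in>A. \<exists>v\<in>bracket_space.
      r = right_mult dual dual_mult g + d \<and> w = ext_right_mult b + v \<and>
      p = g b + bracket_pairing d v)"

definition L_pairing ::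
  "('a \<Rightarrow> 'k) \<times> (('a \<Rightarrow> 'k) \<Rightarrow> ('a \<Rightarrow> 'k)) \<times> ('a \<Rightarrow> 'k) \<Rightarrow>
     'a \<times> (('a \<Rightarrow> 'k) \<times> 'a \<Rightarrow> ('a \<Rightarrow> 'k) \<times> 'a) \<times> 'a \<Rightarrow> 'k" where
  "L_pairing u x = (case (u, x) of ((f, r, h), (a, w, c)) \<Rightarrow> f a + R_pairing r w + h c)"

definition L_functional ::
  "('a \<Rightarrow> 'k) \<times> (('a \<Rightarrow> 'k) \<Rightarrow> ('a \<Rightarrow> 'k)) \<times> ('a \<Rightarrow> 'k) \<Rightarrow>
     'a \<times> (('a \<Rightarrow> 'k) \<times> 'a \<Rightarrow> ('a \<Rightarrow> 'k) \<times> 'a) \<times> 'a \<Rightarrow> 'k" where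
  "L_functional u = (\<lambda>x. if x \<in> L_space then L_pairing u x else 0)"

end

end

theory Submission
  imports Defs
begin

text \<open>
  In a Jordan algebra a word in the multiplication operators is, up to shorter words, skew-symmetric
  in its letters of odd position. For an element \<open>a\<close> of a Jordan coalgebra the functionals
  annihilating \<open>a\<close> have finite codimension, so all sufficiently long words applied to \<open>a\<close> reduce
  to shorter ones and \<open>a\<close> lies in a finite-dimensional subcoalgebra. On such a subcoalgebra a
  weakly inner derivation is inner, and inner derivations separate the points of \<open>[A\<^sup>*, A]\<close>;
  this gives \<open>WIntDer(A\<^sup>*) = [A\<^sup>*, A]\<^sup>*\<close> and hence \<open>L(A)\<^sup>* = L(A\<^sup>*)\<close>.

  A bilinear product on \<open>L(A)\<^sup>*\<close> comes from a comultiplication iff for every \<open>x\<close> in \<open>L(A)\<close> the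
  form \<open>(u, v) \<mapsto> \<langle>[u, v], x\<rangle>\<close> is a finite sum of products of evaluations. For \<open>r\<close> in \<open>R(A\<^sup>*)\<close> and a
  finite-dimensional subcoalgebra containing \<open>a\<close>, with basis \<open>b\<^sub>i\<close> and dual functionals \<open>f\<^sub>i\<close>, one has
  \<open>\<langle>f r, a\<rangle> = \<Sum> \<langle>f, b\<^sub>i\<rangle> \<langle>f\<^sub>i r, a\<rangle>\<close>, which yields such sums for all components of the bracket. The Jacobi
  identity of \<open>L(A\<^sup>*)\<close> rests on \<open>[a \<nabla> b, r] = (a r) \<nabla> b + a \<nabla> (b \<epsilon>(r))\<close>.
\<close>

section \<open>Functionals and tensors\<close>

text \<open>Local finiteness has to come from the Jordan identity. The second tool is that the
  annihilator of a subcoalgebra is an ideal preserved by inner derivations, so that a claim at one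
  point of \<open>A\<close> can be checked with an inner derivation in place of a weakly inner one.
  The unit separates the summands: derivations kill \<open>e\<close> and \<open>[f, a]\<close> kills
  \<open>(e, 0)\<close>, while \<open>f'\<close> and \<open>b'\<close> return \<open>f\<close> and
  \<open>b\<close> there. This makes the definite descriptions in \<open>R_eps\<close> and
  \<open>R_pairing\<close> determinate. Characteristic not 2 enters when the Jordan identity is
  linearized and when a letter occurs twice in a word. \<open>L_bracket\<close> is the
  Tits-Kantor-Koecher construction with weakly inner derivations in place of inner ones; the larger
  space is forced, since a functional on the possibly infinite-dimensional
  \<open>[A\<^sup>*, A]\<close> is inner only locally.\<close>

definition functionals :: "('k::field \<Rightarrow> 'a::ab_group_add \<Rightarrow> 'a) \<Rightarrow> 'a set \<Rightarrow> ('a \<Rightarrow> 'k) set" where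
  "functionals s V = {f. linear_on s (*) V f \<and> (\<forall>x. x \<notin> V \<longrightarrow> f x = 0)}"

lemma linear_on_sum:
  assumes "vector_space s" "vector_space s'" "linear_on s s' V f" "module.subspace s V"
    and "\<And>i. i \<in> I \<Longrightarrow> x i \<in> V"
  shows "f (\<Sum>i\<in>I. x i) = (\<Sum>i\<in>I. f (x i))"
proof -
  interpret v: vector_space s by fact
  have "f (0 + 0) = f 0 + f 0"
    using assms(3) v.subspace_0[OF assms(4)] unfolding linear_on_def by blast
  then have f0: "f 0 = 0" by simp
  show ?thesis
    using assms(5)
  proof (induction I rule: infinite_finite_induct)
    case (insert i I)
    have "x i \<in> V" "(\<Sum>i\<in>I. x i) \<in> V"
      using insert.prems by (auto intro!: v.subspace_sum[OF assms(4)])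
    then have "f (x i + (\<Sum>i\<in>I. x i)) = f (x i) + f (\<Sum>i\<in>I. x i)"
      using assms(3) unfolding linear_on_def by blast
    with insert show ?case by simp
  qed (simp_all add: f0)
qed

lemma linear_on_0:
  assumes "vector_space s" "vector_space s'" "linear_on s s' V f" "module.subspace s V"
  shows "f 0 = 0"
  using linear_on_sum[OF assms, of "{}"] by simp

lemma linear_on_diff:
  assumes "vector_space s" "vector_space s'" "linear_on s s' V f" "module.subspace s V"
    and "x \<in> V" "y \<in> V"
  shows "f (x - y) = f x - f y"
proof -
  interpret v: vector_space s by fact
  have "x - y \<in> V" using v.subspace_diff assms by blast
  then have "f (x - y + y) = f (x - y) + f y"
    using assms(3,6) unfolding linear_on_def by blast
  then show ?thesis by simp
qed

lemma functionals_subspace: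
  assumes "vector_space s" "module.subspace s V"
  shows "module.subspace (fun_scale (*)) (functionals s V)"
proof -
  interpret t: vector_space "fun_scale (*) :: 'a \<Rightarrow> ('b \<Rightarrow> 'a) \<Rightarrow> _"
    by (rule vector_space_fun_scale[OF vector_space_field])
  show ?thesis
    by (rule t.subspaceI) (auto simp: functionals_def linear_on_def fun_scale_def algebra_simps)
qed

context vector_space
begin

lemma functionalsI:
  assumes "linear_on scale (*) V f"
  shows "subspace V \<Longrightarrow> (\<lambda>x. if x \<in> V then f x else 0) \<in> functionals scale V"
  using assms by (auto simp: functionals_def linear_on_def subspace_add subspace_scale)

text \<open>A basis of the span is extended to a basis of the entire space, so the coordinate
  functions \<open>c e\<close> are linear everywhere and not just on \<open>span S\<close>; they can
  then be restricted to any subspace.\<close>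

lemma dual_basis:
  assumes "finite S"
  obtains E c where "finite E" "E \<subseteq> span S" "\<And>e. Vector_Spaces.linear scale (*) (c e)"
    "\<And>x. x \<in> span S \<Longrightarrow> x = (\<Sum>e\<in>E. c e x *s e)"
proof -
  obtain E where E: "E \<subseteq> S" "independent E" "S \<subseteq> span E"
    using maximal_independent_subset[of S] by blast
  have fin: "finite E" using E(1) assms finite_subset by blast
  have sp: "span S = span E"
    by (metis E(1,3) span_mono span_span subset_antisym)
  define F where "F = extend_basis E"
  have F: "E \<subseteq> F" "independent F" "span F = UNIV"
    unfolding F_def using extend_basis_superset E(2) independent_extend_basis span_extend_basis by auto
  have lin: "Vector_Spaces.linear scale (*) (\<lambda>x. representation F x e)" for e
    using F by (simp add: Vector_Spaces.linear_iff vector_space_axioms vector_space_field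
        representation_add representation_scale)
  have repr: "x = (\<Sum>e\<in>E. representation F x e *s e)" if "x \<in> span E" for x
  proof -
    have "representation F x = representation E x"
      by (rule representation_extend[OF F(2) that F(1)])
    then show ?thesis using sum_representation_eq[OF E(2) that fin subset_refl] by simp
  qed
  have "E \<subseteq> span S" using sp span_superset[of E] by simp
  then show ?thesis
    by (rule that[OF fin _ lin repr[folded sp]])
qed

lemma linear_imp_linear_on: "Vector_Spaces.linear scale s' f \<Longrightarrow> linear_on scale s' V f"
  by (simp add: linear_on_def Vector_Spaces.linear_iff)

lemma functionals_separate:
  assumes V: "subspace V" and x: "x \<in> V" and f: "\<And>f. f \<in> functionals scale V \<Longrightarrow> f x = 0"
  shows "x = 0"
proof -
  obtain E c where E: "finite E" "E \<subseteq> span {x}" "\<And>e. Vector_Spaces.linear scale (*) (c e)"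
    "\<And>y. y \<in> span {x} \<Longrightarrow> y = (\<Sum>e\<in>E. c e y *s e)"
    by (rule dual_basis[of "{x}"]) auto
  have "c e x = 0" for e
    using f[OF functionalsI[OF linear_imp_linear_on[OF E(3)[of e]] V]] x by auto
  then have "(\<Sum>e\<in>E. c e x *s e) = 0" by simp
  moreover have "x = (\<Sum>e\<in>E. c e x *s e)" by (rule E(4)) (simp add: span_base)
  ultimately show ?thesis by simp
qed

lemma functionals_cong_imp_eq:
  assumes V: "subspace V" and "x \<in> V" "y \<in> V" and "\<And>f. f \<in> functionals scale V \<Longrightarrow> f x = f y"
  shows "x = y"
proof -
  have "x - y = 0"
  proof (rule functionals_separate[OF V])
    show "x - y \<in> V" using assms subspace_diff by blast
    fix f assume f: "f \<in> functionals scale V"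
    have "f (x - y) = f x - f y"
      by (rule linear_on_diff[OF vector_space_axioms vector_space_field _ V assms(2,3)])
         (use f in \<open>simp add: functionals_def\<close>)
    then show "f (x - y) = 0" using assms(4)[OF f] by simp
  qed
  then show ?thesis by simp
qed

text \<open>Products of functionals separate tensors. The left factors are expanded in a basis of
  their span; the element paired with each basis vector \<open>e\<close> is then killed by every
  functional, hence is zero.\<close>

lemma tensor_sum_eq_0:
  fixes n :: nat
  assumes V: "subspace V" and xy: "\<And>i. i < n \<Longrightarrow> x i \<in> V \<and> y i \<in> V"
    and fg: "\<And>f g. f \<in> functionals scale V \<Longrightarrow> g \<in> functionals scale V \<Longrightarrow> (\<Sum>i<n. f (x i) * g (y i)) = 0"
  shows "(\<Sum>i<n. pure_tensor scale scale (x i) (y i)) = 0"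
proof
  fix \<beta>
  obtain E c where E: "finite E" "E \<subseteq> span (x ` {..<n})" "\<And>e. Vector_Spaces.linear scale (*) (c e)"
    "\<And>y. y \<in> span (x ` {..<n}) \<Longrightarrow> y = (\<Sum>e\<in>E. c e y *s e)"
    by (rule dual_basis[of "x ` {..<n}"]) auto
  have z: "(\<Sum>i<n. c e (x i) *s y i) = 0" for e
  proof (rule functionals_separate[OF V])
    show "(\<Sum>i<n. c e (x i) *s y i) \<in> V"
      using xy by (auto intro!: subspace_sum subspace_scale V)
    fix g assume g: "g \<in> functionals scale V"
    have lg: "linear_on scale (*) V g" using g by (simp add: functionals_def)
    have "g (\<Sum>i<n. c e (x i) *s y i) = (\<Sum>i<n. g (c e (x i) *s y i))"
      by (rule linear_on_sum[OF vector_space_axioms vector_space_field lg V])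
         (use xy in \<open>auto intro!: subspace_scale V\<close>)
    also have "\<dots> = (\<Sum>i<n. (if x i \<in> V then c e (x i) else 0) * g (y i))"
      using lg xy by (intro sum.cong) (auto simp: linear_on_def)
    also have "\<dots> = 0"
      by (rule fg[OF functionalsI[OF linear_imp_linear_on[OF E(3)[of e]] V] g])
    finally show "g (\<Sum>i<n. c e (x i) *s y i) = 0" .
  qed
  show "(\<Sum>i<n. pure_tensor scale scale (x i) (y i)) \<beta> = 0 \<beta>"
  proof (cases "bilinear_on scale scale (*) UNIV UNIV \<beta>")
    case True
    then have l1: "linear_on scale (*) UNIV (\<lambda>x. \<beta> x y)" and l2: "linear_on scale (*) UNIV (\<beta> x)" for x y
      by (auto simp: bilinear_on_def)
    note sum1 = linear_on_sum[OF vector_space_axioms vector_space_field l1 subspace_UNIV]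
      and sum2 = linear_on_sum[OF vector_space_axioms vector_space_field l2 subspace_UNIV]
    have "(\<Sum>i<n. \<beta> (x i) (y i)) = (\<Sum>i<n. \<beta> (\<Sum>e\<in>E. c e (x i) *s e) (y i))"
      by (intro sum.cong refl arg_cong2[of _ _ _ _ \<beta>] E(4)) (auto intro: span_base)
    also have "\<dots> = (\<Sum>i<n. \<Sum>e\<in>E. \<beta> e (c e (x i) *s y i))"
      using l1 l2 by (intro sum.cong) (auto simp: sum1 linear_on_def)
    also have "\<dots> = (\<Sum>e\<in>E. \<beta> e (\<Sum>i<n. c e (x i) *s y i))"
      by (subst sum.swap) (simp add: sum2)
    also have "\<dots> = 0"
      using linear_on_0[OF vector_space_axioms vector_space_field l2 subspace_UNIV] by (simp add: z)
    finally show ?thesis using True by (simp add: sum_fun_apply pure_tensor_def)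
  qed (simp add: sum_fun_apply pure_tensor_def)
qed

text \<open>Finite-dimensional duality: a space of functionals whose only common zero on
  \<open>span S\<close> is 0 restricts onto the whole dual of \<open>span S\<close>. The induction
  runs over \<open>T \<subseteq> S\<close>, while separation is kept for all of
  \<open>span S\<close>, where the test vector \<open>w\<close> of the second case lies.\<close>

lemma separating_functionals:
  assumes I: "module.subspace (fun_scale (*)) I"
    and lin: "\<And>i. i \<in> I \<Longrightarrow> Vector_Spaces.linear scale (*) i"
    and sep: "\<And>w. w \<in> span S \<Longrightarrow> (\<And>i. i \<in> I \<Longrightarrow> i w = 0) \<Longrightarrow> w = 0"
    and S: "finite S" "T \<subseteq> S" and \<phi>: "linear_on scale (*) (span S) \<phi>"
  shows "\<exists>i\<in>I. \<forall>w\<in>span T. i w = \<phi> w"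
proof -
  interpret t: vector_space "fun_scale (*) :: 'a \<Rightarrow> ('b \<Rightarrow> 'a) \<Rightarrow> _"
    by (rule vector_space_fun_scale[OF vector_space_field])
  have "finite T" using S finite_subset by blast
  then show ?thesis using S(2) \<phi>
  proof (induction T arbitrary: \<phi> rule: finite_induct)
    case empty
    then show ?case
      using linear_on_0[OF vector_space_axioms vector_space_field empty(2)] t.subspace_0[OF I]
      by (auto simp: zero_fun_def)
  next
    case (insert t T)
    have sub: "span T \<subseteq> span S" "t \<in> span S" "T \<subseteq> S"
      using insert.prems by (auto simp: span_mono span_base)
    obtain E c where E: "finite E" "E \<subseteq> span T" "\<And>e. Vector_Spaces.linear scale (*) (c e)"
      "\<And>y. y \<in> span T \<Longrightarrow> y = (\<Sum>e\<in>E. c e y *s e)"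
      by (rule dual_basis[OF insert(1)]) auto
    have "\<forall>e. \<exists>j\<in>I. \<forall>w\<in>span T. j w = c e w"
      using insert.IH[OF sub(3)] linear_imp_linear_on[OF E(3)] by blast
    then obtain j where j: "\<And>e. j e \<in> I" "\<And>e w. w \<in> span T \<Longrightarrow> j e w = c e w" by metis
    obtain i where i: "i \<in> I" "\<And>w. w \<in> span T \<Longrightarrow> i w = \<phi> w"
      using insert.IH[OF sub(3) insert.prems(2)] by blast
    have split: "\<exists>w0\<in>span T. \<exists>c. w = w0 + c *s t" if w: "w \<in> span (insert t T)" for w
    proof -
      obtain k where "w - k *s t \<in> span T" using w span_breakdown_eq by blast
      then show ?thesis by (intro bexI[of _ "w - k *s t"] exI[of _ k]) auto
    qed
    have agree: "\<exists>i\<in>I. \<forall>w\<in>span (insert t T). i w = \<phi> w"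
      if i': "i' \<in> I" "\<And>w. w \<in> span T \<Longrightarrow> i' w = \<phi> w" "i' t = \<phi> t" for i'
    proof (intro bexI[of _ i'] ballI i'(1))
      fix w assume "w \<in> span (insert t T)"
      then obtain w0 k where w: "w0 \<in> span T" "w = w0 + k *s t" using split by blast
      interpret l: Vector_Spaces.linear scale "(*)" i' by (rule lin[OF i'(1)])
      have "\<phi> w = \<phi> w0 + k * \<phi> t"
        using insert.prems(2) sub w(1) unfolding linear_on_def w(2)
        by (metis span_scale subsetD)
      then show "i' w = \<phi> w" using i' w by (simp add: l.add l.scale)
    qed
    show ?case
    \<comment> \<open>Either some functional in \<open>I\<close> vanishes on \<open>span T\<close>
      but not at \<open>t\<close>, and a multiple of it corrects the value at \<open>t\<close>; or
      there is none, and then \<open>t\<close> already lies in \<open>span T\<close>.\<close>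
    proof (cases "\<exists>j\<in>I. (\<forall>w\<in>span T. j w = 0) \<and> j t \<noteq> 0")
      case True
      then obtain j where jj: "j \<in> I" "\<And>w. w \<in> span T \<Longrightarrow> j w = 0" "j t \<noteq> 0" by blast
      show ?thesis
      proof (rule agree)
        show "i + fun_scale (*) ((\<phi> t - i t) / j t) j \<in> I"
          by (intro t.subspace_add[OF I i(1)] t.subspace_scale[OF I] jj)
      qed (use jj i in \<open>simp_all add: fun_scale_def\<close>)
    next
      case False
      \<comment> \<open>\<open>j e\<close> realizes the coordinate at \<open>e\<close> inside
        \<open>I\<close>. Any \<open>i\<close> minus the combination of the \<open>j e\<close> with
        coefficients \<open>i e\<close> vanishes on \<open>span T\<close>, hence at \<open>t\<close>
        in this case, which is exactly \<open>i w = 0\<close>.\<close>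
      define w where "w = t - (\<Sum>e\<in>E. j e t *s e)"
      have Es: "(\<Sum>e\<in>E. j e t *s e) \<in> span T"
        using E(2) by (auto intro!: span_sum span_scale)
      have "w = 0"
      proof (rule sep)
        show "w \<in> span S" unfolding w_def using sub Es span_diff by blast
        fix i assume i: "i \<in> I"
        interpret l: Vector_Spaces.linear scale "(*)" i by (rule lin[OF i])
        define i' where "i' = i - (\<Sum>e\<in>E. fun_scale (*) (i e) (j e))"
        have "i' \<in> I" unfolding i'_def
          by (intro t.subspace_diff[OF I] t.subspace_sum[OF I] t.subspace_scale[OF I] i j)
        moreover have "i' w = 0" if "w \<in> span T" for w
        proof -
          have "i w = i (\<Sum>e\<in>E. c e w *s e)" by (rule arg_cong[OF E(4)[OF that]])
          also have "\<dots> = (\<Sum>e\<in>E. i e * j e w)"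
            by (simp add: l.sum l.scale j(2)[OF that] mult.commute)
          finally show ?thesis by (simp add: i'_def sum_fun_apply fun_scale_def)
        qed
        ultimately have "i' t = 0" using False by blast
        then show "i w = 0"
          by (simp add: w_def i'_def l.diff l.sum l.scale sum_fun_apply fun_scale_def mult.commute)
      qed
      then have tT: "t \<in> span T" using Es by (simp add: w_def)
      show ?thesis by (rule agree[OF i(1)]) (use i tT in auto)
    qed
  qed
qed

end

section \<open>Comultiplications from products on the dual\<close>

lemma bilinear_on_functionals:
  "f \<in> functionals s V \<Longrightarrow> g \<in> functionals s W \<Longrightarrow> bilinear_on s s (*) V W (\<lambda>x y. f x * g y)"
  by (auto simp: functionals_def bilinear_on_def linear_on_def algebra_simps)

lemma (in vector_space) tensor_eqI:
  assumes V: "subspace V"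
    and t: "t \<in> tensor_product scale scale V V" and u: "u \<in> tensor_product scale scale V V"
    and eq: "\<And>f g. f \<in> functionals scale V \<Longrightarrow> g \<in> functionals scale V \<Longrightarrow>
      tensor_lift scale scale V V (\<lambda>x y. f x * g y) t = tensor_lift scale scale V V (\<lambda>x y. f x * g y) u"
  shows "t = u"
proof -
  interpret t: vector_space "tensor_scale :: 'a \<Rightarrow> ('b, 'b, 'a) tensor \<Rightarrow> _"
    by (rule vector_space_fun_scale[OF vector_space_field])
  note ctx = vector_space_axioms vector_space_axioms vector_space_field V V
  have sub: "t.subspace (tensor_product scale scale V V)"
    unfolding tensor_product_def by (rule t.subspace_span)
  have tu: "t - u \<in> tensor_product scale scale V V" using t u sub t.subspace_diff by blast
  obtain n :: nat and x y where xy: "\<forall>i<n. x i \<in> V \<and> y i \<in> V"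
    "t - u = (\<Sum>i<n. pure_tensor scale scale (x i) (y i))"
    by (rule tensor_product_sumE[OF ctx _ tu, of "\<lambda>_ _. 0"]) (auto simp: bilinear_on_def linear_on_def)
  have "(\<Sum>i<n. pure_tensor scale scale (x i) (y i)) = 0"
  proof (rule tensor_sum_eq_0[OF V])
    fix f g assume fg: "f \<in> functionals scale V" "g \<in> functionals scale V"
    note bil = bilinear_on_functionals[OF fg]
    have "(\<Sum>i<n. f (x i) * g (y i)) = tensor_lift scale scale V V (\<lambda>x y. f x * g y) (t - u)"
      unfolding xy(2) by (rule tensor_lift_sum[OF ctx bil, symmetric]) (use xy in auto)
    also have "\<dots> = tensor_lift scale scale V V (\<lambda>x y. f x * g y) t - tensor_lift scale scale V V (\<lambda>x y. f x * g y) u"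
      by (rule linear_on_diff[OF t.vector_space_axioms vector_space_field tensor_lift_linear[OF ctx bil] sub t u])
    finally show "(\<Sum>i<n. f (x i) * g (y i)) = 0" using eq[OF fg] by simp
  qed (use xy in auto)
  then show ?thesis using xy(2) by simp
qed

text \<open>\<open>B\<close> is the intended product of functionals. A finite-rank expression of
  \<open>B f g x\<close> is the value of \<open>f \<otimes> g\<close> at a tensor, and since such
  products separate tensors that tensor is unique; uniqueness makes the pointwise choice of
  \<open>\<Delta>\<close> linear.\<close>

lemma (in vector_space) comult_exists:
  assumes V: "subspace V"
    and lin: "\<And>f g. f \<in> functionals scale V \<Longrightarrow> g \<in> functionals scale V \<Longrightarrow> linear_on scale (*) V (B f g)"
    and rep: "\<And>x. x \<in> V \<Longrightarrow> \<exists>(n::nat) y z. (\<forall>i<n. y i \<in> V \<and> z i \<in> V) \<and>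
      (\<forall>f\<in>functionals scale V. \<forall>g\<in>functionals scale V. B f g x = (\<Sum>i<n. f (y i) * g (z i)))"
  shows "\<exists>\<Delta>. coalgebra scale V \<Delta> \<and>
    (\<forall>f\<in>functionals scale V. \<forall>g\<in>functionals scale V. \<forall>x\<in>V.
       tensor_lift scale scale V V (\<lambda>x y. f x * g y) (\<Delta> x) = B f g x)"
proof -
  interpret t: vector_space "tensor_scale :: 'a \<Rightarrow> ('b, 'b, 'a) tensor \<Rightarrow> _"
    by (rule vector_space_fun_scale[OF vector_space_field])
  let ?T = "tensor_product scale scale V V"
  let ?l = "\<lambda>f g. tensor_lift scale scale V V (\<lambda>x y. f x * g y)"
  note ctx = vector_space_axioms vector_space_axioms vector_space_field V V
  have sub: "t.subspace ?T"
    unfolding tensor_product_def by (rule t.subspace_span)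
  have "\<exists>t. t \<in> ?T \<and> (\<forall>f\<in>functionals scale V. \<forall>g\<in>functionals scale V. ?l f g t = B f g x)"
    if x: "x \<in> V" for x
  proof -
    obtain n :: nat and y z where yz: "\<forall>i<n. y i \<in> V \<and> z i \<in> V"
      "\<forall>f\<in>functionals scale V. \<forall>g\<in>functionals scale V. B f g x = (\<Sum>i<n. f (y i) * g (z i))"
      using rep[OF x] by blast
    have "(\<Sum>i<n. pure_tensor scale scale (y i) (z i)) \<in> ?T"
      by (rule t.subspace_sum[OF sub]) (use yz in \<open>auto simp: tensor_product_def intro!: t.span_base\<close>)
    moreover have "?l f g (\<Sum>i<n. pure_tensor scale scale (y i) (z i)) = B f g x"
      if "f \<in> functionals scale V" "g \<in> functionals scale V" for f g
      using tensor_lift_sum[OF ctx bilinear_on_functionals[OF that], of n y z] yz that by simp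
    ultimately show ?thesis by blast
  qed
  then obtain \<Delta> where \<Delta>: "\<And>x. x \<in> V \<Longrightarrow> \<Delta> x \<in> ?T"
    "\<And>x f g. x \<in> V \<Longrightarrow> f \<in> functionals scale V \<Longrightarrow> g \<in> functionals scale V \<Longrightarrow> ?l f g (\<Delta> x) = B f g x"
    by metis
  have l: "linear_on tensor_scale (*) ?T (?l f g)"
    if "f \<in> functionals scale V" "g \<in> functionals scale V" for f g
    by (rule tensor_lift_linear[OF ctx bilinear_on_functionals[OF that]])
  have "linear_on scale tensor_scale V \<Delta>"
    unfolding linear_on_def
  proof (intro conjI ballI allI)
    fix x y assume xy: "x \<in> V" "y \<in> V"
    then have xy': "x + y \<in> V" using V subspace_add by blast
    show "\<Delta> (x + y) = \<Delta> x + \<Delta> y"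
    proof (rule tensor_eqI[OF V \<Delta>(1)[OF xy'] t.subspace_add[OF sub \<Delta>(1)[OF xy(1)] \<Delta>(1)[OF xy(2)]]])
      fix f g assume fg: "f \<in> functionals scale V" "g \<in> functionals scale V"
      have "?l f g (\<Delta> x + \<Delta> y) = ?l f g (\<Delta> x) + ?l f g (\<Delta> y)"
        using l[OF fg] \<Delta>(1) xy unfolding linear_on_def by blast
      moreover have "B f g (x + y) = B f g x + B f g y"
        using lin[OF fg] xy unfolding linear_on_def by blast
      ultimately show "?l f g (\<Delta> (x + y)) = ?l f g (\<Delta> x + \<Delta> y)" using \<Delta>(2) fg xy xy' by simp
    qed
  next
    fix c x assume x: "x \<in> V"
    then have x': "c *s x \<in> V" using V subspace_scale by blast
    show "\<Delta> (c *s x) = tensor_scale c (\<Delta> x)"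
    proof (rule tensor_eqI[OF V \<Delta>(1)[OF x'] t.subspace_scale[OF sub \<Delta>(1)[OF x]]])
      fix f g assume fg: "f \<in> functionals scale V" "g \<in> functionals scale V"
      have "?l f g (tensor_scale c (\<Delta> x)) = c * ?l f g (\<Delta> x)"
        using l[OF fg] \<Delta>(1) x unfolding linear_on_def by blast
      moreover have "B f g (c *s x) = c * B f g x"
        using lin[OF fg] x unfolding linear_on_def by blast
      ultimately show "?l f g (\<Delta> (c *s x)) = ?l f g (tensor_scale c (\<Delta> x))" using \<Delta>(2) fg x x' by simp
    qed
  qed
  then have "coalgebra scale V \<Delta>"
    by unfold_locales (use V \<Delta>(1) in auto)
  with \<Delta>(2) show ?thesis by blast
qed

section \<open>Dual algebras of coalgebras\<close>

context coalgebra
begin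

notation dual_mult (infixl \<open>\<odot>\<close> 70)

text \<open>\<open>functionals\<close> makes no reference to a comultiplication, so it can be used
  for \<open>L_space\<close> before one has been constructed there.\<close>

lemma dual_eq_functionals: "dual = functionals scale A"
  by (simp add: dual_def functionals_def)

lemma dual_add: "f \<in> dual \<Longrightarrow> x \<in> A \<Longrightarrow> y \<in> A \<Longrightarrow> f (x + y) = f x + f y"
  by (simp add: dual_def linear_on_def)

lemma dual_scale: "f \<in> dual \<Longrightarrow> x \<in> A \<Longrightarrow> f (c *s x) = c * f x"
  by (simp add: dual_def linear_on_def)

lemma dual_sum: "f \<in> dual \<Longrightarrow> (\<And>i. i \<in> I \<Longrightarrow> x i \<in> A) \<Longrightarrow> f (\<Sum>i\<in>I. x i) = (\<Sum>i\<in>I. f (x i))"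
  by (rule linear_on_sum[OF vector_space_axioms vector_space_field _ subspace_space])
     (auto simp: dual_def)

lemma dual_diff: "f \<in> dual \<Longrightarrow> x \<in> A \<Longrightarrow> y \<in> A \<Longrightarrow> f (x - y) = f x - f y"
  by (rule linear_on_diff[OF vector_space_axioms vector_space_field _ subspace_space])
     (auto simp: dual_def)

lemma dual_0: "f \<in> dual \<Longrightarrow> f 0 = 0"
  using dual_diff[of f 0 0] subspace_0[OF subspace_space] by simp

lemma dual_outside: "f \<in> dual \<Longrightarrow> x \<notin> A \<Longrightarrow> f x = 0"
  by (simp add: dual_def)

lemma dual_separates: "x \<in> A \<Longrightarrow> y \<in> A \<Longrightarrow> (\<And>f. f \<in> dual \<Longrightarrow> f x = f y) \<Longrightarrow> x = y"
  unfolding dual_eq_functionals by (rule functionals_cong_imp_eq[OF subspace_space])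

lemma dual_eqI: "f \<in> dual \<Longrightarrow> g \<in> dual \<Longrightarrow> (\<And>x. x \<in> A \<Longrightarrow> f x = g x) \<Longrightarrow> f = g"
  by (metis dual_outside ext)

lemma dual_subspace: "module.subspace dual_scale dual"
  unfolding dual_eq_functionals by (rule functionals_subspace[OF vector_space_axioms subspace_space])

lemma dual_restrict: "linear_on scale (*) A f \<Longrightarrow> (\<lambda>x. if x \<in> A then f x else 0) \<in> dual"
  unfolding dual_eq_functionals by (rule functionalsI[OF _ subspace_space])

lemma subcoalgebra_space: "subcoalgebra A"
  using subspace_space comult_closed by (auto simp: subcoalgebra_def)

lemma comult_sum:
  fixes n :: nat
  assumes "a \<in> A" "\<Delta> a = (\<Sum>i<n. pure_tensor scale scale (x i) (y i))" "\<And>i. i < n \<Longrightarrow> x i \<in> A \<and> y i \<in> A"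
  shows "f \<in> dual \<Longrightarrow> g \<in> dual \<Longrightarrow> (f \<odot> g) a = (\<Sum>i<n. f (x i) * g (y i))"
    and "f \<in> dual \<Longrightarrow> action f a = (\<Sum>i<n. f (y i) *s x i)"
proof -
  note ctx = vector_space_axioms vector_space_axioms
  show "(f \<odot> g) a = (\<Sum>i<n. f (x i) * g (y i))" if "f \<in> dual" "g \<in> dual"
    unfolding dual_mult_def using assms(1)
    by (simp add: assms(2) tensor_lift_sum[OF ctx vector_space_field subspace_space subspace_space
          bilinear_on_functionals[OF that[unfolded dual_eq_functionals]]] assms(3))
  show "action f a = (\<Sum>i<n. f (y i) *s x i)" if f: "f \<in> dual"
    unfolding action_def assms(2)
    by (rule tensor_lift_sum[OF ctx vector_space_axioms subspace_space subspace_space])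
       (use f assms(3) in \<open>auto simp: bilinear_on_def linear_on_def dual_def algebra_simps\<close>)
qed

text \<open>The Sweedler sum of \<open>b\<close> is chosen inside \<open>B\<close>, while the lifts
  defining product and action are taken over \<open>A\<close>; both fit together because
  \<open>pure_tensor\<close> does not depend on the subspace.\<close>

lemma comultE:
  assumes B: "subcoalgebra B" "b \<in> B"
  obtains n :: nat and x y where "\<And>i. i < n \<Longrightarrow> x i \<in> B \<and> y i \<in> B"
    "\<And>f g. f \<in> dual \<Longrightarrow> g \<in> dual \<Longrightarrow> (f \<odot> g) b = (\<Sum>i<n. f (x i) * g (y i))"
    "\<And>f. f \<in> dual \<Longrightarrow> action f b = (\<Sum>i<n. f (y i) *s x i)"
proof -
  have BA: "subspace B" "B \<subseteq> A" "\<Delta> b \<in> tensor_product scale scale B B"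
    using B by (auto simp: subcoalgebra_def)
  obtain n :: nat and x y where xy: "\<forall>i<n. x i \<in> B \<and> y i \<in> B"
    "\<Delta> b = (\<Sum>i<n. pure_tensor scale scale (x i) (y i))"
    \<comment> \<open>The zero map only fills the place of the bilinear map that
      \<open>tensor_product_sumE\<close> inherits from its context.\<close>
    by (rule tensor_product_sumE[OF vector_space_axioms vector_space_axioms vector_space_field
          BA(1,1) _ BA(3), of "\<lambda>_ _. 0"]) (auto simp: bilinear_on_def linear_on_def)
  have "b \<in> A" "\<And>i. i < n \<Longrightarrow> x i \<in> A \<and> y i \<in> A" using B(2) BA(2) xy(1) by auto
  from comult_sum[OF this(1) xy(2) this(2)] xy(1) show ?thesis using that by blast
qed

lemma subcoalgebra_subspace: "subcoalgebra B \<Longrightarrow> subspace B"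
  and subcoalgebra_subset: "subcoalgebra B \<Longrightarrow> B \<subseteq> A"
  by (simp_all add: subcoalgebra_def)

lemma action_closed:
  assumes B: "subcoalgebra B" "b \<in> B" and f: "f \<in> dual"
  shows "action f b \<in> B"
proof -
  obtain n :: nat and x y where xy: "\<And>i. i < n \<Longrightarrow> x i \<in> B \<and> y i \<in> B"
    "\<And>f g. f \<in> dual \<Longrightarrow> g \<in> dual \<Longrightarrow> (f \<odot> g) b = (\<Sum>i<n. f (x i) * g (y i))"
    "\<And>f. f \<in> dual \<Longrightarrow> action f b = (\<Sum>i<n. f (y i) *s x i)"
    by (rule comultE[OF B]) (rule that)
  note B' = subcoalgebra_subspace[OF B(1)]
  show ?thesis unfolding xy(3)[OF f]
    by (rule subspace_sum[OF B']) (use xy(1) subspace_scale[OF B'] in auto)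
qed

lemma action_in: "a \<in> A \<Longrightarrow> f \<in> dual \<Longrightarrow> action f a \<in> A"
  by (rule action_closed[OF subcoalgebra_space])

text \<open>Exhibits \<open>action f\<close> as the transpose of right multiplication by
  \<open>f\<close>. Identities of the dual algebra pass through it to \<open>A\<close>, where
  equality is tested by functionals.\<close>

lemma dual_action: "h \<in> dual \<Longrightarrow> f \<in> dual \<Longrightarrow> a \<in> A \<Longrightarrow> h (action f a) = (h \<odot> f) a"
proof -
  assume *: "h \<in> dual" "f \<in> dual" "a \<in> A"
  obtain n :: nat and x y where xy: "\<And>i. i < n \<Longrightarrow> x i \<in> A \<and> y i \<in> A"
    "\<And>f g. f \<in> dual \<Longrightarrow> g \<in> dual \<Longrightarrow> (f \<odot> g) a = (\<Sum>i<n. f (x i) * g (y i))"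
    "\<And>f. f \<in> dual \<Longrightarrow> action f a = (\<Sum>i<n. f (y i) *s x i)"
    by (rule comultE[OF subcoalgebra_space *(3)]) (rule that)
  have "h (\<Sum>i<n. f (y i) *s x i) = (\<Sum>i<n. h (f (y i) *s x i))"
    by (rule dual_sum[OF *(1)]) (use xy in \<open>auto intro!: subspace_scale subspace_space\<close>)
  also have "\<dots> = (\<Sum>i<n. h (x i) * f (y i))"
    using dual_scale[OF *(1)] xy(1) by (intro sum.cong) auto
  finally show ?thesis using xy * by simp
qed

lemma dual_mult_closed:
  assumes "f \<in> dual" "g \<in> dual" shows "f \<odot> g \<in> dual"
proof -
  interpret t: vector_space "tensor_scale :: 'k \<Rightarrow> ('a, 'a, 'k) tensor \<Rightarrow> _"
    by (rule vector_space_fun_scale[OF vector_space_field])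
  note l = tensor_lift_linear[OF vector_space_axioms vector_space_axioms vector_space_field subspace_space subspace_space
          bilinear_on_functionals[OF assms[unfolded dual_eq_functionals]]]
  have "linear_on scale (*) A (\<lambda>a. tensor_lift scale scale A A (\<lambda>x y. f x * g y) (\<Delta> a))"
    using l comult_linear comult_closed unfolding linear_on_def
    by (simp add: image_subset_iff)
  then show ?thesis unfolding dual_mult_def by (rule dual_restrict)
qed

lemma dual_add_closed [intro]: "f \<in> dual \<Longrightarrow> g \<in> dual \<Longrightarrow> f + g \<in> dual"
  and dual_scale_closed [intro]: "f \<in> dual \<Longrightarrow> dual_scale c f \<in> dual"
  and dual_diff_closed [intro]: "f \<in> dual \<Longrightarrow> g \<in> dual \<Longrightarrow> f - g \<in> dual"
  and dual_minus_closed [intro]: "f \<in> dual \<Longrightarrow> - f \<in> dual"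
  and dual_0_closed [intro]: "0 \<in> dual"
proof -
  interpret t: vector_space "dual_scale :: 'k \<Rightarrow> ('a \<Rightarrow> 'k) \<Rightarrow> _"
    by (rule vector_space_fun_scale[OF vector_space_field])
  note s = dual_subspace
  show "f \<in> dual \<Longrightarrow> g \<in> dual \<Longrightarrow> f + g \<in> dual" "f \<in> dual \<Longrightarrow> dual_scale c f \<in> dual"
    "f \<in> dual \<Longrightarrow> g \<in> dual \<Longrightarrow> f - g \<in> dual" "f \<in> dual \<Longrightarrow> - f \<in> dual" "0 \<in> dual"
    by (auto intro: t.subspace_add[OF s] t.subspace_scale[OF s] t.subspace_diff[OF s]
        t.subspace_neg[OF s] t.subspace_0[OF s])
qed

lemma dual_nonassoc_algebra: "nonassoc_algebra dual_scale dual dual_mult"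
proof -
  interpret t: vector_space "dual_scale :: 'k \<Rightarrow> ('a \<Rightarrow> 'k) \<Rightarrow> _"
    by (rule vector_space_fun_scale[OF vector_space_field])
  show ?thesis
  proof
    show "bilinear_on dual_scale dual_scale dual_scale dual dual dual_mult"
      unfolding bilinear_on_def linear_on_def
    proof (intro conjI ballI allI)
      fix f g h c assume fg: "f \<in> dual" "g \<in> dual" "h \<in> dual"
      show "(f + g) \<odot> h = f \<odot> h + g \<odot> h"
        by (rule dual_eqI, use fg in \<open>auto intro!: dual_mult_closed\<close>)
           (erule comultE[OF subcoalgebra_space],
            use fg in \<open>simp add: dual_mult_closed dual_add_closed algebra_simps sum.distrib\<close>)
      show "h \<odot> (f + g) = h \<odot> f + h \<odot> g"
        by (rule dual_eqI, use fg in \<open>auto intro!: dual_mult_closed\<close>)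
           (erule comultE[OF subcoalgebra_space],
            use fg in \<open>simp add: dual_mult_closed dual_add_closed algebra_simps sum.distrib\<close>)
    next
      fix f g c assume fg: "f \<in> dual" "g \<in> dual"
      show "dual_scale c f \<odot> g = dual_scale c (f \<odot> g)"
        by (rule dual_eqI, use fg in \<open>auto intro!: dual_mult_closed\<close>)
           (erule comultE[OF subcoalgebra_space],
            use fg in \<open>simp add: dual_mult_closed dual_scale_closed, simp add: fun_scale_def algebra_simps sum_distrib_left\<close>)
      show "f \<odot> dual_scale c g = dual_scale c (f \<odot> g)"
        by (rule dual_eqI, use fg in \<open>auto intro!: dual_mult_closed\<close>)
           (erule comultE[OF subcoalgebra_space],
            use fg in \<open>simp add: dual_mult_closed dual_scale_closed, simp add: fun_scale_def algebra_simps sum_distrib_left\<close>)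
    qed
  qed (auto intro: dual_subspace dual_mult_closed)
qed

end

section \<open>Linearized Jordan identities\<close>

context nonassoc_algebra
begin

lemma add_in: "x \<in> X \<Longrightarrow> y \<in> X \<Longrightarrow> x + y \<in> X"
  and diff_in: "x \<in> X \<Longrightarrow> y \<in> X \<Longrightarrow> x - y \<in> X"
  and minus_in: "x \<in> X \<Longrightarrow> - x \<in> X"
  and zero_in: "0 \<in> X"
  and scale_in: "x \<in> X \<Longrightarrow> scale c x \<in> X"
  by (simp_all add: subspace_carrier subspace_add subspace_diff subspace_neg subspace_0 subspace_scale)

lemma mult_add_left: "x \<in> X \<Longrightarrow> y \<in> X \<Longrightarrow> z \<in> X \<Longrightarrow> mult (x + y) z = mult x z + mult y z"
  and mult_add_right: "x \<in> X \<Longrightarrow> y \<in> X \<Longrightarrow> z \<in> X \<Longrightarrow> mult z (x + y) = mult z x + mult z y"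
  and mult_scale_left: "x \<in> X \<Longrightarrow> z \<in> X \<Longrightarrow> mult (scale c x) z = scale c (mult x z)"
  and mult_scale_right: "x \<in> X \<Longrightarrow> z \<in> X \<Longrightarrow> mult z (scale c x) = scale c (mult z x)"
  using mult_bilinear by (simp_all add: bilinear_on_def linear_on_def)

lemma mult_zero_left: "x \<in> X \<Longrightarrow> mult 0 x = 0"
  and mult_zero_right: "x \<in> X \<Longrightarrow> mult x 0 = 0"
  using mult_add_left[of 0 0 x] mult_add_right[of 0 0 x] zero_in by auto

lemma mult_minus_left: "x \<in> X \<Longrightarrow> z \<in> X \<Longrightarrow> mult (- x) z = - mult x z"
  and mult_minus_right: "x \<in> X \<Longrightarrow> z \<in> X \<Longrightarrow> mult z (- x) = - mult z x"
  using mult_add_left[of x "- x" z] mult_add_right[of x "- x" z] minus_in[of x]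
  by (simp_all add: mult_zero_left mult_zero_right add_eq_0_iff)

lemma mult_diff_left: "x \<in> X \<Longrightarrow> y \<in> X \<Longrightarrow> z \<in> X \<Longrightarrow> mult (x - y) z = mult x z - mult y z"
  and mult_diff_right: "x \<in> X \<Longrightarrow> y \<in> X \<Longrightarrow> z \<in> X \<Longrightarrow> mult z (x - y) = mult z x - mult z y"
  using mult_add_left[of x "- y" z] mult_add_right[of x "- y" z] minus_in[of y]
  by (simp_all add: mult_minus_left mult_minus_right)

lemmas mult_distribs = mult_add_left mult_add_right mult_diff_left mult_diff_right
  mult_minus_left mult_minus_right mult_zero_left mult_zero_right mult_scale_left mult_scale_right

lemmas closures = add_in diff_in minus_in zero_in scale_in mult_closed

end

context jordan_algebra
begin

context
  assumes two: "\<And>x. x \<in> X \<Longrightarrow> x + x = 0 \<Longrightarrow> x = 0"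
begin

text \<open>\<open>K p q\<close> is the associator of \<open>q\<close>, \<open>d\<close>,
  \<open>p\<close>, and the Jordan identity says that the cubic map
  \<open>x \<mapsto> K x (x x)\<close> is zero. It is polarized twice, cancelling only 2, so that
  even fields with three elements are covered.\<close>

lemma jordan_linearized:
  assumes X: "a \<in> X" "b \<in> X" "c \<in> X" "d \<in> X"
  shows "mult (mult d (mult a b)) c + mult (mult d (mult b c)) a + mult (mult d (mult c a)) b =
    mult (mult a b) (mult d c) + mult (mult b c) (mult d a) + mult (mult c a) (mult d b)"
proof -
  define K where "K = (\<lambda>p q. mult (mult q d) p - mult q (mult d p))"
  have Kin: "K p q \<in> X" if "p \<in> X" "q \<in> X" for p q
    unfolding K_def using X(4) that by (simp add: closures)
  have K1: "K (p + p') q = K p q + K p' q" "K (p - p') q = K p q - K p' q"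
    if "p \<in> X" "p' \<in> X" "q \<in> X" for p p' q
    unfolding K_def using X(4) that by (simp_all add: closures mult_distribs algebra_simps)
  have K2: "K q (p + p') = K q p + K q p'" "K q (p - p') = K q p - K q p'"
    if "p \<in> X" "p' \<in> X" "q \<in> X" for p p' q
    unfolding K_def using X(4) that by (simp_all add: closures mult_distribs algebra_simps)
  have K0: "K x (mult x x) = 0" if "x \<in> X" for x
    using jordan_identity[OF that X(4)] by (simp add: K_def)
  have quad: "K x (mult x z) + K x (mult x z) + K z (mult x x) = 0" (is "?S = 0")
    if xz: "x \<in> X" "z \<in> X" for x z
  proof -
    note zx = mult_commute[OF xz(2,1)]
    have p: "K (x + z) (mult (x + z) (x + z)) = 0" and m: "K (x - z) (mult (x - z) (x - z)) = 0"
      using K0 xz by (simp_all add: closures)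
    \<comment> \<open>The difference of the values at \<open>x + z\<close> and \<open>x - z\<close>
      keeps the parts of odd degree in \<open>z\<close>: twice the linear part \<open>?S\<close> and
      twice \<open>K z (z z)\<close>, which is zero.\<close>
    have "?S + ?S = K (x + z) (mult (x + z) (x + z)) - K (x - z) (mult (x - z) (x - z))
        - K z (mult z z) - K z (mult z z)"
      using xz by (simp add: mult_distribs closures K1 K2 zx algebra_simps)
    then have "?S + ?S = 0" using p m K0 xz by simp
    then show ?thesis using two[of ?S] xz by (simp add: closures Kin)
  qed
  have "K c (mult a b) + K a (mult b c) + K b (mult c a) = 0" (is "?T = 0")
  proof -
    have "K (a + b) (mult (a + b) c) + K (a + b) (mult (a + b) c) + K c (mult (a + b) (a + b)) = 0"
      (is "?L = 0") using quad[of "a + b" c] X by (simp add: closures)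
    \<comment> \<open>Substituting \<open>a + b\<close> into the form that is quadratic in
      \<open>x\<close> leaves its mixed part; the two pure parts vanish by
      \<open>quad\<close>.\<close>
    moreover have "?L = ?T + ?T
       + (K a (mult a c) + K a (mult a c) + K c (mult a a)) + (K b (mult b c) + K b (mult b c) + K c (mult b b))"
      using X mult_commute[OF X(2,1)] mult_commute[OF X(3,1)]
      by (simp add: mult_distribs closures K1 K2 algebra_simps)
    ultimately have "?T + ?T = 0" using quad X by simp
    then show ?thesis using two[of ?T] X by (simp add: closures Kin)
  qed
  then show ?thesis
    using X mult_commute[of d] by (simp add: K_def closures algebra_simps)
qed

text \<open>Written with operators on the right of \<open>u\<close>, the words
  \<open>f' g' h'\<close> and \<open>h' g' f'\<close> add up to a combination of words of length at
  most two. This is the skew-symmetry, modulo shorter words, in the letters at positions one and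
  three.\<close>

lemma jordan_operator_identity:
  assumes X: "f \<in> X" "g \<in> X" "h \<in> X" "u \<in> X"
  shows "mult (mult (mult u f) g) h + mult (mult (mult u h) g) f + mult u (mult g (mult f h)) =
    mult (mult u f) (mult g h) + mult (mult u g) (mult f h) + mult (mult u h) (mult g f)"
proof -
  note c = mult_commute
  have "mult (mult g (mult u f)) h + mult (mult g (mult f h)) u + mult (mult g (mult h u)) f =
    mult (mult u f) (mult g h) + mult (mult f h) (mult g u) + mult (mult h u) (mult g f)"
    by (rule jordan_linearized) (use X in auto)
  moreover have "mult g (mult u f) = mult (mult u f) g" "mult (mult g (mult f h)) u = mult u (mult g (mult f h))"
    "mult g (mult h u) = mult (mult u h) g" "mult (mult f h) (mult g u) = mult (mult u g) (mult f h)"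
    "mult h u = mult u h"
    using X c[of g "mult u f"] c[of "mult g (mult f h)" u] c[of h u] c[of g "mult u h"] c[of g u]
      c[of "mult f h" "mult u g"] by (simp_all add: closures)
  ultimately show ?thesis by (simp add: add_ac)
qed

text \<open>Take \<open>jordan_linearized\<close> for \<open>x, y, b\<close> with
  \<open>d = a\<close> and for \<open>x, y, a\<close> with \<open>d = b\<close>. The right-hand
  sides agree by commutativity, and subtracting the left-hand sides gives the Leibniz rule for
  \<open>[a, b]\<close>.\<close>

lemma bracket_derivation:
  assumes X: "a \<in> X" "b \<in> X" "x \<in> X" "y \<in> X"
  shows "mult (mult (mult x y) a) b - mult (mult (mult x y) b) a =
    mult (mult (mult x a) b - mult (mult x b) a) y + mult x (mult (mult y a) b - mult (mult y b) a)"
proof -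
  note c = mult_commute
  have "mult (mult a (mult x y)) b + mult (mult a (mult y b)) x + mult (mult a (mult b x)) y =
    mult (mult x y) (mult a b) + mult (mult y b) (mult a x) + mult (mult b x) (mult a y)"
    by (rule jordan_linearized) (use X in auto)
  moreover have "mult (mult b (mult x y)) a + mult (mult b (mult y a)) x + mult (mult b (mult a x)) y =
    mult (mult x y) (mult b a) + mult (mult y a) (mult b x) + mult (mult a x) (mult b y)"
    by (rule jordan_linearized) (use X in auto)
  moreover have "mult b a = mult a b" "mult a x = mult x a" "mult b x = mult x b"
    "mult a y = mult y a" "mult b y = mult y b" using X c by blast+
  moreover have "mult a (mult x y) = mult (mult x y) a" "mult b (mult x y) = mult (mult x y) b"
    "mult a (mult y b) = mult (mult y b) a" "mult b (mult y a) = mult (mult y a) b"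
    "mult a (mult x b) = mult (mult x b) a" "mult b (mult x a) = mult (mult x a) b"
    "mult (mult (mult y b) a) x = mult x (mult (mult y b) a)"
    "mult (mult (mult y a) b) x = mult x (mult (mult y a) b)"
    "mult (mult y b) (mult x a) = mult (mult x a) (mult y b)"
    "mult (mult y a) (mult x b) = mult (mult x b) (mult y a)"
    using X c by (simp_all add: closures)
  ultimately show ?thesis using X by (simp add: mult_distribs closures algebra_simps)
qed

text \<open>In operator form, \<open>[ab, c] + [bc, a] + [ca, b] = 0\<close>: the linearized
  identity with \<open>x\<close> as the element acted on. It supplies the multiplication part of
  \<open>commutator_nabla\<close>.\<close>

lemma bracket_cyclic:
  assumes X: "a \<in> X" "b \<in> X" "c \<in> X" "x \<in> X"
  shows "mult (mult x (mult a b)) c - mult (mult x c) (mult a b)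
    + (mult (mult x (mult b c)) a - mult (mult x a) (mult b c))
    + (mult (mult x (mult c a)) b - mult (mult x b) (mult c a)) = 0"
  using jordan_linearized[OF X] X
    mult_commute[of "mult x c" "mult a b"] mult_commute[of "mult x a" "mult b c"] mult_commute[of "mult x b" "mult c a"]
  by (simp add: closures algebra_simps)

end

end

locale unital_jordan_coalgebra = jordan_coalgebra scale A \<Delta>
  for scale :: "'k::field \<Rightarrow> 'a::ab_group_add \<Rightarrow> 'a" (infixr \<open>*s\<close> 75)
    and A :: "'a set" and \<Delta> :: "'a \<Rightarrow> ('a, 'a, 'k) tensor" +
  fixes e :: "'a \<Rightarrow> 'k"
  assumes two_neq_0: "(2::'k) \<noteq> 0"
    and unit_in: "e \<in> dual" and unit_left: "f \<in> dual \<Longrightarrow> e \<odot> f = f"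
begin

sublocale J: jordan_algebra dual_scale dual dual_mult
  by (rule dual_jordan)

lemma unit_right: "f \<in> dual \<Longrightarrow> f \<odot> e = f"
  using J.mult_commute[OF unit_in] unit_left by metis

lemma dual_two: "f + f = 0 \<Longrightarrow> f = 0" for f :: "'a \<Rightarrow> 'k"
proof -
  assume "f + f = 0"
  then have "2 * f x = 0" for x
    unfolding mult_2 by (metis plus_fun_apply zero_fun_apply)
  then show "f = 0" using two_neq_0 by (simp add: fun_eq_iff)
qed

lemma two_cancel: "x + x \<in> V \<Longrightarrow> subspace V \<Longrightarrow> x \<in> V"
proof -
  assume *: "x + x \<in> V" "subspace V"
  have "inverse 2 *s (x + x) = x"
    using two_neq_0 by (simp add: scale_right_distrib flip: scale_left_distrib)
  then show "x \<in> V" using subspace_scale[OF *(2,1)] by metis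
qed

section \<open>Subcoalgebras as submodules\<close>

text \<open>Pattern for the laws of \<open>action\<close>: apply a functional, move the action into
  the dual algebra by \<open>dual_action\<close>, and use the algebra law there.\<close>

lemma action_add: "f \<in> dual \<Longrightarrow> a \<in> A \<Longrightarrow> b \<in> A \<Longrightarrow> action f (a + b) = action f a + action f b"
  by (rule dual_separates)
     (simp_all add: dual_action dual_add action_in subspace_add[OF subspace_space] dual_mult_closed)

lemma action_scale: "f \<in> dual \<Longrightarrow> a \<in> A \<Longrightarrow> action f (c *s a) = c *s action f a"
  by (rule dual_separates)
     (simp_all add: dual_action dual_scale action_in subspace_scale[OF subspace_space] dual_mult_closed)

lemma action_add_left: "f \<in> dual \<Longrightarrow> g \<in> dual \<Longrightarrow> a \<in> A \<Longrightarrow> action (f + g) a = action f a + action g a"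
  by (rule dual_separates)
     (simp_all add: dual_action dual_add action_in subspace_add[OF subspace_space] dual_add_closed J.mult_distribs)

lemma action_scale_left: "f \<in> dual \<Longrightarrow> a \<in> A \<Longrightarrow> action (dual_scale c f) a = c *s action f a"
  by (rule dual_separates)
     (simp_all add: dual_action dual_scale action_in subspace_scale[OF subspace_space] dual_scale_closed J.mult_distribs,
      simp add: fun_scale_def)

lemma action_zero_left: "a \<in> A \<Longrightarrow> action 0 a = 0"
  using action_add_left[of 0 0 a] by (simp add: dual_0_closed)

lemma action_0: "f \<in> dual \<Longrightarrow> action f 0 = 0"
  using action_add[of f 0 0] subspace_0[OF subspace_space] by simp

lemma action_unit: "a \<in> A \<Longrightarrow> action e a = a"
  by (rule dual_separates) (simp_all add: dual_action action_in unit_in unit_right)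

text \<open>Closure under the action confines the left tensor factors of \<open>\<Delta> b\<close>
  to \<open>B\<close>; commutativity of the dual algebra then confines the right ones. With a
  projection \<open>p\<close> onto \<open>B\<close>, the tensor \<open>\<Delta> b\<close> and its
  image under \<open>p \<otimes> p\<close> have the same value at all
  \<open>f \<otimes> g\<close>.\<close>

lemma subcoalgebraI:
  assumes B: "subspace B" "B \<subseteq> A" and act: "\<And>f b. f \<in> dual \<Longrightarrow> b \<in> B \<Longrightarrow> action f b \<in> B"
  shows "subcoalgebra B"
  unfolding subcoalgebra_def
proof (intro conjI B image_subsetI)
  fix b assume b: "b \<in> B"
  then have bA: "b \<in> A" using B(2) by blast
  note ctx = vector_space_axioms vector_space_axioms vector_space_field subspace_space subspace_space
  interpret t: vector_space "tensor_scale :: 'k \<Rightarrow> ('a, 'a, 'k) tensor \<Rightarrow> _"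
    by (rule vector_space_fun_scale[OF vector_space_field])
  interpret vp: vector_space_pair scale scale by unfold_locales
  obtain p where p: "range p \<subseteq> B" "Vector_Spaces.linear scale scale p" "\<forall>v\<in>B. p v = v"
    using vp.linear_exists_left_inverse_on[OF linear_ident B(1)] by (auto simp: inj_on_def)
  interpret p: Vector_Spaces.linear scale scale p by (rule p)
  have pB: "p x \<in> B" for x using p(1) by auto
  then have pA: "p x \<in> A" for x using B(2) by auto
  define P where "P = (\<lambda>f::'a \<Rightarrow> 'k. \<lambda>x. if x \<in> A then f (p x) else 0)"
  have P: "P f \<in> dual" if "f \<in> dual" for f
    unfolding P_def
    by (rule dual_restrict) (use that pA in \<open>simp add: linear_on_def p.add p.scale dual_add dual_scale\<close>)
  have PB: "P f x = f x" if "x \<in> B" for f x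
    using that B(2) p(3) by (auto simp: P_def)
  have \<Delta>b: "\<Delta> b \<in> tensor_product scale scale A A" using bA comult_closed by blast
  obtain n :: nat and x y where xy: "\<forall>i<n. x i \<in> A \<and> y i \<in> A"
    "\<Delta> b = (\<Sum>i<n. pure_tensor scale scale (x i) (y i))"
    by (rule tensor_product_sumE[OF ctx _ \<Delta>b, of "\<lambda>_ _. 0"]) (auto simp: bilinear_on_def linear_on_def)
  have BB: "(\<Sum>i<n. pure_tensor scale scale (p (x i)) (p (y i))) \<in> tensor_product scale scale B B"
    and AA: "(\<Sum>i<n. pure_tensor scale scale (p (x i)) (p (y i))) \<in> tensor_product scale scale A A"
    unfolding tensor_product_def
    by (rule t.span_sum, rule t.span_base, use pA pB in blast)+
  have "\<Delta> b = (\<Sum>i<n. pure_tensor scale scale (p (x i)) (p (y i)))"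
  proof (rule tensor_eqI[OF subspace_space \<Delta>b AA])
    fix f g assume fg': "f \<in> functionals scale A" "g \<in> functionals scale A"
    then have fg: "f \<in> dual" "g \<in> dual" by (simp_all add: dual_eq_functionals)
    note s = comult_sum(1)[OF bA xy(2)]
    have "tensor_lift scale scale A A (\<lambda>x y. f x * g y) (\<Delta> b) = (f \<odot> g) b"
      using bA by (simp add: dual_mult_def)
    \<comment> \<open>\<open>action g b\<close> lies in \<open>B\<close>, where \<open>f\<close> and
      \<open>P f\<close> agree. After the factors are exchanged, the same argument replaces
      \<open>g\<close> by \<open>P g\<close>.\<close>
    also have "\<dots> = P f (action g b)"
      using fg bA b act by (simp add: dual_action[symmetric] PB)
    also have "\<dots> = (g \<odot> P f) b"
      using fg bA P J.mult_commute by (simp add: dual_action)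
    also have "\<dots> = P g (action (P f) b)"
      using fg bA b act P by (simp add: dual_action[symmetric] PB)
    also have "\<dots> = (P f \<odot> P g) b"
      using fg bA P J.mult_commute by (simp add: dual_action)
    also have "\<dots> = (\<Sum>i<n. f (p (x i)) * g (p (y i)))"
      using s[of "P f" "P g"] xy(1) fg P by (simp add: P_def)
    also have "\<dots> = tensor_lift scale scale A A (\<lambda>x y. f x * g y) (\<Sum>i<n. pure_tensor scale scale (p (x i)) (p (y i)))"
      by (rule tensor_lift_sum[OF ctx bilinear_on_functionals[OF fg'], symmetric]) (use pA in auto)
    finally show "tensor_lift scale scale A A (\<lambda>x y. f x * g y) (\<Delta> b) = \<dots>" .
  qed
  with BB show "\<Delta> b \<in> tensor_product scale scale B B" by simp
qed


section \<open>Local finiteness\<close>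

text \<open>Transpose of \<open>jordan_operator_identity\<close>. Transposition reverses the order
  of composition: the outermost action corresponds to the operator applied to \<open>u\<close>
  first.\<close>

lemma action_jordan:
  assumes "f \<in> dual" "g \<in> dual" "h \<in> dual" "v \<in> A"
  shows "action f (action g (action h v)) + action h (action g (action f v)) + action (g \<odot> (f \<odot> h)) v
    = action f (action (g \<odot> h) v) + action g (action (f \<odot> h) v) + action h (action (g \<odot> f) v)"
proof (rule dual_separates)
  note cl = assms action_in dual_mult_closed subspace_add[OF subspace_space]
  fix u assume u: "u \<in> dual"
  have "(((u \<odot> f) \<odot> g) \<odot> h + ((u \<odot> h) \<odot> g) \<odot> f + u \<odot> (g \<odot> (f \<odot> h))) v
     = ((u \<odot> f) \<odot> (g \<odot> h) + (u \<odot> g) \<odot> (f \<odot> h) + (u \<odot> h) \<odot> (g \<odot> f)) v"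
    using J.jordan_operator_identity[OF dual_two assms(1-3) u] by simp
  then show "u (action f (action g (action h v)) + action h (action g (action f v)) + action (g \<odot> (f \<odot> h)) v)
    = u (action f (action (g \<odot> h) v) + action g (action (f \<odot> h) v) + action h (action (g \<odot> f) v))"
    using u by (simp add: dual_add dual_action cl)
qed (use assms in \<open>auto intro!: subspace_add[OF subspace_space] action_in dual_mult_closed\<close>)

text \<open>Filtration by word length of the space generated by \<open>a\<close> under the action:
  words of at most \<open>m\<close> letters.\<close>

primrec orbit :: "'a \<Rightarrow> nat \<Rightarrow> 'a set" where
  "orbit a 0 = span {a}"
| "orbit a (Suc m) = span (orbit a m \<union> {action f w | f w. f \<in> dual \<and> w \<in> orbit a m})"

lemma subspace_orbit: "subspace (orbit a m)"
  by (cases m) simp_all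

lemma orbit_Suc: "orbit a m \<subseteq> orbit a (Suc m)"
  by (auto intro: span_base)

lemma orbit_mono: "m \<le> n \<Longrightarrow> w \<in> orbit a m \<Longrightarrow> w \<in> orbit a n"
  by (induction n) (use orbit_Suc in \<open>auto simp del: orbit.simps simp: le_Suc_eq\<close>)

lemma action_orbit: "f \<in> dual \<Longrightarrow> w \<in> orbit a m \<Longrightarrow> action f w \<in> orbit a (Suc m)"
  by (auto intro!: span_base)

lemma orbit_subset: "a \<in> A \<Longrightarrow> orbit a m \<subseteq> A"
proof (induction m)
  case (Suc m)
  then show ?case
    unfolding orbit.simps by (intro span_minimal subspace_space) (auto intro: action_in)
qed (auto intro!: span_minimal subspace_space simp: span_singleton subspace_scale[OF subspace_space])

text \<open>\<open>fold\<close> applies the head of the list first, so the head is the letter next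
  to \<open>v\<close>.\<close>

lemma fold_action_orbit: "set gs \<subseteq> dual \<Longrightarrow> v \<in> orbit a m \<Longrightarrow> fold action gs v \<in> orbit a (m + length gs)"
proof (induction gs arbitrary: v m)
  case (Cons g gs)
  then show ?case using Cons.IH[of "action g v" "Suc m"] action_orbit by (simp del: orbit.simps)
qed simp

lemma fold_action_add:
  "set gs \<subseteq> dual \<Longrightarrow> v \<in> A \<Longrightarrow> w \<in> A \<Longrightarrow> fold action gs (v + w) = fold action gs v + fold action gs w"
  by (induction gs arbitrary: v w) (auto simp: action_add action_in)

lemma fold_action_scale:
  "set gs \<subseteq> dual \<Longrightarrow> v \<in> A \<Longrightarrow> fold action gs (c *s v) = c *s fold action gs v"
  by (induction gs arbitrary: v) (auto simp: action_scale action_in)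

lemma fold_action_0: "set gs \<subseteq> dual \<Longrightarrow> fold action gs 0 = 0"
  by (induction gs) (auto simp: action_0)

text \<open>
  Modulo shorter words, \<open>action_jordan\<close> makes a word in the operators skew-symmetric in the first
  and third letters. So passing from \<open>v\<close> to \<open>action h (action f v)\<close> adds \<open>f\<close> to the
  space of those \<open>k\<close> that act on \<open>v\<close> without raising its degree, and this space has finite
  codimension.
\<close>

lemma long_words:
  assumes a: "a \<in> A"
  shows "finite F \<Longrightarrow> card F = n \<Longrightarrow> F \<subseteq> dual \<Longrightarrow> v \<in> orbit a p \<Longrightarrow>
    dual \<subseteq> J.span (F \<union> {k \<in> dual. action k v \<in> orbit a p}) \<Longrightarrow>
    set gs \<subseteq> dual \<Longrightarrow> length gs = Suc (2 * n) \<Longrightarrow> fold action gs v \<in> orbit a (p + 2 * n)"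
proof (induction n arbitrary: F v p gs)
  case 0
  let ?K = "{k \<in> dual. action k v \<in> orbit a p}"
  have v: "v \<in> A" using 0 orbit_subset[OF a] by blast
  have sub: "J.subspace ?K"
    using v subspace_orbit[of a p] action_zero_left[OF v]
    by (intro J.subspaceI) (auto simp: action_add_left action_scale_left subspace_add subspace_scale subspace_0)
  have "F = {}" using 0 by simp
  then have "dual \<subseteq> ?K" using 0(5) J.span_minimal[OF subset_refl sub] by auto
  moreover obtain g where "gs = [g]" using 0 by (cases gs) auto
  ultimately show ?case using 0 by auto
next
  case (Suc n)
  let ?K = "{k \<in> dual. action k v \<in> orbit a p}"
  obtain g h rest where gs: "gs = g # h # rest" "length rest = Suc (2 * n)"
    using Suc.prems by (cases gs; cases "tl gs") auto
  have h: "h \<in> dual" and rest: "set rest \<subseteq> dual" and g: "g \<in> dual" using Suc.prems gs by auto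
  have v: "v \<in> A" using Suc.prems orbit_subset[OF a] by blast
  let ?q = "p + 2 * Suc n"
  \<comment> \<open>The first letters that give the bound form a subspace, so it is enough to treat
    those in \<open>F\<close> and those in \<open>?K\<close>.\<close>
  let ?G = "{g \<in> dual. fold action rest (action h (action g v)) \<in> orbit a ?q}"
  have "J.subspace ?G"
  proof (rule J.subspaceI)
    show "0 \<in> ?G" using h rest
      by (auto simp: action_zero_left[OF v] action_0 fold_action_0 subspace_0[OF subspace_orbit] dual_0_closed
          simp del: orbit.simps)
  qed (auto simp del: orbit.simps simp: v h rest action_add_left action_scale_left action_add action_scale action_in
      fold_action_add fold_action_scale subspace_add[OF subspace_orbit] subspace_scale[OF subspace_orbit])
  moreover have "?K \<subseteq> ?G"
  proof
    fix k assume k: "k \<in> ?K"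
    \<comment> \<open>\<open>action k v\<close> has not left \<open>orbit a p\<close>, so one degree
      is saved: \<open>p + 1\<close> and the \<open>2 * n + 1\<close> letters of \<open>rest\<close>
      give \<open>?q\<close>.\<close>
    then have "action h (action k v) \<in> orbit a (Suc p)" using action_orbit[OF h] by blast
    from fold_action_orbit[OF rest this] have "fold action rest (action h (action k v)) \<in> orbit a ?q"
      using gs(2) by (simp del: orbit.simps)
    then show "k \<in> ?G" using k by blast
  qed
  moreover have "f \<in> ?G" if f: "f \<in> F" for f
  proof -
    have f': "f \<in> dual" using f Suc.prems by blast
    let ?v = "action h (action f v)"
    let ?K' = "{k \<in> dual. action k ?v \<in> orbit a (p + 2)}"
    have v1: "action f v \<in> orbit a (Suc p)" using Suc.prems action_orbit[OF f'] by blast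
    have v': "?v \<in> orbit a (p + 2)" using action_orbit[OF h v1] by (simp del: orbit.simps)
    have swap: "action k ?v + action f (action h (action k v)) \<in> orbit a (p + 2)" if k: "k \<in> dual" for k
    proof -
      have 1: "action k' v \<in> orbit a (Suc p)" if "k' \<in> dual" for k'
        using action_orbit[OF that] Suc.prems by blast
      have 2: "action k'' (action k' v) \<in> orbit a (p + 2)" if "k' \<in> dual" "k'' \<in> dual" for k' k''
        using action_orbit[OF that(2) 1[OF that(1)]] by (simp del: orbit.simps)
      have "action k ?v + action f (action h (action k v)) = action k (action (h \<odot> f) v)
        + action h (action (k \<odot> f) v) + action f (action (h \<odot> k) v) - action (h \<odot> (k \<odot> f)) v"
        using action_jordan[OF k h f' v] by (simp add: eq_diff_eq)
      also have "\<dots> \<in> orbit a (p + 2)"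
        using k h f' 1[of "h \<odot> (k \<odot> f)"]
        by (intro subspace_diff[OF subspace_orbit] subspace_add[OF subspace_orbit] 2
            orbit_mono[of "Suc p" "p + 2"]) (auto simp del: orbit.simps intro: dual_mult_closed)
      finally show ?thesis .
    qed
    have "?K \<subseteq> ?K'"
    proof
      fix k assume k: "k \<in> ?K"
      then have "action f (action h (action k v)) \<in> orbit a (p + 2)"
        using action_orbit[OF f' action_orbit[OF h]] by (auto simp del: orbit.simps)
      from subspace_diff[OF subspace_orbit swap[of k] this] k show "k \<in> ?K'" by simp
    qed
    \<comment> \<open>For \<open>k = f\<close> the two terms of \<open>swap\<close> coincide, so
      twice \<open>action f ?v\<close> lies in \<open>orbit a (p + 2)\<close> and 2 can be
      cancelled. Hence \<open>f\<close> can leave the finite set in the induction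
      hypothesis.\<close>
    moreover have "f \<in> ?K'" using two_cancel[OF swap[OF f'] subspace_orbit] f' by simp
    ultimately have "F \<union> ?K \<subseteq> (F - {f}) \<union> ?K'" by blast
    then have "dual \<subseteq> J.span ((F - {f}) \<union> ?K')" using J.span_mono Suc.prems(5) by blast
    then have "fold action rest ?v \<in> orbit a (p + 2 + 2 * n)"
      using Suc.IH[of "F - {f}" ?v "p + 2" rest] Suc.prems f v' rest gs(2)
      by (auto simp: card_Diff_singleton)
    then show ?thesis using f' by (simp add: add.assoc del: orbit.simps)
  qed
  ultimately have "J.span (F \<union> ?K) \<subseteq> ?G" by (intro J.span_minimal) auto
  then have "g \<in> ?G" using Suc.prems(5) g by blast
  then show ?case by (simp add: gs del: orbit.simps)
qed

section \<open>Finite-dimensional subcoalgebras\<close>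

lemma subspace_of_finite_span:
  assumes "subspace V" "V \<subseteq> span T" "finite T"
  obtains S where "finite S" "S \<subseteq> V" "V = span S"
proof -
  obtain B where B: "B \<subseteq> V" "independent B" "V \<subseteq> span B"
    using maximal_independent_subset[of V] by blast
  have "finite B" using independent_span_bound[OF assms(3) B(2)] B(1) assms(2) by blast
  moreover have "V = span B" using B span_minimal[OF B(1) assms(1)] by blast
  ultimately show ?thesis using that B by blast
qed

lemma action_range_finite:
  assumes "a \<in> A"
  shows "\<exists>X. finite X \<and> (\<forall>f\<in>dual. action f a \<in> span X)"
proof -
  obtain n :: nat and x y where xy: "\<And>i. i < n \<Longrightarrow> x i \<in> A \<and> y i \<in> A"
    "\<And>f g. f \<in> dual \<Longrightarrow> g \<in> dual \<Longrightarrow> (f \<odot> g) a = (\<Sum>i<n. f (x i) * g (y i))"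
    "\<And>f. f \<in> dual \<Longrightarrow> action f a = (\<Sum>i<n. f (y i) *s x i)"
    by (rule comultE[OF subcoalgebra_space assms]) (rule that)
  then have "\<forall>f\<in>dual. action f a \<in> span (x ` {..<n})"
    by (auto intro!: span_sum intro: span_scale span_base)
  then show ?thesis by blast
qed

lemma orbit_finite:
  assumes a: "a \<in> A"
  shows "\<exists>T. finite T \<and> T \<subseteq> A \<and> orbit a m = span T"
proof (induction m)
  case 0
  then show ?case using a by (intro exI[of _ "{a}"]) auto
next
  case (Suc m)
  then obtain T where T: "finite T" "T \<subseteq> A" "orbit a m = span T" by blast
  have "\<forall>t\<in>T. \<exists>X. finite X \<and> (\<forall>f\<in>dual. action f t \<in> span X)"
    using action_range_finite T by blast
  then obtain X where X: "\<And>t. t \<in> T \<Longrightarrow> finite (X t)" "\<And>t f. t \<in> T \<Longrightarrow> f \<in> dual \<Longrightarrow> action f t \<in> span (X t)"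
    by metis
  let ?U = "T \<union> (\<Union>t\<in>T. X t)"
  have "action f w \<in> span ?U" if f: "f \<in> dual" and w: "w \<in> span T" for f w
  proof -
    have "w \<in> A \<and> action f w \<in> span ?U"
      using w
    proof (induction w rule: span_induct_alt)
      case base
      then show ?case using f by (simp add: action_0 span_zero subspace_0[OF subspace_space])
    next
      case (step c x y)
      then have x: "x \<in> A" using T by blast
      have "action f x \<in> span ?U"
        using X(2)[OF step(1) f] span_mono[of "X x" ?U] step(1) by blast
      with step x f show ?case
        by (simp add: action_add action_scale subspace_add[OF subspace_space] subspace_scale[OF subspace_space]
            span_add span_scale)
    qed
    then show ?thesis ..
  qed
  moreover have "span T \<subseteq> span ?U" by (rule span_mono) auto
  ultimately have "orbit a (Suc m) \<subseteq> span ?U"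
    unfolding orbit.simps T(3) by (intro span_minimal) auto
  then obtain S where "finite S" "S \<subseteq> orbit a (Suc m)" "orbit a (Suc m) = span S"
    using T(1) X(1) by (elim subspace_of_finite_span[OF subspace_orbit]) auto
  then show ?case using orbit_subset[OF a, of "Suc m"] by blast
qed

text \<open>\<open>F\<close> is a finite set of functionals whose images \<open>action f a\<close>
  span the range of the action on \<open>a\<close>; together with \<open>?K\<close> it spans the
  dual. \<open>long_words\<close> with \<open>p = 0\<close> then collapses all words of length
  \<open>2 * card F + 1\<close>, so the filtration stops growing and its last member is closed under
  the action.\<close>

lemma finite_subcoalgebra_singleton:
  assumes a: "a \<in> A"
  shows "\<exists>B T. subcoalgebra B \<and> finite T \<and> B = span T \<and> a \<in> B"
proof -
  let ?R = "(\<lambda>f. action f a) ` dual"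
  let ?K = "{k \<in> dual. action k a \<in> orbit a 0}"
  have "subspace ?R"
  proof (rule subspaceI)
    show "0 \<in> ?R" using action_zero_left[OF a] dual_0_closed by (metis imageI)
  next
    fix x y assume "x \<in> ?R" "y \<in> ?R"
    then obtain f g where "f \<in> dual" "g \<in> dual" "x = action f a" "y = action g a" by blast
    then show "x + y \<in> ?R" using a by (intro image_eqI[of _ _ "f + g"]) (auto simp: action_add_left)
  next
    fix c x assume "x \<in> ?R"
    then obtain f where "f \<in> dual" "x = action f a" by blast
    then show "c *s x \<in> ?R" using a by (intro image_eqI[of _ _ "dual_scale c f"]) (auto simp: action_scale_left)
  qed
  moreover obtain X where "finite X" "?R \<subseteq> span X" using action_range_finite[OF a] by blast
  ultimately obtain S where S: "finite S" "S \<subseteq> ?R" "?R = span S"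
    by (elim subspace_of_finite_span)
  obtain F where F: "finite F" "F \<subseteq> dual" "S = (\<lambda>f. action f a) ` F"
    using finite_subset_image[OF S(1,2)] by blast
  \<comment> \<open>Some combination \<open>h\<close> of \<open>F\<close> acts on \<open>a\<close>
    as \<open>g\<close> does, and the difference sends \<open>a\<close> to 0, so it lies in
    \<open>?K\<close>.\<close>
  have "g \<in> J.span (F \<union> ?K)" if g: "g \<in> dual" for g
  proof -
    have "\<exists>h \<in> J.span F. h \<in> dual \<and> action h a = x" if "x \<in> span S" for x
      using that
    proof (induction x rule: span_induct_alt)
      case base
      then show ?case
        by (intro bexI[of _ 0] conjI dual_0_closed action_zero_left[OF a] J.span_zero)
    next
      case (step c x y)
      then obtain f h where "f \<in> F" "x = action f a" "h \<in> J.span F" "h \<in> dual" "action h a = y"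
        using F(3) by auto
      moreover from this have "f \<in> dual" using F(2) by blast
      ultimately show ?case using a
        by (intro bexI[of _ "dual_scale c f + h"] conjI J.span_add J.span_scale J.span_base[of f F]
            dual_add_closed dual_scale_closed)
           (simp_all only: action_add_left action_scale_left dual_scale_closed)
    qed
    then obtain h where h: "h \<in> J.span F" "h \<in> dual" "action h a = action g a"
      using S(3) g by blast
    have "action (g - h) a = 0"
      using action_add_left[of "g - h" h a] h g a by auto
    then have "g - h \<in> ?K" using g h subspace_0[OF subspace_orbit] by (auto simp del: orbit.simps)
    then have "g - h \<in> J.span (F \<union> ?K)" by (simp add: J.span_base del: orbit.simps)
    moreover have "h \<in> J.span (F \<union> ?K)" using h(1) J.span_mono[of F "F \<union> ?K"] by blast
    ultimately show ?thesis using J.span_add[of "g - h" _ h] by simp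
  qed
  then have dual: "dual \<subseteq> J.span (F \<union> ?K)" by blast
  define N where "N = 2 * card F"
  have word: "fold action gs a \<in> orbit a N" if "set gs \<subseteq> dual" "length gs = Suc N" for gs
    using long_words[OF a F(1) refl F(2) _ dual that(1)] that(2) by (simp add: N_def span_base)
  \<comment> \<open>Generalized to a start \<open>w\<close> of degree \<open>m\<close> and a word of
    \<open>N + 1 - m\<close> letters, so that induction on \<open>m\<close> moves letters from
    \<open>w\<close> into the word; the empty word gives
    \<open>orbit a (Suc N) \<subseteq> orbit a N\<close>.\<close>
  have "fold action gs w \<in> orbit a N" if "w \<in> orbit a m" "set gs \<subseteq> dual" "length gs + m = Suc N" for w gs m
    using that
  proof (induction m arbitrary: w gs)
    case 0
    then obtain c where "w = c *s a" by (auto simp: span_singleton)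
    then show ?case using fold_action_scale[OF 0(2) a] word 0 subspace_scale[OF subspace_orbit]
      by (simp del: orbit.simps)
  next
    case (Suc m)
    let ?G = "{w \<in> A. fold action gs w \<in> orbit a N}"
    have "subspace ?G"
      using Suc.prems(2) subspace_space subspace_orbit[of a N]
      by (intro subspaceI) (auto simp: fold_action_add fold_action_scale fold_action_0 subspace_add subspace_scale subspace_0)
    moreover have "w \<in> ?G" if "w \<in> orbit a m" for w
      using fold_action_orbit[OF Suc.prems(2) that] Suc.prems(3) orbit_subset[OF a] that
      by (auto simp add: add.commute simp del: orbit.simps)
    moreover have "action f w \<in> ?G" if "f \<in> dual" "w \<in> orbit a m" for f w
      using Suc.IH[OF that(2), of "f # gs"] Suc.prems(2,3) that(1) action_in[OF subsetD[OF orbit_subset[OF a] that(2)] that(1)]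
      by auto
    ultimately have "orbit a (Suc m) \<subseteq> ?G"
      unfolding orbit.simps by (intro span_minimal) auto
    then show ?case using Suc.prems(1) by blast
  qed
  from this[of _ "Suc N" "[]"] have stable: "orbit a (Suc N) \<subseteq> orbit a N" by auto
  have "subcoalgebra (orbit a N)"
    by (rule subcoalgebraI[OF subspace_orbit orbit_subset[OF a]]) (use action_orbit stable in blast)
  moreover have "a \<in> orbit a N" by (rule orbit_mono[of 0]) (simp_all add: span_base)
  moreover obtain T where "finite T" "orbit a N = span T" using orbit_finite[OF a] by blast
  ultimately show ?thesis by blast
qed

lemma finite_subcoalgebra:
  assumes "finite S" "S \<subseteq> A"
  shows "\<exists>B T. subcoalgebra B \<and> finite T \<and> B = span T \<and> S \<subseteq> B"
  using assms
proof (induction rule: finite_induct)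
  case empty
  have "subcoalgebra {0}"
    by (rule subcoalgebraI) (auto simp: subspace_0[OF subspace_space] action_0)
  then show ?case by (intro exI[of _ "{0}"] exI[of _ "{}"]) auto
next
  case (insert a S)
  then obtain B T where B: "subcoalgebra B" "finite T" "B = span T" "S \<subseteq> B" by auto
  obtain C U where C: "subcoalgebra C" "finite U" "C = span U" "a \<in> C"
    using finite_subcoalgebra_singleton insert.prems by blast
  let ?D = "span (B \<union> C)"
  have BC: "B \<union> C \<subseteq> A" using B C subcoalgebra_subset by blast
  have "subcoalgebra ?D"
  proof (rule subcoalgebraI)
    show "?D \<subseteq> A" by (rule span_minimal[OF BC subspace_space])
    fix f b assume f: "f \<in> dual" and b: "b \<in> ?D"
    have "b \<in> A \<and> action f b \<in> ?D" using b
    proof (induction b rule: span_induct_alt)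
      case (step c x y)
      then have "action f x \<in> ?D" using action_closed[OF _ _ f] B(1) C(1) by (auto intro!: span_base)
      with step BC f show ?case
        by (auto simp: action_add action_scale subspace_add[OF subspace_space] subspace_scale[OF subspace_space]
            span_add span_scale subset_iff)
    qed (use f in \<open>simp add: action_0 span_zero subspace_0[OF subspace_space]\<close>)
    then show "action f b \<in> ?D" ..
  qed simp
  moreover have "?D = span (T \<union> U)" unfolding B(3) C(3) span_Un span_span ..
  ultimately show ?case
    using B C by (intro exI[of _ ?D] exI[of _ "T \<union> U"]) (auto intro: span_base)
qed

end

context unital_jordan_coalgebra
begin

section \<open>Operators on the dual algebra\<close>

sublocale O: vector_space "fun_scale dual_scale :: 'k \<Rightarrow> (('a \<Rightarrow> 'k) \<Rightarrow> ('a \<Rightarrow> 'k)) \<Rightarrow> _"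
  by (intro vector_space_fun_scale vector_space_field)

abbreviation R_op ("\<rho>") where "\<rho> \<equiv> right_mult dual dual_mult"
abbreviation br where "br \<equiv> mult_bracket dual dual_mult"

definition dual_operators :: "(('a \<Rightarrow> 'k) \<Rightarrow> ('a \<Rightarrow> 'k)) set" where
  "dual_operators = {r. linear_on dual_scale dual_scale dual r \<and> r ` dual \<subseteq> dual \<and> (\<forall>x. x \<notin> dual \<longrightarrow> r x = 0)}"

lemma operator_add: "r \<in> dual_operators \<Longrightarrow> f \<in> dual \<Longrightarrow> g \<in> dual \<Longrightarrow> r (f + g) = r f + r g"
  and operator_scale: "r \<in> dual_operators \<Longrightarrow> f \<in> dual \<Longrightarrow> r (dual_scale c f) = dual_scale c (r f)"
  and operator_in: "r \<in> dual_operators \<Longrightarrow> f \<in> dual \<Longrightarrow> r f \<in> dual"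
  and operator_outside: "r \<in> dual_operators \<Longrightarrow> f \<notin> dual \<Longrightarrow> r f = 0"
  by (auto simp: dual_operators_def linear_on_def)

lemma operator_diff: "r \<in> dual_operators \<Longrightarrow> f \<in> dual \<Longrightarrow> g \<in> dual \<Longrightarrow> r (f - g) = r f - r g"
  using operator_add[of r "f - g" g] by (simp add: dual_diff_closed)

lemma operator_0: "r \<in> dual_operators \<Longrightarrow> r 0 = 0"
  using operator_diff[of r 0 0] by (simp add: dual_0_closed)

lemma operator_minus: "r \<in> dual_operators \<Longrightarrow> f \<in> dual \<Longrightarrow> r (- f) = - r f"
  using operator_diff[of r 0 f] operator_0[of r] dual_0_closed by (metis diff_0)

lemma operator_sum:
  "r \<in> dual_operators \<Longrightarrow> (\<And>i. i \<in> I \<Longrightarrow> f i \<in> dual) \<Longrightarrow> r (\<Sum>i\<in>I. f i) = (\<Sum>i\<in>I. r (f i))"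
  by (rule linear_on_sum[OF J.vector_space_axioms J.vector_space_axioms _ dual_subspace])
     (auto simp: dual_operators_def)

lemma operator_eqI:
  "r \<in> dual_operators \<Longrightarrow> s \<in> dual_operators \<Longrightarrow> (\<And>x. x \<in> dual \<Longrightarrow> r x = s x) \<Longrightarrow> r = s"
  by (metis operator_outside ext)

lemma operators_subspace: "O.subspace dual_operators"
  by (rule O.subspaceI)
     (auto simp: dual_operators_def linear_on_def fun_scale_def[of "fun_scale _"] image_subset_iff
        J.scale_right_distrib J.scale_left_commute intro: dual_add_closed dual_scale_closed dual_0_closed)

lemmas operator_closures = O.subspace_add[OF operators_subspace] O.subspace_diff[OF operators_subspace]
  O.subspace_neg[OF operators_subspace] O.subspace_scale[OF operators_subspace] O.subspace_0[OF operators_subspace]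

lemma right_mult_apply: "x \<in> dual \<Longrightarrow> \<rho> f x = x \<odot> f"
  by (simp add: right_mult_def)

lemma right_mult_operator: "f \<in> dual \<Longrightarrow> \<rho> f \<in> dual_operators"
  by (auto simp: dual_operators_def linear_on_def right_mult_def J.mult_distribs J.closures)

lemma right_mult_add: "f \<in> dual \<Longrightarrow> g \<in> dual \<Longrightarrow> \<rho> (f + g) = \<rho> f + \<rho> g"
  and right_mult_diff: "f \<in> dual \<Longrightarrow> g \<in> dual \<Longrightarrow> \<rho> (f - g) = \<rho> f - \<rho> g"
  and right_mult_scale: "f \<in> dual \<Longrightarrow> \<rho> (dual_scale c f) = fun_scale dual_scale c (\<rho> f)"
  and right_mult_minus: "f \<in> dual \<Longrightarrow> \<rho> (- f) = - \<rho> f"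
  by (auto simp: right_mult_def fun_eq_iff J.mult_distribs fun_scale_def[of "fun_scale _"] fun_scale_def[of "(*)" _ 0])

lemma right_mult_0: "\<rho> 0 = 0"
  using right_mult_diff[of 0 0] by (simp add: dual_0_closed)

lemma commutator_operator:
  "r \<in> dual_operators \<Longrightarrow> s \<in> dual_operators \<Longrightarrow> op_commutator r s \<in> dual_operators"
  by (auto simp: dual_operators_def linear_on_def op_commutator_def image_subset_iff J.scale_right_diff_distrib
      dual_0_closed J.zero_in intro!: dual_diff_closed)
     (metis J.scale_zero_left J.zero_in)+

lemma commutator_add_left: "r \<in> dual_operators \<Longrightarrow> s \<in> dual_operators \<Longrightarrow> t \<in> dual_operators \<Longrightarrow>
    op_commutator (r + s) t = op_commutator r t + op_commutator s t"
  and commutator_add_right: "r \<in> dual_operators \<Longrightarrow> s \<in> dual_operators \<Longrightarrow> t \<in> dual_operators \<Longrightarrow>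
    op_commutator t (r + s) = op_commutator t r + op_commutator t s"
  and commutator_diff_left: "r \<in> dual_operators \<Longrightarrow> s \<in> dual_operators \<Longrightarrow> t \<in> dual_operators \<Longrightarrow>
    op_commutator (r - s) t = op_commutator r t - op_commutator s t"
  by (rule operator_eqI;
      simp add: commutator_operator operator_closures;
      simp add: op_commutator_def operator_add operator_diff operator_in operator_scale
        fun_scale_def[of "fun_scale _"] J.scale_right_diff_distrib fun_eq_iff)+

lemma commutator_scale_left: "r \<in> dual_operators \<Longrightarrow> t \<in> dual_operators \<Longrightarrow>
    op_commutator (fun_scale dual_scale c r) t = fun_scale dual_scale c (op_commutator r t)"
proof (rule operator_eqI)
  assume r: "r \<in> dual_operators" and t: "t \<in> dual_operators"
  show "op_commutator (fun_scale dual_scale c r) t \<in> dual_operators" "fun_scale dual_scale c (op_commutator r t) \<in> dual_operators"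
    using r t by (simp_all add: commutator_operator operator_closures)
  show "op_commutator (fun_scale dual_scale c r) t x = fun_scale dual_scale c (op_commutator r t) x" if "x \<in> dual" for x
    using that operator_scale[OF t operator_in[OF r]] r t
    by (simp add: op_commutator_def fun_scale_def[of "fun_scale _"] J.scale_right_diff_distrib)
qed

lemma commutator_skew: "op_commutator s r = - op_commutator r s" for r s :: "('a \<Rightarrow> 'k) \<Rightarrow> ('a \<Rightarrow> 'k)"
  by (simp add: op_commutator_def fun_eq_iff)

lemma commutator_jacobi:
  "r \<in> dual_operators \<Longrightarrow> s \<in> dual_operators \<Longrightarrow> t \<in> dual_operators \<Longrightarrow>
    op_commutator (op_commutator r s) t + op_commutator (op_commutator s t) r + op_commutator (op_commutator t r) s = 0"
  by (rule operator_eqI;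
      simp add: commutator_operator operator_closures;
      simp add: op_commutator_def operator_diff operator_in fun_eq_iff)

lemma bracket_operator: "f \<in> dual \<Longrightarrow> g \<in> dual \<Longrightarrow> br f g \<in> dual_operators"
  by (simp add: mult_bracket_def commutator_operator right_mult_operator)

lemma bracket_apply: "f \<in> dual \<Longrightarrow> g \<in> dual \<Longrightarrow> x \<in> dual \<Longrightarrow> br f g x = (x \<odot> f) \<odot> g - (x \<odot> g) \<odot> f"
  by (simp add: mult_bracket_def op_commutator_def right_mult_apply J.closures)

lemma bracket_skew: "br g f = - br f g"
  unfolding mult_bracket_def by (rule commutator_skew)

section \<open>Derivations\<close>

abbreviation "Der \<equiv> derivations dual_scale dual dual_mult"
abbreviation "Inn \<equiv> inner_derivations dual dual_mult"

lemma derivation_operator: "d \<in> Der \<Longrightarrow> d \<in> dual_operators"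
  by (auto simp: derivations_def dual_operators_def)

lemma derivation_mult: "d \<in> Der \<Longrightarrow> x \<in> dual \<Longrightarrow> y \<in> dual \<Longrightarrow> d (x \<odot> y) = d x \<odot> y + x \<odot> d y"
  by (auto simp: derivations_def)

lemma derivationI:
  "d \<in> dual_operators \<Longrightarrow> (\<And>x y. x \<in> dual \<Longrightarrow> y \<in> dual \<Longrightarrow> d (x \<odot> y) = d x \<odot> y + x \<odot> d y) \<Longrightarrow> d \<in> Der"
  by (auto simp: derivations_def dual_operators_def)

lemma derivation_unit: "d \<in> Der \<Longrightarrow> d e = 0"
proof -
  assume d: "d \<in> Der"
  then have "d e \<in> dual" using derivation_operator operator_in unit_in by blast
  then show ?thesis using derivation_mult[OF d unit_in unit_in] by (simp add: unit_left unit_right unit_in)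
qed

lemma derivations_subspace: "O.subspace Der"
proof (rule O.subspaceI)
  show "0 \<in> Der" by (rule derivationI) (simp_all add: operator_closures J.mult_distribs)
next
  fix d d' assume d: "d \<in> Der" "d' \<in> Der"
  note op = derivation_operator[OF d(1)] derivation_operator[OF d(2)]
  show "d + d' \<in> Der"
    by (rule derivationI) (use d op in \<open>simp_all add: operator_closures operator_in derivation_mult J.mult_distribs fun_eq_iff\<close>)
next
  fix d c assume d: "d \<in> Der"
  note op = derivation_operator[OF d]
  show "fun_scale dual_scale c d \<in> Der"
    by (rule derivationI, use d op in \<open>simp_all add: operator_closures operator_in\<close>)
       (use d op in \<open>simp add: fun_scale_def[of "fun_scale _"] operator_in derivation_mult[OF d] J.mult_distribs J.scale_right_distrib\<close>)
qed

lemma bracket_derivation: "f \<in> dual \<Longrightarrow> g \<in> dual \<Longrightarrow> br f g \<in> Der"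
  by (rule derivationI)
     (simp_all add: bracket_operator bracket_apply J.closures J.bracket_derivation[OF dual_two])

lemma commutator_derivation: "d \<in> Der \<Longrightarrow> d' \<in> Der \<Longrightarrow> op_commutator d d' \<in> Der"
proof (rule derivationI)
  assume d: "d \<in> Der" "d' \<in> Der"
  note op = derivation_operator[OF d(1)] derivation_operator[OF d(2)]
  show "op_commutator d d' \<in> dual_operators" using op by (rule commutator_operator)
  show "op_commutator d d' (x \<odot> y) = op_commutator d d' x \<odot> y + x \<odot> op_commutator d d' y"
    if "x \<in> dual" "y \<in> dual" for x y
    using that d op
    by (simp add: op_commutator_def derivation_mult[OF d(1)] derivation_mult[OF d(2)] operator_add[OF op(1)] operator_add[OF op(2)]
        operator_in J.closures J.mult_distribs algebra_simps)
qed

lemma commutator_right_mult_derivation: "d \<in> Der \<Longrightarrow> f \<in> dual \<Longrightarrow> op_commutator (\<rho> f) d = \<rho> (d f)"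
  by (rule operator_eqI)
     (simp_all add: commutator_operator right_mult_operator derivation_operator operator_in,
      simp add: op_commutator_def right_mult_apply derivation_mult operator_in derivation_operator fun_eq_iff)

lemma commutator_bracket_derivation:
  assumes d: "d \<in> Der" and fg: "f \<in> dual" "g \<in> dual"
  shows "op_commutator (br f g) d = br (d f) g + br f (d g)"
proof (rule operator_eqI)
  note op = derivation_operator[OF d]
  note cl = fg op operator_in[OF op]
  show "op_commutator (br f g) d x = (br (d f) g + br f (d g)) x" if x: "x \<in> dual" for x
    using x fg d
    by (simp add: op_commutator_def bracket_apply cl derivation_mult[OF d] operator_diff[OF op] J.closures J.mult_distribs algebra_simps)
qed (use assms in \<open>simp_all add: commutator_operator bracket_operator derivation_operator operator_in operator_closures\<close>)

lemma bracket_scale: "f \<in> dual \<Longrightarrow> g \<in> dual \<Longrightarrow> fun_scale dual_scale c (br f g) = br (dual_scale c f) g"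
  unfolding mult_bracket_def
  by (simp add: right_mult_scale right_mult_operator commutator_scale_left)

text \<open>A generating set closed under scaling spans by plain finite sums, the form in which
  \<open>inner_derivations\<close> and \<open>bracket_pairing\<close> are given.\<close>

lemma (in vector_space) span_sums:
  assumes "x \<in> span G" and "\<And>c x. x \<in> G \<Longrightarrow> scale c x \<in> G"
  shows "\<exists>(n::nat) y. (\<forall>i<n. y i \<in> G) \<and> x = (\<Sum>i<n. y i)"
  using assms(1)
proof (induction rule: span_induct_alt)
  case base
  show ?case by (rule exI[of _ 0]) simp
next
  case (step c x z)
  then obtain n :: nat and y where y: "\<forall>i<n. y i \<in> G" "z = (\<Sum>i<n. y i)" by blast
  have "scale c x + z = (\<Sum>i<Suc n. (y(n := scale c x)) i)"
    by (simp add: y(2) add.commute)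
  then show ?case using y(1) assms(2)[OF step(1)]
    by (intro exI[of _ "Suc n"] exI[of _ "y(n := scale c x)"]) (simp add: less_Suc_eq)
qed

lemma inner_span: "Inn = O.span {br f g | f g. f \<in> dual \<and> g \<in> dual}" (is "_ = O.span ?G")
proof
  show "Inn \<subseteq> O.span ?G"
    by (auto simp: inner_derivations_def intro!: O.span_sum intro: O.span_base)
  show "O.span ?G \<subseteq> Inn"
  proof
    fix d assume "d \<in> O.span ?G"
    then obtain n :: nat and y where y: "\<forall>i<n. y i \<in> ?G" "d = (\<Sum>i<n. y i)"
      using O.span_sums[of d ?G] bracket_scale dual_scale_closed by (smt (verit) mem_Collect_eq)
    then have "\<forall>i<n. \<exists>f g. f \<in> dual \<and> g \<in> dual \<and> y i = br f g" by blast
    then obtain f g where "\<And>i. i < n \<Longrightarrow> f i \<in> dual \<and> g i \<in> dual \<and> y i = br (f i) (g i)" by metis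
    then show "d \<in> Inn" using y(2) unfolding inner_derivations_def by auto
  qed
qed

lemma inner_subspace: "O.subspace Inn"
  unfolding inner_span by simp

lemma bracket_inner: "f \<in> dual \<Longrightarrow> g \<in> dual \<Longrightarrow> br f g \<in> Inn"
  unfolding inner_span by (rule O.span_base) blast

lemma inner_derivation: "Inn \<subseteq> Der"
  unfolding inner_span by (rule O.span_minimal[OF _ derivations_subspace]) (auto intro: bracket_derivation)

text \<open>The inner derivations form an ideal among all derivations; on generators this is
  \<open>commutator_bracket_derivation\<close>.\<close>

lemma commutator_inner:
  assumes d: "d \<in> Der" and i: "i \<in> Inn"
  shows "op_commutator i d \<in> Inn"
proof -
  note op = derivation_operator[OF d]
  have "O.subspace {i \<in> Der. op_commutator i d \<in> Inn}"
  proof (rule O.subspaceI)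
    have "op_commutator 0 d = 0" using operator_0[OF op] by (simp add: op_commutator_def fun_eq_iff)
    then show "0 \<in> {i \<in> Der. op_commutator i d \<in> Inn}"
      using O.subspace_0 derivations_subspace inner_subspace by simp
  qed (auto simp: O.subspace_add[OF derivations_subspace] O.subspace_scale[OF derivations_subspace]
      commutator_add_left commutator_scale_left derivation_operator op
      O.subspace_add[OF inner_subspace] O.subspace_scale[OF inner_subspace])
  moreover have "op_commutator (br f g) d \<in> Inn" if "f \<in> dual" "g \<in> dual" for f g
    using that by (simp add: commutator_bracket_derivation d bracket_inner operator_in op O.subspace_add[OF inner_subspace])
  ultimately have "O.span {br f g | f g. f \<in> dual \<and> g \<in> dual} \<subseteq> {i \<in> Der. op_commutator i d \<in> Inn}"
    by (intro O.span_minimal) (auto intro: bracket_derivation)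
  then show ?thesis using i inner_span by blast
qed

section \<open>Weakly inner derivations\<close>

definition finite_dim_subcoalgebra :: "'a set \<Rightarrow> bool" where
  "finite_dim_subcoalgebra B \<longleftrightarrow> subcoalgebra B \<and> (\<exists>S. finite S \<and> B = span S)"

lemma finite_dim_subcoalgebra_exists:
  "finite S \<Longrightarrow> S \<subseteq> A \<Longrightarrow> \<exists>B. finite_dim_subcoalgebra B \<and> S \<subseteq> B"
  using finite_subcoalgebra[of S] unfolding finite_dim_subcoalgebra_def by metis

abbreviation "WDer \<equiv> weakly_inner_derivations"

lemma weakly_inner_iff: "d \<in> WDer \<longleftrightarrow> d \<in> Der \<and>
    (\<forall>B. finite_dim_subcoalgebra B \<longrightarrow> (\<exists>i\<in>Inn. \<forall>f\<in>dual. \<forall>b\<in>B. d f b = i f b))"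
  unfolding weakly_inner_derivations_def finite_dim_subcoalgebra_def by simp

lemma weakly_innerD: "d \<in> WDer \<Longrightarrow> finite_dim_subcoalgebra B \<Longrightarrow> \<exists>i\<in>Inn. \<forall>f\<in>dual. \<forall>b\<in>B. d f b = i f b"
  by (simp add: weakly_inner_iff)

lemma weakly_inner_derivation: "d \<in> WDer \<Longrightarrow> d \<in> Der"
  by (simp add: weakly_inner_iff)

lemma inner_weakly_inner: "i \<in> Inn \<Longrightarrow> i \<in> WDer"
  using inner_derivation by (auto simp: weakly_inner_iff)

lemma weakly_inner_operator: "d \<in> WDer \<Longrightarrow> d \<in> dual_operators"
  by (simp add: weakly_inner_derivation derivation_operator)

text \<open>The annihilator of a subcoalgebra is an ideal: the value of \<open>f \<odot> g\<close>
  at \<open>b\<close> is that of \<open>f\<close> at \<open>action g b\<close>, again in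
  \<open>B\<close>.\<close>

lemma dual_mult_vanish:
  assumes B: "subcoalgebra B" and f: "f \<in> dual" "\<And>b. b \<in> B \<Longrightarrow> f b = 0" and g: "g \<in> dual" and b: "b \<in> B"
  shows "(f \<odot> g) b = 0"
  using dual_action[OF f(1) g] action_closed[OF B b g] f(2) subcoalgebra_subset[OF B] b by fastforce

text \<open>Locality: on \<open>B\<close>, the functional \<open>i f\<close> depends only on the
  restriction of \<open>f\<close> to \<open>B\<close>.\<close>

lemma inner_vanish:
  assumes B: "subcoalgebra B" and i: "i \<in> Inn" and f: "f \<in> dual" "\<And>b. b \<in> B \<Longrightarrow> f b = 0" and b: "b \<in> B"
  shows "i f b = 0"
proof -
  have "br g h f b = 0" if "g \<in> dual" "h \<in> dual" for g h
    using that f b dual_mult_vanish[OF B] by (simp add: bracket_apply dual_mult_closed)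
  then show ?thesis using i by (auto simp: inner_derivations_def sum_fun_apply)
qed

lemma weakly_inner_subspace: "O.subspace WDer"
proof (rule O.subspaceI)
  show "0 \<in> WDer" using inner_weakly_inner O.subspace_0[OF inner_subspace] by blast
next
  fix d d' assume d: "d \<in> WDer" "d' \<in> WDer"
  show "d + d' \<in> WDer" unfolding weakly_inner_iff
  proof (intro conjI allI impI)
    show "d + d' \<in> Der" using d O.subspace_add[OF derivations_subspace] weakly_inner_derivation by blast
    fix B assume B: "finite_dim_subcoalgebra B"
    obtain i where "i \<in> Inn" "\<forall>f\<in>dual. \<forall>b\<in>B. d f b = i f b"
      using weakly_innerD[OF d(1) B] by blast
    moreover obtain i' where "i' \<in> Inn" "\<forall>f\<in>dual. \<forall>b\<in>B. d' f b = i' f b"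
      using weakly_innerD[OF d(2) B] by blast
    ultimately show "\<exists>i\<in>Inn. \<forall>f\<in>dual. \<forall>b\<in>B. (d + d') f b = i f b"
      by (intro bexI[of _ "i + i'"]) (simp_all add: O.subspace_add[OF inner_subspace])
  qed
next
  fix d c assume d: "d \<in> WDer"
  show "fun_scale dual_scale c d \<in> WDer" unfolding weakly_inner_iff
  proof (intro conjI allI impI)
    show "fun_scale dual_scale c d \<in> Der"
      using d O.subspace_scale[OF derivations_subspace] weakly_inner_derivation by blast
    fix B assume B: "finite_dim_subcoalgebra B"
    obtain i where "i \<in> Inn" "\<forall>f\<in>dual. \<forall>b\<in>B. d f b = i f b"
      using weakly_innerD[OF d B] by blast
    then show "\<exists>i\<in>Inn. \<forall>f\<in>dual. \<forall>b\<in>B. fun_scale dual_scale c d f b = i f b"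
      by (intro bexI[of _ "fun_scale dual_scale c i"] O.subspace_scale[OF inner_subspace])
         (simp_all add: fun_scale_def)
  qed
qed

text \<open>Inner approximations \<open>i\<close>, \<open>i'\<close> of \<open>d\<close>,
  \<open>d'\<close> on \<open>B\<close> also approximate the compositions, because by locality
  \<open>i' (d f)\<close> and \<open>i' (i f)\<close> agree on \<open>B\<close> once
  \<open>d f\<close> and \<open>i f\<close> do.\<close>

lemma weakly_inner_commutator:
  assumes d: "d \<in> WDer" "d' \<in> WDer"
  shows "op_commutator d d' \<in> WDer"
  unfolding weakly_inner_iff
proof (intro conjI allI impI)
  show "op_commutator d d' \<in> Der" using d commutator_derivation weakly_inner_derivation by blast
  fix B assume B: "finite_dim_subcoalgebra B"
  obtain i where i1: "i \<in> Inn" "\<forall>f\<in>dual. \<forall>b\<in>B. d f b = i f b"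
    using weakly_innerD[OF d(1) B] by blast
  obtain i' where i2: "i' \<in> Inn" "\<forall>f\<in>dual. \<forall>b\<in>B. d' f b = i' f b"
    using weakly_innerD[OF d(2) B] by blast
  note i = i1(1) i2(1) and eq = i1(2)[rule_format] i2(2)[rule_format]
  have sub: "subcoalgebra B" using B by (simp add: finite_dim_subcoalgebra_def)
  have op: "d \<in> dual_operators" "d' \<in> dual_operators" "i \<in> dual_operators" "i' \<in> dual_operators"
    using d i inner_weakly_inner weakly_inner_operator by blast+
  have comp: "j g b = j g' b"
    if "j \<in> Inn" "g \<in> dual" "g' \<in> dual" "\<And>b. b \<in> B \<Longrightarrow> g b = g' b" "b \<in> B" for j g g' b
  proof -
    have "j \<in> dual_operators" using that(1) inner_weakly_inner weakly_inner_operator by blast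
    moreover have "j (g - g') b = 0"
      by (rule inner_vanish[OF sub that(1)]) (use that in auto)
    ultimately show ?thesis using that by (simp add: operator_diff)
  qed
  show "\<exists>j\<in>Inn. \<forall>f\<in>dual. \<forall>b\<in>B. op_commutator d d' f b = j f b"
  proof (intro bexI[of _ "op_commutator i i'"] ballI)
    show "op_commutator i i' \<in> Inn" using i commutator_inner inner_derivation by blast
    fix f b assume f: "f \<in> dual" and b: "b \<in> B"
    have "d' (d f) b = i' (i f) b"
      using comp[OF i(2), of "d f" "i f"] eq f b op by (simp add: operator_in)
    moreover have "d (d' f) b = i (i' f) b"
      using comp[OF i(1), of "d' f" "i' f"] eq f b op by (simp add: operator_in)
    ultimately show "op_commutator d d' f b = op_commutator i i' f b"
      by (simp add: op_commutator_def)
  qed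
qed

lemma weakly_inner_vanish:
  assumes "finite_dim_subcoalgebra B" "d \<in> WDer" "f \<in> dual" "\<And>b. b \<in> B \<Longrightarrow> f b = 0" "b \<in> B"
  shows "d f b = 0"
  using assms inner_vanish unfolding weakly_inner_iff finite_dim_subcoalgebra_def by metis

end

lemma sum_append:
  fixes n k :: nat and g :: "'a \<Rightarrow> 'b::comm_monoid_add"
  shows "(\<Sum>i<n + k. g (if i < n then x i else y (i - n))) = (\<Sum>i<n. g (x i)) + (\<Sum>i<k. g (y i))"
  by (induction k) (auto simp: add.assoc intro!: sum.cong)

context unital_jordan_coalgebra
begin

section \<open>Operators on the null extension\<close>

lemma ext_scale_apply: "ext_scale c (f, a) = (dual_scale c f, c *s a)"
proof -
  interpret E: vector_space_prod "dual_scale :: 'k \<Rightarrow> ('a \<Rightarrow> 'k) \<Rightarrow> _" scale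
    by unfold_locales
  show ?thesis by (simp add: ext_scale_def E.scale_def)
qed

sublocale E: vector_space ext_scale
proof -
  interpret E: vector_space_prod "dual_scale :: 'k \<Rightarrow> ('a \<Rightarrow> 'k) \<Rightarrow> _" scale
    by unfold_locales
  show "vector_space ext_scale" unfolding ext_scale_def by (rule E.p.vector_space_axioms)
qed

sublocale X: vector_space "fun_scale ext_scale :: 'k \<Rightarrow> (('a \<Rightarrow> 'k) \<times> 'a \<Rightarrow> ('a \<Rightarrow> 'k) \<times> 'a) \<Rightarrow> _"
  by (rule vector_space_fun_scale[OF E.vector_space_axioms])

lemma A_0: "0 \<in> A"
  by (rule subspace_0[OF subspace_space])

lemma ext_right_mult_apply:
  assumes "a \<in> A"
  shows "ext_right_mult a x = (if fst x \<in> dual \<and> snd x \<in> A then (0, action (fst x) a) else 0)"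
  using assms
  by (cases x) (auto simp: ext_right_mult_def right_mult_def ext_carrier_def ext_mult_def J.mult_distribs action_zero_left
      simp flip: zero_fun_def)

text \<open>Products within \<open>A\<close> vanish in the null extension, so only the dual
  component of \<open>x\<close> matters and the values lie in \<open>A\<close>; the operator is
  determined by its values at the elements \<open>(g, 0)\<close>.\<close>

lemma ext_bracket_apply:
  assumes "f \<in> dual" "a \<in> A"
  shows "ext_bracket f a x = (if fst x \<in> dual \<and> snd x \<in> A
    then (0, action (fst x \<odot> f) a - action f (action (fst x) a)) else 0)"
  using assms
  by (cases x) (auto simp: ext_bracket_def mult_bracket_def op_commutator_def right_mult_def ext_carrier_def ext_mult_def
      J.mult_distribs J.closures action_zero_left action_0 action_in A_0 zero_prod_def
      simp flip: zero_fun_def)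

lemma ext_right_mult_add: "a \<in> A \<Longrightarrow> b \<in> A \<Longrightarrow> ext_right_mult (a + b) = ext_right_mult a + ext_right_mult b"
  by (rule ext) (simp add: ext_right_mult_apply subspace_add[OF subspace_space] action_add)

lemma ext_right_mult_scale: "a \<in> A \<Longrightarrow> ext_right_mult (c *s a) = fun_scale ext_scale c (ext_right_mult a)"
  by (rule ext) (simp add: ext_right_mult_apply subspace_scale[OF subspace_space] action_scale
      fun_scale_def[of ext_scale] ext_scale_apply E.scale_zero_right)

lemma ext_bracket_add_left: "f \<in> dual \<Longrightarrow> g \<in> dual \<Longrightarrow> a \<in> A \<Longrightarrow> ext_bracket (f + g) a = ext_bracket f a + ext_bracket g a"
  by (rule ext) (simp add: ext_bracket_apply J.closures J.mult_distribs action_add_left action_in)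

lemma ext_bracket_scale_left: "f \<in> dual \<Longrightarrow> a \<in> A \<Longrightarrow> ext_bracket (dual_scale c f) a = fun_scale ext_scale c (ext_bracket f a)"
  by (rule ext) (simp add: ext_bracket_apply J.closures J.mult_distribs action_scale_left action_in
      fun_scale_def[of ext_scale] ext_scale_apply scale_right_diff_distrib)

lemma ext_bracket_add_right: "f \<in> dual \<Longrightarrow> a \<in> A \<Longrightarrow> b \<in> A \<Longrightarrow> ext_bracket f (a + b) = ext_bracket f a + ext_bracket f b"
  by (rule ext) (simp add: ext_bracket_apply J.closures subspace_add[OF subspace_space] action_add action_in)

lemma ext_bracket_scale_right: "f \<in> dual \<Longrightarrow> a \<in> A \<Longrightarrow> ext_bracket f (c *s a) = fun_scale ext_scale c (ext_bracket f a)"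
  by (rule ext) (simp add: ext_bracket_apply J.closures subspace_scale[OF subspace_space] action_scale action_in
      fun_scale_def[of ext_scale] ext_scale_apply scale_right_diff_distrib)

lemma bracket_space_span: "bracket_space = X.span {ext_bracket f a | f a. f \<in> dual \<and> a \<in> A}"
  unfolding bracket_space_def bracket_span_def ext_bracket_def
  by (rule arg_cong[where f = X.span]) auto

lemma bracket_space_subspace: "X.subspace bracket_space"
  unfolding bracket_space_span by simp

lemma ext_bracket_in: "f \<in> dual \<Longrightarrow> a \<in> A \<Longrightarrow> ext_bracket f a \<in> bracket_space"
  unfolding bracket_space_span by (rule X.span_base) blast

lemma bracket_space_sumE:
  assumes "v \<in> bracket_space"
  obtains n :: nat and f a where "\<And>i. i < n \<Longrightarrow> f i \<in> dual \<and> a i \<in> A" "v = (\<Sum>i<n. ext_bracket (f i) (a i))"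
proof -
  let ?G = "{ext_bracket f a | f a. f \<in> dual \<and> a \<in> A}"
  have "fun_scale ext_scale c x \<in> ?G" if "x \<in> ?G" for c x
  proof -
    obtain f a where "x = ext_bracket f a" "f \<in> dual" "a \<in> A" using \<open>x \<in> ?G\<close> by blast
    then show ?thesis using ext_bracket_scale_left[of f a c] dual_scale_closed[of f c] by (metis (mono_tags, lifting) mem_Collect_eq)
  qed
  from X.span_sums[OF assms[unfolded bracket_space_span] this]
  obtain n :: nat and y where y: "\<forall>i<n. y i \<in> ?G" "v = (\<Sum>i<n. y i)" by blast
  from y(1) have "\<forall>i<n. \<exists>f a. f \<in> dual \<and> a \<in> A \<and> y i = ext_bracket f a" by blast
  then obtain f a where "\<And>i. i < n \<Longrightarrow> f i \<in> dual \<and> a i \<in> A \<and> y i = ext_bracket (f i) (a i)" by metis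
  with y(2) show ?thesis by (intro that[of n f a]) auto
qed

text \<open>Through this identity the inner derivations separate the points of \<open>[A\<^sup>*, A]\<close>.\<close>

lemma ext_bracket_pairing:
  assumes "f \<in> dual" "a \<in> A" "g \<in> dual" "h \<in> dual"
  shows "h (snd (ext_bracket f a (g, 0))) = br g h f a"
proof -
  have "h (snd (ext_bracket f a (g, 0))) = (h \<odot> (g \<odot> f)) a - ((h \<odot> f) \<odot> g) a"
    using assms by (simp add: ext_bracket_apply A_0 dual_diff dual_action action_in J.closures)
  also have "\<dots> = br g h f a"
    using assms J.mult_commute[of h "g \<odot> f"] J.mult_commute[of g f] J.mult_commute[of h f]
    by (simp add: bracket_apply J.closures)
  finally show ?thesis .
qed

lemma snd_sum: "snd (\<Sum>i\<in>I. f i) = (\<Sum>i\<in>I. snd (f i))"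
  by (induction I rule: infinite_finite_induct) auto

lemma ext_bracket_sum_snd_in:
  assumes "\<And>i. i < (n::nat) \<Longrightarrow> f i \<in> dual \<and> a i \<in> A" "g \<in> dual"
  shows "snd ((\<Sum>i<n. ext_bracket (f i) (a i)) (g, 0)) \<in> A"
    and "h \<in> dual \<Longrightarrow> h (snd ((\<Sum>i<n. ext_bracket (f i) (a i)) (g, 0))) = (\<Sum>i<n. br g h (f i) (a i))"
proof -
  have in_A: "snd (ext_bracket (f i) (a i) (g, 0)) \<in> A" if "i < n" for i
    using assms that by (simp add: ext_bracket_apply A_0 action_in J.closures subspace_diff[OF subspace_space])
  then show "snd ((\<Sum>i<n. ext_bracket (f i) (a i)) (g, 0)) \<in> A"
    by (auto simp: sum_fun_apply snd_sum intro!: subspace_sum[OF subspace_space])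
  show "h (snd ((\<Sum>i<n. ext_bracket (f i) (a i)) (g, 0))) = (\<Sum>i<n. br g h (f i) (a i))" if h: "h \<in> dual"
    using dual_sum[OF h, of "{..<n}" "\<lambda>i. snd (ext_bracket (f i) (a i) (g, 0))"] in_A assms h
    by (auto simp: sum_fun_apply snd_sum ext_bracket_pairing intro!: sum.cong)
qed

text \<open>By \<open>ext_bracket_pairing\<close> the second hypothesis says that \<open>v\<close>
  pairs to zero with every \<open>[g, h]\<close>; this is the separation of points by inner
  derivations.\<close>

lemma bracket_space_eq_0:
  assumes v: "v \<in> bracket_space" and 0: "\<And>g h. g \<in> dual \<Longrightarrow> h \<in> dual \<Longrightarrow> h (snd (v (g, 0))) = 0"
  shows "v = 0"
proof
  obtain n :: nat and f a where fa: "\<And>i. i < n \<Longrightarrow> f i \<in> dual \<and> a i \<in> A" "v = (\<Sum>i<n. ext_bracket (f i) (a i))"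
    by (rule bracket_space_sumE[OF v]) (rule that)
  fix x
  show "v x = 0 x"
  proof (cases "fst x \<in> dual \<and> snd x \<in> A")
    case False
    then show ?thesis using fa by (auto simp: sum_fun_apply ext_bracket_apply)
  next
    case True
    have eq: "v x = v (fst x, 0)"
      using True fa by (auto simp: sum_fun_apply ext_bracket_apply A_0)
    have "snd (v (fst x, 0)) = 0"
    proof (rule dual_separates)
      show "snd (v (fst x, 0)) \<in> A"
        unfolding fa(2) by (rule ext_bracket_sum_snd_in(1)[OF fa(1)]) (use True in auto)
    qed (use True 0 in \<open>simp_all add: dual_0 A_0\<close>)
    moreover have "fst (v (fst x, 0)) = 0"
    proof -
      have "fst (\<Sum>i<m. ext_bracket (f i) (a i) (fst x, 0)) = 0" if "m \<le> n" for m
        using that by (induction m) (use fa True in \<open>auto simp: ext_bracket_apply A_0\<close>)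
      then show ?thesis by (simp add: fa(2) sum_fun_apply)
    qed
    ultimately show ?thesis using eq by (simp add: prod_eq_iff)
  qed
qed

section \<open>The pairing\<close>

text \<open>All \<open>a i\<close> and \<open>a' i\<close> lie in one finite-dimensional
  subcoalgebra, on which \<open>d\<close> is a sum of brackets \<open>[g j, h j]\<close>. Both sums
  then equal the sum of the \<open>h j (snd (v (g j, 0)))\<close>, an expression in the common
  operator \<open>v\<close> alone.\<close>

lemma bracket_pairing_unique:
  assumes d: "d \<in> WDer"
    and fa: "\<And>i. i < (n::nat) \<Longrightarrow> f i \<in> dual \<and> a i \<in> A" and fa': "\<And>i. i < (m::nat) \<Longrightarrow> f' i \<in> dual \<and> a' i \<in> A"
    and eq: "(\<Sum>i<n. ext_bracket (f i) (a i)) = (\<Sum>i<m. ext_bracket (f' i) (a' i))"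
  shows "(\<Sum>i<n. d (f i) (a i)) = (\<Sum>i<m. d (f' i) (a' i))"
proof -
  have "finite (a ` {..<n} \<union> a' ` {..<m})" "a ` {..<n} \<union> a' ` {..<m} \<subseteq> A"
    using fa fa' by auto
  from finite_dim_subcoalgebra_exists[OF this]
  obtain B where B: "finite_dim_subcoalgebra B" "a ` {..<n} \<union> a' ` {..<m} \<subseteq> B" by blast
  obtain i where i: "i \<in> Inn" "\<forall>f\<in>dual. \<forall>b\<in>B. d f b = i f b"
    using weakly_innerD[OF d B(1)] by blast
  obtain k :: nat and g h where gh: "\<forall>j<k. g j \<in> dual \<and> h j \<in> dual" "i = (\<Sum>j<k. br (g j) (h j))"
    using i(1) unfolding inner_derivations_def by blast
  have *: "(\<Sum>l<p. d (F l) (c l)) = (\<Sum>j<k. h j (snd ((\<Sum>l<p. ext_bracket (F l) (c l)) (g j, 0))))"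
    if "\<And>l. l < p \<Longrightarrow> F l \<in> dual \<and> c l \<in> A" "c ` {..<p} \<subseteq> B" for p :: nat and F c
  proof -
    have "(\<Sum>l<p. d (F l) (c l)) = (\<Sum>l<p. \<Sum>j<k. br (g j) (h j) (F l) (c l))"
      using that i(2) by (intro sum.cong) (auto simp: gh(2) sum_fun_apply)
    also have "\<dots> = (\<Sum>j<k. \<Sum>l<p. br (g j) (h j) (F l) (c l))" by (rule sum.swap)
    also have "\<dots> = (\<Sum>j<k. h j (snd ((\<Sum>l<p. ext_bracket (F l) (c l)) (g j, 0))))"
      using gh(1) ext_bracket_sum_snd_in(2)[of p F c, OF that(1)] by (intro sum.cong) auto
    finally show ?thesis .
  qed
  show ?thesis
    using *[of n f a, OF fa] *[of m f' a', OF fa'] B(2) eq by auto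
qed

lemma bracket_pairing_sum:
  assumes "d \<in> WDer" "\<And>i. i < (n::nat) \<Longrightarrow> f i \<in> dual \<and> a i \<in> A"
  shows "bracket_pairing d (\<Sum>i<n. ext_bracket (f i) (a i)) = (\<Sum>i<n. d (f i) (a i))"
  unfolding bracket_pairing_def
proof (rule the_equality)
  show "\<exists>(m::nat) f' a'. (\<forall>i<m. f' i \<in> dual \<and> a' i \<in> A) \<and>
      (\<Sum>i<n. ext_bracket (f i) (a i)) = (\<Sum>i<m. ext_bracket (f' i) (a' i)) \<and>
      (\<Sum>i<n. d (f i) (a i)) = (\<Sum>i<m. d (f' i) (a' i))"
    using assms(2) by (intro exI[of _ n] exI[of _ f] exI[of _ a]) simp
next
  fix p
  assume "\<exists>(m::nat) f' a'. (\<forall>i<m. f' i \<in> dual \<and> a' i \<in> A) \<and>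
      (\<Sum>i<n. ext_bracket (f i) (a i)) = (\<Sum>i<m. ext_bracket (f' i) (a' i)) \<and>
      p = (\<Sum>i<m. d (f' i) (a' i))"
  then obtain m :: nat and f' a' where *: "\<forall>i<m. f' i \<in> dual \<and> a' i \<in> A"
    "(\<Sum>i<n. ext_bracket (f i) (a i)) = (\<Sum>i<m. ext_bracket (f' i) (a' i))"
    "p = (\<Sum>i<m. d (f' i) (a' i))"
    by (elim exE conjE)
  show "p = (\<Sum>i<n. d (f i) (a i))"
    unfolding *(3) by (rule bracket_pairing_unique[symmetric, OF assms _ *(2)]) (use *(1) in auto)
qed

lemma bracket_pairing_bracket:
  "d \<in> WDer \<Longrightarrow> f \<in> dual \<Longrightarrow> a \<in> A \<Longrightarrow> bracket_pairing d (ext_bracket f a) = d f a"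
  using bracket_pairing_sum[of d 1 "\<lambda>_. f" "\<lambda>_. a"] by simp

lemma bracket_pairing_add:
  assumes d: "d \<in> WDer" and vw: "v \<in> bracket_space" "w \<in> bracket_space"
  shows "bracket_pairing d (v + w) = bracket_pairing d v + bracket_pairing d w"
proof -
  obtain n :: nat and f a where fa: "\<And>i. i < n \<Longrightarrow> f i \<in> dual \<and> a i \<in> A" "v = (\<Sum>i<n. ext_bracket (f i) (a i))"
    by (rule bracket_space_sumE[OF vw(1)]) (rule that)
  obtain m :: nat and f' a' where fa': "\<And>i. i < m \<Longrightarrow> f' i \<in> dual \<and> a' i \<in> A" "w = (\<Sum>i<m. ext_bracket (f' i) (a' i))"
    by (rule bracket_space_sumE[OF vw(2)]) (rule that)
  define z where "z = (\<lambda>i. if i < n then (f i, a i) else (f' (i - n), a' (i - n)))"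
  have "v + w = (\<Sum>i<n+m. ext_bracket (fst (z i)) (snd (z i)))"
    using sum_append[of "\<lambda>p. ext_bracket (fst p) (snd p)" n "\<lambda>i. (f i, a i)" "\<lambda>i. (f' i, a' i)" m]
    by (simp add: fa(2) fa'(2) z_def)
  moreover have "bracket_pairing d (\<Sum>i<n+m. ext_bracket (fst (z i)) (snd (z i))) = (\<Sum>i<n+m. d (fst (z i)) (snd (z i)))"
    using fa(1) fa'(1) by (intro bracket_pairing_sum[OF d]) (auto simp: z_def)
  moreover have "\<dots> = (\<Sum>i<n. d (f i) (a i)) + (\<Sum>i<m. d (f' i) (a' i))"
    using sum_append[of "\<lambda>p. d (fst p) (snd p)" n "\<lambda>i. (f i, a i)" "\<lambda>i. (f' i, a' i)" m] by (simp add: z_def)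
  moreover have "bracket_pairing d v = (\<Sum>i<n. d (f i) (a i))" "bracket_pairing d w = (\<Sum>i<m. d (f' i) (a' i))"
    unfolding fa(2) fa'(2) by (intro bracket_pairing_sum[OF d] fa(1) fa'(1); assumption)+
  ultimately show ?thesis by simp
qed

lemma bracket_pairing_scale:
  assumes d: "d \<in> WDer" and v: "v \<in> bracket_space"
  shows "bracket_pairing d (fun_scale ext_scale c v) = c * bracket_pairing d v"
proof -
  obtain n :: nat and f a where fa: "\<And>i. i < n \<Longrightarrow> f i \<in> dual \<and> a i \<in> A" "v = (\<Sum>i<n. ext_bracket (f i) (a i))"
    by (rule bracket_space_sumE[OF v]) (rule that)
  have "fun_scale ext_scale c v = (\<Sum>i<n. ext_bracket (dual_scale c (f i)) (a i))"
    unfolding fa(2) X.scale_sum_right by (intro sum.cong) (use fa(1) in \<open>auto simp: ext_bracket_scale_left\<close>)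
  moreover have "bracket_pairing d (\<Sum>i<n. ext_bracket (dual_scale c (f i)) (a i)) = (\<Sum>i<n. d (dual_scale c (f i)) (a i))"
    by (intro bracket_pairing_sum[OF d]) (use fa(1) dual_scale_closed in blast)
  moreover have "\<dots> = (\<Sum>i<n. c * d (f i) (a i))"
    using fa(1) operator_scale[OF weakly_inner_operator[OF d]] by (intro sum.cong) (auto simp: fun_scale_def)
  moreover have "bracket_pairing d v = (\<Sum>i<n. d (f i) (a i))"
    unfolding fa(2) by (intro bracket_pairing_sum[OF d] fa(1))
  ultimately show ?thesis by (simp add: sum_distrib_left)
qed

section \<open>Uniqueness of the decompositions in \<open>R_space\<close> and
  \<open>R_dual\<close>\<close>

lemma bracket_space_unit:
  assumes "v \<in> bracket_space"
  shows "v (e, 0) = 0"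
proof -
  obtain n :: nat and f a where fa: "\<And>i. i < n \<Longrightarrow> f i \<in> dual \<and> a i \<in> A" "v = (\<Sum>i<n. ext_bracket (f i) (a i))"
    by (rule bracket_space_sumE[OF assms]) (rule that)
  show ?thesis unfolding fa(2) sum_fun_apply
    by (rule sum.neutral) (use fa(1) in \<open>simp add: ext_bracket_apply unit_in unit_left A_0 action_unit zero_prod_def\<close>)
qed

lemma ext_right_mult_unit: "b \<in> A \<Longrightarrow> ext_right_mult b (e, 0) = (0, b)"
  by (simp add: ext_right_mult_apply unit_in A_0 action_unit)

text \<open>Evaluation at \<open>(e, 0)\<close> reads off \<open>b\<close>, because
  \<open>b'\<close> sends it to \<open>(0, b)\<close> and brackets kill it.\<close>

lemma R_space_unique:
  assumes "b \<in> A" "v \<in> bracket_space" "b' \<in> A" "v' \<in> bracket_space"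
    and eq: "ext_right_mult b + v = ext_right_mult b' + v'"
  shows "b = b' \<and> v = v'"
proof -
  have "(ext_right_mult b + v) (e, 0) = (ext_right_mult b' + v') (e, 0)" using eq by simp
  then have "b = b'" using assms(1-4) by (simp add: ext_right_mult_unit bracket_space_unit)
  then show ?thesis using eq by simp
qed

text \<open>Derivations kill the unit, so the value at \<open>e\<close> recovers the multiplication
  part.\<close>

lemma R_dual_value: "g \<in> dual \<Longrightarrow> d \<in> WDer \<Longrightarrow> (\<rho> g + d) e = g"
  using derivation_unit[OF weakly_inner_derivation, of d]
  by (simp add: right_mult_apply unit_in unit_left fun_eq_iff)

lemma R_dual_unique:
  assumes "g \<in> dual" "d \<in> WDer" "g' \<in> dual" "d' \<in> WDer" "\<rho> g + d = \<rho> g' + d'"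
  shows "g = g' \<and> d = d'"
proof -
  have "g = g'" using R_dual_value[OF assms(1,2)] R_dual_value[OF assms(3,4)] assms(5) by metis
  then show ?thesis using assms(5) by simp
qed

lemma R_eps_sum:
  assumes "g \<in> dual" "d \<in> WDer"
  shows "R_eps (\<rho> g + d) = - \<rho> g + d"
  unfolding R_eps_def
proof (rule the_equality)
  show "\<exists>f\<in>dual. \<exists>d'\<in>WDer. \<rho> g + d = \<rho> f + d' \<and> - \<rho> g + d = - \<rho> f + d'" using assms by blast
next
  fix r assume "\<exists>f\<in>dual. \<exists>d'\<in>WDer. \<rho> g + d = \<rho> f + d' \<and> r = - \<rho> f + d'"
  then obtain f d' where *: "f \<in> dual" "d' \<in> WDer" "\<rho> g + d = \<rho> f + d'" "r = - \<rho> f + d'" by blast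
  show "r = - \<rho> g + d" using R_dual_unique[OF assms *(1-3)] *(4) by simp
qed

lemma R_pairing_sum:
  assumes gd: "g \<in> dual" "d \<in> WDer" and bv: "b \<in> A" "v \<in> bracket_space"
  shows "R_pairing (\<rho> g + d) (ext_right_mult b + v) = g b + bracket_pairing d v"
  unfolding R_pairing_def
proof (rule the_equality)
  show "\<exists>g'\<in>dual. \<exists>d'\<in>WDer. \<exists>b'\<in>A. \<exists>v'\<in>bracket_space.
      \<rho> g + d = \<rho> g' + d' \<and> ext_right_mult b + v = ext_right_mult b' + v' \<and>
      g b + bracket_pairing d v = g' b' + bracket_pairing d' v'" using assms by blast
next
  fix p assume "\<exists>g'\<in>dual. \<exists>d'\<in>WDer. \<exists>b'\<in>A. \<exists>v'\<in>bracket_space.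
      \<rho> g + d = \<rho> g' + d' \<and> ext_right_mult b + v = ext_right_mult b' + v' \<and>
      p = g' b' + bracket_pairing d' v'"
  then obtain g' d' b' v' where *: "g' \<in> dual" "d' \<in> WDer" "b' \<in> A" "v' \<in> bracket_space"
      "\<rho> g + d = \<rho> g' + d'" "ext_right_mult b + v = ext_right_mult b' + v'"
      "p = g' b' + bracket_pairing d' v'" by blast
  show "p = g b + bracket_pairing d v"
    using R_dual_unique[OF gd *(1,2,5)] R_space_unique[OF bv *(3,4,6)] *(7) by simp
qed

lemma R_dualE:
  assumes "r \<in> R_dual"
  obtains g d where "g \<in> dual" "d \<in> WDer" "r = \<rho> g + d"
  using assms unfolding R_dual_def by blast

lemma R_dualI: "g \<in> dual \<Longrightarrow> d \<in> WDer \<Longrightarrow> \<rho> g + d \<in> R_dual"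
  unfolding R_dual_def by blast

lemma R_spaceE:
  assumes "w \<in> R_space"
  obtains b v where "b \<in> A" "v \<in> bracket_space" "w = ext_right_mult b + v"
  using assms unfolding R_space_def by blast

lemma R_spaceI: "b \<in> A \<Longrightarrow> v \<in> bracket_space \<Longrightarrow> ext_right_mult b + v \<in> R_space"
  unfolding R_space_def by blast

section \<open>Functionals on the bracket space as weakly inner derivations\<close>

lemma subcoalgebra_dual_basis:
  assumes B: "finite_dim_subcoalgebra B"
  obtains E C where "finite E" "E \<subseteq> B" "\<And>u. C u \<in> dual"
    "\<And>x. x \<in> B \<Longrightarrow> x = (\<Sum>u\<in>E. C u x *s u)"
    "\<And>f b. f \<in> dual \<Longrightarrow> b \<in> B \<Longrightarrow> f b = (\<Sum>u\<in>E. dual_scale (f u) (C u)) b"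
proof -
  have BA: "B \<subseteq> A" using B by (auto simp: finite_dim_subcoalgebra_def subcoalgebra_def)
  obtain T where T: "finite T" "B = span T" using B by (auto simp: finite_dim_subcoalgebra_def)
  obtain E c where E: "finite E" "E \<subseteq> B" "\<And>u. Vector_Spaces.linear scale (*) (c u)"
      "\<And>x. x \<in> B \<Longrightarrow> x = (\<Sum>u\<in>E. c u x *s u)"
    by (rule dual_basis[OF T(1), folded T(2)]) (rule that)
  define C where "C = (\<lambda>u x. if x \<in> A then c u x else 0)"
  have C: "C u \<in> dual" for u
    unfolding C_def by (rule dual_restrict[OF linear_imp_linear_on[OF E(3)]])
  have Cc: "C u x = c u x" if "x \<in> B" for u x using that BA by (auto simp: C_def)
  have EA: "E \<subseteq> A" using E(2) BA by blast
  show ?thesis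
  proof (rule that[OF E(1,2) C])
    show "x = (\<Sum>u\<in>E. C u x *s u)" if "x \<in> B" for x
      unfolding Cc[OF that] by (rule E(4)[OF that])
    fix f b assume f: "f \<in> dual" and b: "b \<in> B"
    have "f b = f (\<Sum>u\<in>E. c u b *s u)" by (rule arg_cong[OF E(4)[OF b]])
    also have "\<dots> = (\<Sum>u\<in>E. c u b * f u)"
      using EA f by (subst dual_sum) (auto intro!: subspace_scale[OF subspace_space] simp: dual_scale subset_iff)
    also have "\<dots> = (\<Sum>u\<in>E. dual_scale (f u) (C u)) b"
      by (simp add: Cc[OF b] sum_fun_apply fun_scale_def mult.commute)
    finally show "f b = (\<Sum>u\<in>E. dual_scale (f u) (C u)) b" .
  qed
qed

text \<open>The brackets with elements of \<open>B\<close> span a finite-dimensional space,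
  generated by the \<open>ext_bracket (C u) u'\<close> with \<open>u\<close>, \<open>u'\<close> in
  the basis \<open>E\<close>. Evaluations coming from inner derivations separate its points, so
  \<open>separating_functionals\<close> represents \<open>\<phi>\<close> on it.\<close>

lemma bracket_functional_inner:
  assumes B: "finite_dim_subcoalgebra B" and \<phi>: "linear_on (fun_scale ext_scale) (*) bracket_space \<phi>"
  shows "\<exists>i\<in>Inn. \<forall>f\<in>dual. \<forall>b\<in>B. \<phi> (ext_bracket f b) = i f b"
proof -
  have sub: "subcoalgebra B" and BA: "B \<subseteq> A" using B by (auto simp: finite_dim_subcoalgebra_def subcoalgebra_def)
  obtain E C where E: "finite E" "E \<subseteq> B" and C: "\<And>u. C u \<in> dual"
    and EC: "\<And>x. x \<in> B \<Longrightarrow> x = (\<Sum>u\<in>E. C u x *s u)"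
      "\<And>f b. f \<in> dual \<Longrightarrow> b \<in> B \<Longrightarrow> f b = (\<Sum>u\<in>E. dual_scale (f u) (C u)) b"
    by (rule subcoalgebra_dual_basis[OF B]) (rule that)
  have EA: "E \<subseteq> A" using E(2) BA by blast
  define S where "S = (\<lambda>(u, u'). ext_bracket (C u) u') ` (E \<times> E)"
  have S: "finite S" "S \<subseteq> bracket_space" unfolding S_def using E(1) EA C by (auto intro!: ext_bracket_in)
  have span_S: "X.span S \<subseteq> bracket_space" by (rule X.span_minimal[OF S(2) bracket_space_subspace])
  have in_span: "ext_bracket f b \<in> X.span S" if f: "f \<in> dual" and b: "b \<in> B" for f b
  proof -
    have bA: "b \<in> A" using b BA by blast
    define f' where "f' = (\<Sum>u\<in>E. dual_scale (f u) (C u))"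
    have f': "f' \<in> dual" unfolding f'_def by (rule J.subspace_sum[OF dual_subspace]) (auto intro: C dual_scale_closed)
    have zero: "(f - f') b = 0" if "b \<in> B" for b
      using EC(2)[OF f that] by (simp add: f'_def)
    \<comment> \<open>\<open>f'\<close> is the combination of the \<open>C u\<close> that agrees
      with \<open>f\<close> on \<open>B\<close>; the difference annihilates \<open>B\<close> and so
      is invisible to every inner derivation at \<open>b\<close>.\<close>
    have "ext_bracket (f - f') b = 0"
    proof (rule bracket_space_eq_0)
      show "ext_bracket (f - f') b \<in> bracket_space" using f f' bA by (auto intro: ext_bracket_in)
      fix g h assume gh: "g \<in> dual" "h \<in> dual"
      have "br g h (f - f') b = 0"
        by (rule inner_vanish[OF sub bracket_inner[OF gh] dual_diff_closed[OF f f'] zero b])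
      then show "h (snd (ext_bracket (f - f') b (g, 0))) = 0"
        using f f' bA gh by (subst ext_bracket_pairing) auto
    qed
    then have "ext_bracket f b = ext_bracket f' b"
      using ext_bracket_add_left[of "f - f'" f' b] f f' bA by auto
    also have "\<dots> = (\<Sum>u\<in>E. fun_scale ext_scale (f u) (ext_bracket (C u) b))"
    proof -
      have "ext_bracket (\<Sum>u\<in>F. dual_scale (f u) (C u)) b = (\<Sum>u\<in>F. fun_scale ext_scale (f u) (ext_bracket (C u) b))"
        if "finite F" for F
        using that
      proof (induction F rule: finite_induct)
        case empty
        have "ext_bracket 0 b + 0 = ext_bracket 0 b + ext_bracket 0 b"
          using ext_bracket_add_left[OF dual_0_closed dual_0_closed bA] by (metis add_0_right)
        then show ?case unfolding sum.empty by (metis add_left_cancel)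
      next
        case (insert u F)
        have "(\<Sum>u\<in>F. dual_scale (f u) (C u)) \<in> dual"
          by (rule J.subspace_sum[OF dual_subspace]) (auto intro: C dual_scale_closed)
        from ext_bracket_add_left[OF dual_scale_closed[OF C] this bA] show ?case
          unfolding sum.insert[OF insert.hyps(1,2)] insert.IH ext_bracket_scale_left[OF C bA] .
      qed
      then show ?thesis unfolding f'_def using E(1) .
    qed
    also have "\<dots> \<in> X.span S"
    proof (intro X.span_sum X.span_scale)
      fix u assume u: "u \<in> E"
      have "ext_bracket (C u) (\<Sum>u'\<in>F. C u' b *s u') \<in> X.span S" if "finite F" "F \<subseteq> E" for F
        using that
      proof (induction F rule: finite_induct)
        case empty
        have "ext_bracket (C u) 0 + 0 = ext_bracket (C u) 0 + ext_bracket (C u) 0"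
          using ext_bracket_add_right[OF C A_0 A_0, of u] by (metis add_0_right)
        then have "ext_bracket (C u) 0 = 0" by (metis add_left_cancel)
        then show ?case unfolding sum.empty by (metis X.span_zero)
      next
        case (insert u' F)
        have "u' \<in> A" "(\<Sum>u'\<in>F. C u' b *s u') \<in> A"
          using insert.prems EA by (auto intro!: subspace_sum[OF subspace_space] subspace_scale[OF subspace_space])
        moreover have "ext_bracket (C u) u' \<in> S" unfolding S_def using u insert.prems by force
        ultimately show ?case
          using insert.IH insert.prems
          unfolding sum.insert[OF insert.hyps(1,2)]
          by (subst ext_bracket_add_right[OF C])
             (auto simp only: ext_bracket_scale_right[OF C] insert_subset
               intro!: subspace_scale[OF subspace_space] X.span_add X.span_scale intro: X.span_base)
      qed
      from this[OF E(1) subset_refl] show "ext_bracket (C u) b \<in> X.span S"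
        using EC(1)[OF b] by metis
    qed
    finally show ?thesis .
  qed
  interpret vp: vector_space_pair scale scale by unfold_locales
  \<comment> \<open>A functional \<open>h\<close> is known to be additive only on \<open>A\<close>.
    Composition with a projection \<open>q\<close> onto \<open>A\<close> makes \<open>ev g h\<close>
    linear on all operators, as \<open>separating_functionals\<close> requires, without changing it
    on \<open>bracket_space\<close>.\<close>
  obtain q where q: "range q \<subseteq> A" "Vector_Spaces.linear scale scale q" "\<forall>v\<in>A. q v = v"
    using vp.linear_exists_left_inverse_on[OF linear_ident subspace_space] by (auto simp: inj_on_def)
  interpret q: Vector_Spaces.linear scale scale q by (rule q)
  have qA: "q x \<in> A" for x using q(1) by auto
  define ev where "ev = (\<lambda>g h (v :: ('a \<Rightarrow> 'k) \<times> 'a \<Rightarrow> ('a \<Rightarrow> 'k) \<times> 'a). h (q (snd (v (g, 0)))) :: 'k)"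
  have snd_scale: "snd (ext_scale k x) = k *s snd x" for k x by (cases x) (simp add: ext_scale_apply)
  have ev_linear: "Vector_Spaces.linear (fun_scale ext_scale) (*) (ev g h)" if "h \<in> dual" for g h
    using that qA
    by (simp add: Vector_Spaces.linear_iff X.vector_space_axioms vector_space_field ev_def
        q.add q.scale dual_add dual_scale fun_scale_def[of ext_scale] snd_scale)
  have ev_bracket: "ev g h (ext_bracket f a) = br g h f a" if "g \<in> dual" "h \<in> dual" "f \<in> dual" "a \<in> A" for f g h a
  proof -
    have "snd (ext_bracket f a (g, 0)) \<in> A"
      using that by (simp add: ext_bracket_apply A_0 action_in J.closures subspace_diff[OF subspace_space])
    then show ?thesis using that q(3) by (simp add: ev_def ext_bracket_pairing)
  qed
  have ev_in: "ev g h v = h (snd (v (g, 0)))" if g: "g \<in> dual" and v: "v \<in> bracket_space" for g h v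
  proof -
    obtain n :: nat and f a where fa: "\<And>i. i < n \<Longrightarrow> f i \<in> dual \<and> a i \<in> A" "v = (\<Sum>i<n. ext_bracket (f i) (a i))"
      by (rule bracket_space_sumE[OF v]) (rule that)
    then show ?thesis using ext_bracket_sum_snd_in(1)[OF fa(1) g] q(3) by (simp add: ev_def)
  qed
  interpret Y: vector_space "fun_scale (*) :: 'k \<Rightarrow> ((('a \<Rightarrow> 'k) \<times> 'a \<Rightarrow> ('a \<Rightarrow> 'k) \<times> 'a) \<Rightarrow> 'k) \<Rightarrow> _"
    by (rule vector_space_fun_scale[OF vector_space_field])
  define I where "I = Y.span {ev g h | g h. g \<in> dual \<and> h \<in> dual}"
  have I_linear: "Vector_Spaces.linear (fun_scale ext_scale) (*) i" if "i \<in> I" for i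
  proof -
    have "Y.subspace {i. Vector_Spaces.linear (fun_scale ext_scale) (*) i}"
      by (rule Y.subspaceI)
         (auto simp: Vector_Spaces.linear_iff X.vector_space_axioms vector_space_field fun_scale_def[of "(*)"] algebra_simps)
    then have "I \<subseteq> {i. Vector_Spaces.linear (fun_scale ext_scale) (*) i}"
      unfolding I_def by (rule Y.span_minimal[rotated]) (auto intro: ev_linear)
    then show ?thesis using that by blast
  qed
  have I_inner: "\<exists>j\<in>Inn. \<forall>f\<in>dual. \<forall>a\<in>A. i (ext_bracket f a) = j f a" if "i \<in> I" for i
    using that unfolding I_def
  proof (induction rule: Y.span_induct_alt)
    case base
    show ?case using O.subspace_0[OF inner_subspace] by (intro bexI[of _ 0]) auto
  next
    case (step k x i)
    then obtain g h j where gh: "g \<in> dual" "h \<in> dual" "x = ev g h"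
      and j: "j \<in> Inn" "\<forall>f\<in>dual. \<forall>a\<in>A. i (ext_bracket f a) = j f a" by blast
    show ?case
    proof (intro bexI[of _ "fun_scale dual_scale k (br g h) + j"] ballI)
      show "fun_scale dual_scale k (br g h) + j \<in> Inn"
        by (intro O.subspace_add[OF inner_subspace] O.subspace_scale[OF inner_subspace] bracket_inner gh j)
    qed (use gh j in \<open>simp add: fun_scale_def ev_bracket\<close>)
  qed
  have "\<exists>i\<in>I. \<forall>w\<in>X.span S. i w = \<phi> w"
  proof (rule X.separating_functionals[OF _ I_linear _ S(1) subset_refl])
    show "Y.subspace I" by (simp add: I_def)
    show "linear_on (fun_scale ext_scale) (*) (X.span S) \<phi>"
      using \<phi> span_S unfolding linear_on_def by blast
    fix w assume w: "w \<in> X.span S" and 0: "\<And>i. i \<in> I \<Longrightarrow> i w = 0"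
    show "w = 0"
    proof (rule bracket_space_eq_0)
      show wb: "w \<in> bracket_space" using w span_S by blast
      fix g h assume gh: "g \<in> dual" "h \<in> dual"
      then have "ev g h \<in> I" unfolding I_def by (intro Y.span_base) blast
      then show "h (snd (w (g, 0))) = 0" using 0 ev_in[OF gh(1) wb] by metis
    qed
  qed
  then obtain i where i: "i \<in> I" "\<And>w. w \<in> X.span S \<Longrightarrow> i w = \<phi> w" by blast
  obtain j where "j \<in> Inn" "\<forall>f\<in>dual. \<forall>a\<in>A. i (ext_bracket f a) = j f a"
    using I_inner[OF i(1)] by blast
  then show ?thesis using i(2)[OF in_span] BA by (metis subsetD)
qed

text \<open>The Leibniz rule for \<open>d\<close> needs no computation with \<open>\<phi>\<close>:
  at each \<open>a\<close> it is inherited from an inner derivation that agrees with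
  \<open>d\<close> on a finite-dimensional subcoalgebra containing \<open>a\<close>.\<close>

lemma bracket_functional_weakly_inner:
  assumes \<phi>: "linear_on (fun_scale ext_scale) (*) bracket_space \<phi>"
  shows "\<exists>d\<in>WDer. \<forall>f\<in>dual. \<forall>a\<in>A. d f a = \<phi> (ext_bracket f a)"
proof -
  define d where "d = (\<lambda>f. if f \<in> dual then (\<lambda>a. if a \<in> A then \<phi> (ext_bracket f a) else 0) else 0)"
  have d_apply: "d f a = \<phi> (ext_bracket f a)" if "f \<in> dual" "a \<in> A" for f a
    using that by (simp add: d_def)
  have \<phi>_add: "\<phi> (v + w) = \<phi> v + \<phi> w" if "v \<in> bracket_space" "w \<in> bracket_space" for v w
    using \<phi> that by (auto simp: linear_on_def)
  have \<phi>_scale: "\<phi> (fun_scale ext_scale c v) = c * \<phi> v" if "v \<in> bracket_space" for v c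
    using \<phi> that by (auto simp: linear_on_def)
  have d_in: "d f \<in> dual" if "f \<in> dual" for f
    using that unfolding d_def
    by (simp, intro dual_restrict)
       (simp add: linear_on_def ext_bracket_add_right ext_bracket_scale_right \<phi>_add \<phi>_scale ext_bracket_in)
  have op: "d \<in> dual_operators"
    unfolding dual_operators_def linear_on_def
  proof (intro CollectI conjI ballI allI impI image_subsetI d_in)
    fix f g assume "f \<in> dual" "g \<in> dual"
    then show "d (f + g) = d f + d g"
      by (intro dual_eqI)
         (auto intro: d_in simp: d_apply dual_add_closed ext_bracket_add_left \<phi>_add ext_bracket_in)
  next
    fix c f assume f: "f \<in> dual"
    show "d (dual_scale c f) = dual_scale c (d f)"
    proof (rule dual_eqI)
      fix x assume "x \<in> A"
      then show "d (dual_scale c f) x = dual_scale c (d f) x"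
        using f by (simp add: d_apply dual_scale_closed ext_bracket_scale_left \<phi>_scale ext_bracket_in
            fun_scale_def[of "(*)" _ "d f"])
    qed (use f in \<open>auto intro: d_in\<close>)
  next
    fix f assume "f \<notin> dual" then show "d f = 0" by (simp add: d_def)
  qed
  have loc: "\<exists>i\<in>Inn. \<forall>f\<in>dual. \<forall>b\<in>B. d f b = i f b" if B: "finite_dim_subcoalgebra B" for B
  proof -
    have BA: "B \<subseteq> A" using B by (auto simp: finite_dim_subcoalgebra_def subcoalgebra_def)
    obtain i where "i \<in> Inn" "\<forall>f\<in>dual. \<forall>b\<in>B. \<phi> (ext_bracket f b) = i f b"
      using bracket_functional_inner[OF B \<phi>] by blast
    then show ?thesis using d_apply BA by (intro bexI[of _ i]) auto
  qed
  have "d \<in> Der"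
  proof (rule derivationI[OF op])
    fix x y assume xy: "x \<in> dual" "y \<in> dual"
    show "d (x \<odot> y) = d x \<odot> y + x \<odot> d y"
    proof (rule dual_eqI)
      show "d (x \<odot> y) \<in> dual" "d x \<odot> y + x \<odot> d y \<in> dual"
        using xy d_in by (auto intro!: dual_mult_closed dual_add_closed)
      fix a assume a: "a \<in> A"
      obtain B where B: "finite_dim_subcoalgebra B" "a \<in> B"
        using finite_dim_subcoalgebra_exists[of "{a}"] a by auto
      have sub: "subcoalgebra B" using B by (simp add: finite_dim_subcoalgebra_def)
      obtain i where i: "i \<in> Inn" "\<forall>f\<in>dual. \<forall>b\<in>B. d f b = i f b" using loc[OF B(1)] by blast
      have iD: "i \<in> Der" using i inner_derivation by blast
      have i_in: "i f \<in> dual" if "f \<in> dual" for f using that iD derivation_operator operator_in by blast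
      \<comment> \<open>\<open>d f\<close> and \<open>i f\<close> agree on \<open>B\<close>, and a
        product at \<open>a\<close> sees its factors only on \<open>B\<close>.\<close>
      have "((d f - i f) \<odot> g) a = 0" if "f \<in> dual" "g \<in> dual" for f g
        by (rule dual_mult_vanish[OF sub _ _ _ B(2)]) (use that i(2) d_in i_in in auto)
      then have eq: "(d f \<odot> g) a = (i f \<odot> g) a" if "f \<in> dual" "g \<in> dual" for f g
        using that d_in i_in by (simp add: J.mult_diff_left)
      have "d (x \<odot> y) a = i (x \<odot> y) a" using i(2) B(2) xy by (simp add: dual_mult_closed)
      also have "\<dots> = (i x \<odot> y) a + (i y \<odot> x) a"
        using derivation_mult[OF iD xy] J.mult_commute[OF xy(1) i_in[OF xy(2)]] by simp
      also have "\<dots> = (d x \<odot> y) a + (d y \<odot> x) a" using eq xy by simp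
      finally show "d (x \<odot> y) a = (d x \<odot> y + x \<odot> d y) a"
        using J.mult_commute[OF xy(1) d_in[OF xy(2)]] by simp
    qed
  qed
  then have "d \<in> WDer" using loc by (simp add: weakly_inner_iff)
  then show ?thesis using d_apply by blast
qed

end

context unital_jordan_coalgebra
begin

section \<open>The Lie algebra \<open>L(A\<^sup>*)\<close>\<close>

lemma R_dual_operator: "r \<in> R_dual \<Longrightarrow> r \<in> dual_operators"
  by (erule R_dualE) (simp add: operator_closures right_mult_operator weakly_inner_operator)

lemma R_dual_subspace: "O.subspace R_dual"
proof (rule O.subspaceI)
  have "\<rho> 0 + 0 \<in> R_dual" by (rule R_dualI[OF dual_0_closed O.subspace_0[OF weakly_inner_subspace]])
  then show "0 \<in> R_dual" by (simp only: right_mult_0 add_0_right)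
next
  fix r s assume "r \<in> R_dual" "s \<in> R_dual"
  then obtain g d h d' where *: "g \<in> dual" "d \<in> WDer" "h \<in> dual" "d' \<in> WDer" "r = \<rho> g + d" "s = \<rho> h + d'"
    by (metis R_dualE)
  have "r + s = \<rho> (g + h) + (d + d')" unfolding *(5,6) right_mult_add[OF *(1,3)] by (simp only: ac_simps)
  then show "r + s \<in> R_dual"
    using R_dualI[OF dual_add_closed[OF *(1,3)] O.subspace_add[OF weakly_inner_subspace *(2,4)]] by metis
next
  fix r c assume "r \<in> R_dual"
  then obtain g d where *: "g \<in> dual" "d \<in> WDer" "r = \<rho> g + d" by (metis R_dualE)
  have "fun_scale dual_scale c r = \<rho> (dual_scale c g) + fun_scale dual_scale c d"
    unfolding *(3) right_mult_scale[OF *(1)] by (rule O.scale_right_distrib)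
  then show "fun_scale dual_scale c r \<in> R_dual"
    using R_dualI[OF dual_scale_closed[OF *(1)] O.subspace_scale[OF weakly_inner_subspace *(2)]] by metis
qed

lemmas R_dual_closures = O.subspace_add[OF R_dual_subspace] O.subspace_diff[OF R_dual_subspace]
  O.subspace_neg[OF R_dual_subspace] O.subspace_scale[OF R_dual_subspace] O.subspace_0[OF R_dual_subspace]

lemma R_eps_right_mult: "g \<in> dual \<Longrightarrow> d \<in> WDer \<Longrightarrow> R_eps (\<rho> g + d) = \<rho> (- g) + d"
  by (simp only: R_eps_sum right_mult_minus)

lemma R_eps_in: "r \<in> R_dual \<Longrightarrow> R_eps r \<in> R_dual"
  by (erule R_dualE) (simp only: R_eps_right_mult R_dualI dual_minus_closed)

text \<open>Expresses \<open>\<epsilon>\<close> by the value \<open>r e\<close> instead of a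
  decomposition of \<open>r\<close>, so that additivity needs no choice of summands.\<close>

lemma R_eps_eq: "r \<in> R_dual \<Longrightarrow> R_eps r = r - \<rho> (r e) - \<rho> (r e)"
proof -
  assume "r \<in> R_dual"
  then obtain g d where *: "g \<in> dual" "d \<in> WDer" "r = \<rho> g + d" by (metis R_dualE)
  show ?thesis
    unfolding *(3) R_dual_value[OF *(1,2)] R_eps_sum[OF *(1,2)] by simp
qed

lemma R_eps_add: "r \<in> R_dual \<Longrightarrow> s \<in> R_dual \<Longrightarrow> R_eps (r + s) = R_eps r + R_eps s"
  using R_dual_operator operator_in unit_in
  by (simp only: R_eps_eq R_dual_closures plus_fun_apply right_mult_add) (simp only: algebra_simps)

lemma R_eps_diff: "r \<in> R_dual \<Longrightarrow> s \<in> R_dual \<Longrightarrow> R_eps (r - s) = R_eps r - R_eps s"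
  using R_eps_add[of "r - s" s] R_dual_closures(2)[of r s] by (simp add: algebra_simps)

lemma commutator_R_dual:
  assumes "g \<in> dual" "d \<in> WDer" "h \<in> dual" "d' \<in> WDer"
  shows "op_commutator (\<rho> g + d) (\<rho> h + d') = \<rho> (d' g - d h) + (br g h + op_commutator d d')"
proof -
  note op = weakly_inner_operator[OF assms(2)] weakly_inner_operator[OF assms(4)]
    right_mult_operator[OF assms(1)] right_mult_operator[OF assms(3)]
  have 1: "op_commutator (\<rho> g) d' = \<rho> (d' g)"
    using commutator_right_mult_derivation weakly_inner_derivation assms by blast
  have 2: "op_commutator d (\<rho> h) = - \<rho> (d h)"
    using commutator_right_mult_derivation[of d h] weakly_inner_derivation commutator_skew[of d "\<rho> h"] assms by metis
  have "op_commutator (\<rho> g + d) (\<rho> h + d') =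
      (br g h + op_commutator (\<rho> g) d') + (op_commutator d (\<rho> h) + op_commutator d d')"
    using op by (simp only: commutator_add_left commutator_add_right operator_closures mult_bracket_def) (simp only: ac_simps)
  then show ?thesis
    unfolding 1 2 right_mult_diff[OF operator_in[OF op(2) assms(1)] operator_in[OF op(1) assms(3)]]
    by (simp add: algebra_simps)
qed

lemma commutator_WDer: "g \<in> dual \<Longrightarrow> h \<in> dual \<Longrightarrow> d \<in> WDer \<Longrightarrow> d' \<in> WDer \<Longrightarrow> br g h + op_commutator d d' \<in> WDer"
  by (rule O.subspace_add[OF weakly_inner_subspace inner_weakly_inner[OF bracket_inner] weakly_inner_commutator])

text \<open>In \<open>commutator_R_dual\<close> the multiplication part \<open>d' g - d h\<close>
  changes sign with \<open>g\<close> and \<open>h\<close>, while \<open>[g, h]\<close> and the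
  commutator of the derivations do not. Negating \<open>g\<close> and \<open>h\<close> is the effect
  of \<open>\<epsilon>\<close>, which therefore respects commutators.\<close>

lemma R_dual_commutator:
  assumes "r \<in> R_dual" "s \<in> R_dual"
  shows "op_commutator r s \<in> R_dual" and "R_eps (op_commutator r s) = op_commutator (R_eps r) (R_eps s)"
proof -
  obtain g d where r: "g \<in> dual" "d \<in> WDer" "r = \<rho> g + d" using assms by (metis R_dualE)
  obtain h d' where s: "h \<in> dual" "d' \<in> WDer" "s = \<rho> h + d'" using assms by (metis R_dualE)
  note op = weakly_inner_operator[OF r(2)] weakly_inner_operator[OF s(2)]
  have gh: "d' g - d h \<in> dual" by (intro dual_diff_closed operator_in[OF op(1)] operator_in[OF op(2)] r s)
  note W = commutator_WDer[OF r(1) s(1) r(2) s(2)]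
  show "op_commutator r s \<in> R_dual"
    unfolding r(3) s(3) commutator_R_dual[OF r(1,2) s(1,2)] by (rule R_dualI[OF gh W])
  have "br (- g) (- h) = br g h"
    by (rule operator_eqI) (use r(1) s(1) in \<open>simp_all add: bracket_operator dual_minus_closed bracket_apply J.mult_distribs J.closures\<close>)
  moreover have "d' (- g) - d (- h) = - (d' g - d h)"
    unfolding operator_minus[OF op(1) s(1)] operator_minus[OF op(2) r(1)] by simp
  ultimately show "R_eps (op_commutator r s) = op_commutator (R_eps r) (R_eps s)"
    unfolding r(3) s(3) commutator_R_dual[OF r(1,2) s(1,2)] R_eps_right_mult[OF gh W] R_eps_right_mult[OF r(1,2)] R_eps_right_mult[OF s(1,2)]
      commutator_R_dual[OF dual_minus_closed[OF r(1)] r(2) dual_minus_closed[OF s(1)] s(2)] by metis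
qed

lemma nabla_eq: "f \<in> dual \<Longrightarrow> g \<in> dual \<Longrightarrow> nabla f g = \<rho> (f \<odot> g) + br g f"
  using bracket_skew[of g f] by (simp add: nabla_def)

lemma bracket_WDer: "f \<in> dual \<Longrightarrow> g \<in> dual \<Longrightarrow> br f g \<in> WDer"
  by (intro inner_weakly_inner bracket_inner)

lemma nabla_in: "f \<in> dual \<Longrightarrow> g \<in> dual \<Longrightarrow> nabla f g \<in> R_dual"
  by (simp only: nabla_eq) (intro R_dualI dual_mult_closed bracket_WDer)

lemma nabla_operator: "f \<in> dual \<Longrightarrow> g \<in> dual \<Longrightarrow> nabla f g \<in> dual_operators"
  by (intro R_dual_operator nabla_in)

lemma nabla_apply: "f \<in> dual \<Longrightarrow> g \<in> dual \<Longrightarrow> x \<in> dual \<Longrightarrow>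
    nabla f g x = x \<odot> (f \<odot> g) - ((x \<odot> f) \<odot> g - (x \<odot> g) \<odot> f)"
  by (simp add: nabla_def right_mult_apply bracket_apply)

lemma R_eps_nabla_apply: "f \<in> dual \<Longrightarrow> g \<in> dual \<Longrightarrow> x \<in> dual \<Longrightarrow>
    R_eps (nabla f g) x = - (x \<odot> (f \<odot> g)) - ((x \<odot> f) \<odot> g - (x \<odot> g) \<odot> f)"
  by (simp only: nabla_eq R_eps_sum dual_mult_closed bracket_WDer)
     (simp add: right_mult_apply bracket_apply)

lemma nabla_add_left: "f \<in> dual \<Longrightarrow> f' \<in> dual \<Longrightarrow> g \<in> dual \<Longrightarrow> nabla (f + f') g = nabla f g + nabla f' g"
  and nabla_diff_left: "f \<in> dual \<Longrightarrow> f' \<in> dual \<Longrightarrow> g \<in> dual \<Longrightarrow> nabla (f - f') g = nabla f g - nabla f' g"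
  and nabla_diff_right: "f \<in> dual \<Longrightarrow> f' \<in> dual \<Longrightarrow> g \<in> dual \<Longrightarrow> nabla g (f - f') = nabla g f - nabla g f'"
  by (rule operator_eqI,
      simp add: nabla_operator J.closures operator_closures, simp add: nabla_operator operator_closures,
      simp add: nabla_apply J.closures J.mult_distribs)+

text \<open>With \<open>r = \<rho> h + d\<close>, the contribution of \<open>d\<close> is the
  Leibniz rule, \<open>nabla\<close> being built from products. The contribution of \<open>h\<close>
  combines \<open>bracket_cyclic\<close> with the fact that \<open>[f, g]\<close> is a
  derivation.\<close>

lemma commutator_nabla:
  assumes fg: "f \<in> dual" "g \<in> dual" and r: "r \<in> R_dual"
  shows "op_commutator (nabla f g) r = nabla (r f) g + nabla f (R_eps r g)"
proof (rule operator_eqI)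
  note op = R_dual_operator[OF r] R_dual_operator[OF R_eps_in[OF r]]
  have cl: "r f \<in> dual" "R_eps r g \<in> dual" using op fg operator_in by blast+
  show "op_commutator (nabla f g) r \<in> dual_operators"
    by (intro commutator_operator nabla_operator fg op)
  show "nabla (r f) g + nabla f (R_eps r g) \<in> dual_operators"
    by (intro operator_closures nabla_operator fg cl)
  fix x assume x: "x \<in> dual"
  obtain h d where hd: "h \<in> dual" "d \<in> WDer" "r = \<rho> h + d" using r by (rule R_dualE)
  have dD: "d \<in> Der" and dO: "d \<in> dual_operators"
    using hd weakly_inner_derivation weakly_inner_operator by blast+
  have dx: "d f \<in> dual" "d g \<in> dual" "d x \<in> dual" using dO fg x operator_in by blast+
  have r_apply: "r y = y \<odot> h + d y" if "y \<in> dual" for y using that hd(3) by (simp add: right_mult_apply)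
  have eps_apply: "R_eps r y = d y - y \<odot> h" if "y \<in> dual" for y
    using that hd by (simp add: R_eps_sum right_mult_apply)
  have N: "nabla f g y \<in> dual" if "y \<in> dual" for y using operator_in[OF nabla_operator[OF fg] that] .
  have "op_commutator (nabla f g) r x = r (nabla f g x) - nabla f g (r x)"
    by (simp add: op_commutator_def)
  also have "\<dots> = (nabla f g x \<odot> h + d (nabla f g x)) - (nabla f g (x \<odot> h) + nabla f g (d x))"
    using operator_add[OF nabla_operator[OF fg] dual_mult_closed[OF x hd(1)] dx(3)]
    by (simp only: r_apply[OF N[OF x]] r_apply[OF x])
  also have "\<dots> = nabla (r f) g x + nabla f (R_eps r g) x"
  proof -
    have der: "d (nabla f g x) = nabla f g (d x) + nabla (d f) g x + nabla f (d g) x"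
      using fg x dx
      by (simp add: nabla_apply J.closures operator_add[OF dO] operator_diff[OF dO] derivation_mult[OF dD]
          J.mult_distribs algebra_simps)
    \<comment> \<open>The minus sign on the last term is the effect of \<open>\<epsilon>\<close>,
      which replaces \<open>h\<close> by \<open>- h\<close> where \<open>r\<close> acts on
      \<open>g\<close>.\<close>
    have e1: "nabla f g x \<odot> h - nabla f g (x \<odot> h) = nabla (f \<odot> h) g x - nabla f (g \<odot> h) x"
    proof -
      have 1: "((x \<odot> (f \<odot> g)) \<odot> h - (x \<odot> h) \<odot> (f \<odot> g)) + ((x \<odot> (g \<odot> h)) \<odot> f - (x \<odot> f) \<odot> (g \<odot> h))
          + ((x \<odot> (h \<odot> f)) \<odot> g - (x \<odot> g) \<odot> (h \<odot> f)) = 0"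
        by (rule J.bracket_cyclic[OF dual_two fg hd(1) x])
      have bh: "br f g (x \<odot> h) = br f g x \<odot> h + x \<odot> br f g h"
        by (rule derivation_mult[OF bracket_derivation[OF fg] x hd(1)])
      have 2: "((x \<odot> h) \<odot> f) \<odot> g - ((x \<odot> h) \<odot> g) \<odot> f = (((x \<odot> f) \<odot> g) \<odot> h - ((x \<odot> g) \<odot> f) \<odot> h)
          + (x \<odot> ((h \<odot> f) \<odot> g) - x \<odot> ((h \<odot> g) \<odot> f))"
        using bh fg x hd(1) by (simp add: bracket_apply J.closures J.mult_distribs)
      note c = J.mult_commute[OF fg(1) hd(1)] J.mult_commute[OF fg(2) hd(1)]
        J.mult_commute[OF fg(1) dual_mult_closed[OF hd(1) fg(2)]]
      show ?thesis
        using arg_cong2[OF 1 2, of "(+)"] fg x hd(1) by (simp add: nabla_apply J.closures J.mult_distribs c algebra_simps)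
    qed
    have e2: "nabla (r f) g x + nabla f (R_eps r g) x
      = nabla (f \<odot> h) g x + nabla (d f) g x + (nabla f (d g) x - nabla f (g \<odot> h) x)"
      by (simp only: r_apply[OF fg(1)] eps_apply[OF fg(2)] nabla_add_left nabla_diff_right dual_mult_closed fg hd(1) dx
          plus_fun_apply minus_apply)
    have "(nabla f g x \<odot> h + d (nabla f g x)) - (nabla f g (x \<odot> h) + nabla f g (d x))
      = (nabla f g x \<odot> h - nabla f g (x \<odot> h)) + (nabla (d f) g x + nabla f (d g) x)"
      unfolding der by (simp only: algebra_simps)
    then show ?thesis unfolding e1 e2 by (simp only: algebra_simps)
  qed
  finally show "op_commutator (nabla f g) r x = (nabla (r f) g + nabla f (R_eps r g)) x" by simp
qed

lemma L_bracket_apply: "L_bracket (a1, r1, b1) (a2, r2, b2) =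
    (r2 a1 - r1 a2, nabla a1 b2 - nabla a2 b1 + op_commutator r1 r2, R_eps r2 b1 - R_eps r1 b2)"
  by (simp add: L_bracket_def)

lemma L_bracket_closed:
  assumes "u \<in> L_dual" "v \<in> L_dual"
  shows "L_bracket u v \<in> L_dual"
proof -
  obtain a1 r1 b1 a2 r2 b2 where uv: "u = (a1, r1, b1)" "v = (a2, r2, b2)"
    by (metis prod_cases3)
  have a: "a1 \<in> dual" "a2 \<in> dual" "b1 \<in> dual" "b2 \<in> dual" and r: "r1 \<in> R_dual" "r2 \<in> R_dual"
    using assms by (auto simp: uv L_dual_def)
  note i = r[THEN R_dual_operator, THEN operator_in] r[THEN R_eps_in, THEN R_dual_operator, THEN operator_in]
  show ?thesis
    unfolding uv L_bracket_apply L_dual_def mem_Times_iff fst_conv snd_conv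
    by (intro conjI dual_diff_closed R_dual_closures nabla_in R_dual_commutator(1) i a r)
qed

lemma L_bracket_self: "L_bracket u u = 0"
  by (cases u) (simp add: L_bracket_apply op_commutator_def zero_prod_def fun_eq_iff)

text \<open>In the outer components the terms with two operators cancel in pairs and the rest
  cancels by symmetry of the Jordan triple product. In the middle one
  \<open>commutator_nabla\<close> makes all \<open>nabla\<close> terms cancel, and the Jacobi
  identity for operators remains.\<close>

lemma L_bracket_jacobi:
  assumes "u \<in> L_dual" "v \<in> L_dual" "w \<in> L_dual"
  shows "L_bracket (L_bracket u v) w + L_bracket (L_bracket v w) u + L_bracket (L_bracket w u) v = 0"
proof -
  obtain a1 r1 b1 a2 r2 b2 a3 r3 b3 where uvw: "u = (a1, r1, b1)" "v = (a2, r2, b2)" "w = (a3, r3, b3)"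
    by (metis prod_cases3)
  have a: "a1 \<in> dual" "a2 \<in> dual" "a3 \<in> dual" and b: "b1 \<in> dual" "b2 \<in> dual" "b3 \<in> dual"
    and r: "r1 \<in> R_dual" "r2 \<in> R_dual" "r3 \<in> R_dual" using assms by (auto simp: uvw L_dual_def)
  have eR: "R_eps r1 \<in> R_dual" "R_eps r2 \<in> R_dual" "R_eps r3 \<in> R_dual" using r R_eps_in by blast+
  note op = r[THEN R_dual_operator] eR[THEN R_dual_operator]
  note opin = op[THEN operator_in]
  have 1: "r3 (r2 x - r1 y) - (nabla x g - nabla y f + op_commutator r1 r2) z
     = r3 (r2 x) - r3 (r1 y) - nabla x g z + nabla y f z - r2 (r1 z) + r1 (r2 z)"
    if "r1 \<in> dual_operators" "r2 \<in> dual_operators" "r3 \<in> dual_operators" "x \<in> dual" "y \<in> dual"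
    for r1 r2 r3 x y z f g
    using that by (simp add: operator_diff[OF that(3)] operator_in op_commutator_def)
  \<comment> \<open>\<open>nabla x f z\<close> is the Jordan triple product of \<open>z\<close>,
    \<open>f\<close>, \<open>x\<close>, symmetric in its outer entries \<open>x\<close> and
    \<open>z\<close>.\<close>
  have sym: "nabla x f z = nabla z f x" if "x \<in> dual" "f \<in> dual" "z \<in> dual" for x f z
    using that J.mult_commute[OF that(1,3)] J.mult_commute[of z "x \<odot> f"] J.mult_commute[of x "z \<odot> f"]
    by (simp add: nabla_apply J.closures)
  have plus: "(r3 (r2 a1 - r1 a2) - (nabla a1 b2 - nabla a2 b1 + op_commutator r1 r2) a3)
    + (r1 (r3 a2 - r2 a3) - (nabla a2 b3 - nabla a3 b2 + op_commutator r2 r3) a1)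
    + (r2 (r1 a3 - r3 a1) - (nabla a3 b1 - nabla a1 b3 + op_commutator r3 r1) a2) = 0"
    unfolding 1[OF op(1-3) a(1,2)] 1[OF op(2,3,1) a(2,3)] 1[OF op(3,1,2) a(3,1)]
      sym[OF a(1) b(2) a(3)] sym[OF a(2) b(1) a(3)] sym[OF a(2) b(3) a(1)] by simp
  have 2: "nabla (r2 x - r1 y) g3 - nabla z (R_eps r2 f - R_eps r1 g) + op_commutator (nabla x g - nabla y f + op_commutator r1 r2) r3
     = nabla (r2 x) g3 - nabla (r1 y) g3 - nabla z (R_eps r2 f) + nabla z (R_eps r1 g)
      + (nabla (r3 x) g + nabla x (R_eps r3 g)) - (nabla (r3 y) f + nabla y (R_eps r3 f)) + op_commutator (op_commutator r1 r2) r3"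
    if R: "r1 \<in> R_dual" "r2 \<in> R_dual" "r3 \<in> R_dual" and d: "x \<in> dual" "y \<in> dual" "z \<in> dual" "f \<in> dual" "g \<in> dual" "g3 \<in> dual"
    for r1 r2 r3 x y z f g g3
  proof -
    note op = R[THEN R_dual_operator] R[THEN R_eps_in, THEN R_dual_operator]
    note i = op[THEN operator_in]
    have "op_commutator (nabla x g - nabla y f + op_commutator r1 r2) r3
      = (nabla (r3 x) g + nabla x (R_eps r3 g)) - (nabla (r3 y) f + nabla y (R_eps r3 f)) + op_commutator (op_commutator r1 r2) r3"
      using op d by (simp only: commutator_add_left commutator_diff_left commutator_nabla[OF d(1,5) R(3)] commutator_nabla[OF d(2,4) R(3)]
          nabla_operator commutator_operator operator_closures)
    then show ?thesis
      by (simp only: nabla_diff_left[OF i(2)[OF d(1)] i(1)[OF d(2)] d(6)] nabla_diff_right[OF i(5)[OF d(4)] i(4)[OF d(5)] d(3)])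
         (simp only: algebra_simps)
  qed
  have zero: "(nabla (r2 a1 - r1 a2) b3 - nabla a3 (R_eps r2 b1 - R_eps r1 b2) + op_commutator (nabla a1 b2 - nabla a2 b1 + op_commutator r1 r2) r3)
    + (nabla (r3 a2 - r2 a3) b1 - nabla a1 (R_eps r3 b2 - R_eps r2 b3) + op_commutator (nabla a2 b3 - nabla a3 b2 + op_commutator r2 r3) r1)
    + (nabla (r1 a3 - r3 a1) b2 - nabla a2 (R_eps r1 b3 - R_eps r3 b1) + op_commutator (nabla a3 b1 - nabla a1 b3 + op_commutator r3 r1) r2) = 0"
    (is "?Z = 0")
  proof -
    have "?Z = op_commutator (op_commutator r1 r2) r3 + op_commutator (op_commutator r2 r3) r1 + op_commutator (op_commutator r3 r1) r2"
      unfolding 2[OF r(1-3) a(1-3) b(1-3)] 2[OF r(2,3,1) a(2,3,1) b(2,3,1)] 2[OF r(3,1,2) a(3,1,2) b(3,1,2)]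
      by (simp only: algebra_simps)
    then show ?thesis using commutator_jacobi[OF op(1-3)] by simp
  qed
  have 3: "R_eps s3 (R_eps s2 f - R_eps s1 g) - R_eps (nabla x g - nabla y f + op_commutator s1 s2) h
      = R_eps s3 (R_eps s2 f) - R_eps s3 (R_eps s1 g) - R_eps (nabla x g) h + R_eps (nabla y f) h
        - R_eps s2 (R_eps s1 h) + R_eps s1 (R_eps s2 h)"
    if R: "s1 \<in> R_dual" "s2 \<in> R_dual" "s3 \<in> R_dual" and d: "x \<in> dual" "y \<in> dual" "f \<in> dual" "g \<in> dual"
    for s1 s2 s3 x y h f g
  proof -
    note op = R[THEN R_eps_in, THEN R_dual_operator]
    note i = op[THEN operator_in]
    have "R_eps (nabla x g - nabla y f + op_commutator s1 s2) = R_eps (nabla x g) - R_eps (nabla y f) + op_commutator (R_eps s1) (R_eps s2)"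
      using R d by (simp only: R_eps_add R_eps_diff R_dual_closures nabla_in R_dual_commutator)
    then show ?thesis
      by (simp only: operator_diff[OF op(3) i(2)[OF d(3)] i(1)[OF d(4)]]) (simp add: op_commutator_def)
  qed
  \<comment> \<open>Under \<open>\<epsilon>\<close> the value becomes minus the triple product with
    \<open>x\<close> in the middle, so the outer entries are now \<open>g\<close> and
    \<open>h\<close>.\<close>
  have sym': "R_eps (nabla x g) h = R_eps (nabla x h) g" if "x \<in> dual" "g \<in> dual" "h \<in> dual" for x g h
    using that J.mult_commute[OF that(2,3)] J.mult_commute[of h "x \<odot> g"] J.mult_commute[of h x]
      J.mult_commute[of g "x \<odot> h"] J.mult_commute[of g x] J.mult_commute[of "g \<odot> h" x]
    by (simp add: R_eps_nabla_apply J.closures)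
  have minus: "(R_eps r3 (R_eps r2 b1 - R_eps r1 b2) - R_eps (nabla a1 b2 - nabla a2 b1 + op_commutator r1 r2) b3)
    + (R_eps r1 (R_eps r3 b2 - R_eps r2 b3) - R_eps (nabla a2 b3 - nabla a3 b2 + op_commutator r2 r3) b1)
    + (R_eps r2 (R_eps r1 b3 - R_eps r3 b1) - R_eps (nabla a3 b1 - nabla a1 b3 + op_commutator r3 r1) b2) = 0"
    unfolding 3[OF r(1-3) a(1,2) b(1,2)] 3[OF r(2,3,1) a(2,3) b(2,3)] 3[OF r(3,1,2) a(3,1) b(3,1)]
      sym'[OF a(1) b(2) b(3)] sym'[OF a(2) b(1) b(3)] sym'[OF a(3) b(2) b(1)] by simp
  show ?thesis
    unfolding uvw L_bracket_apply plus_prod_def fst_conv snd_conv plus zero minus zero_prod_def ..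
qed

end

context unital_jordan_coalgebra
begin

section \<open>The dual space of \<open>L(A)\<close>\<close>

sublocale WA: vector_space_prod "fun_scale ext_scale :: 'k \<Rightarrow> (('a \<Rightarrow> 'k) \<times> 'a \<Rightarrow> ('a \<Rightarrow> 'k) \<times> 'a) \<Rightarrow> _" scale
  by unfold_locales

sublocale LA: vector_space_prod scale "module_prod.scale (fun_scale ext_scale) scale ::
    'k \<Rightarrow> (('a \<Rightarrow> 'k) \<times> 'a \<Rightarrow> ('a \<Rightarrow> 'k) \<times> 'a) \<times> 'a \<Rightarrow> _"
  by unfold_locales

lemma L_scale_apply: "L_scale c (a, w, b) = (c *s a, fun_scale ext_scale c w, c *s b)"
  by (simp add: L_scale_def LA.scale_def WA.scale_def)

sublocale L: vector_space L_scale
  unfolding L_scale_def by (rule LA.p.vector_space_axioms)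

lemma L_dual_scale_apply: "L_dual_scale c (f, r, h) = (dual_scale c f, fun_scale dual_scale c r, dual_scale c h)"
proof -
  interpret W: vector_space_prod "fun_scale dual_scale :: 'k \<Rightarrow> (('a \<Rightarrow> 'k) \<Rightarrow> ('a \<Rightarrow> 'k)) \<Rightarrow> _"
    "dual_scale :: 'k \<Rightarrow> ('a \<Rightarrow> 'k) \<Rightarrow> _" by unfold_locales
  interpret L': vector_space_prod "dual_scale :: 'k \<Rightarrow> ('a \<Rightarrow> 'k) \<Rightarrow> _" W.scale by unfold_locales
  show ?thesis by (simp add: L_dual_scale_def L'.scale_def W.scale_def)
qed

lemma R_space_subspace: "X.subspace R_space"
proof (rule X.subspaceI)
  have "ext_right_mult 0 = 0" using ext_right_mult_scale[OF A_0, of 0] by simp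
  then show "0 \<in> R_space" using R_spaceI[OF A_0 X.subspace_0[OF bracket_space_subspace]] by (metis add_0_right)
next
  fix w w' assume "w \<in> R_space" "w' \<in> R_space"
  then obtain b v b' v' where *: "b \<in> A" "v \<in> bracket_space" "b' \<in> A" "v' \<in> bracket_space"
    "w = ext_right_mult b + v" "w' = ext_right_mult b' + v'" by (metis R_spaceE)
  have "w + w' = ext_right_mult (b + b') + (v + v')"
    unfolding *(5,6) ext_right_mult_add[OF *(1,3)] by (simp only: ac_simps)
  then show "w + w' \<in> R_space"
    using R_spaceI[OF subspace_add[OF subspace_space *(1,3)] X.subspace_add[OF bracket_space_subspace *(2,4)]] by metis
next
  fix w c assume "w \<in> R_space"
  then obtain b v where *: "b \<in> A" "v \<in> bracket_space" "w = ext_right_mult b + v" by (metis R_spaceE)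
  have "fun_scale ext_scale c w = ext_right_mult (c *s b) + fun_scale ext_scale c v"
    unfolding *(3) ext_right_mult_scale[OF *(1)] by (rule X.scale_right_distrib)
  then show "fun_scale ext_scale c w \<in> R_space"
    using R_spaceI[OF subspace_scale[OF subspace_space *(1)] X.subspace_scale[OF bracket_space_subspace *(2)]] by metis
qed

lemma L_space_subspace: "L.subspace L_space"
  unfolding L_scale_def L_space_def
  by (intro LA.subspace_Times WA.subspace_Times subspace_space R_space_subspace)

lemma R_pairing_add:
  assumes r: "r \<in> R_dual" and w: "w \<in> R_space" "w' \<in> R_space"
  shows "R_pairing r (w + w') = R_pairing r w + R_pairing r w'"
proof -
  obtain g d where gd: "g \<in> dual" "d \<in> WDer" "r = \<rho> g + d" using r by (rule R_dualE)
  obtain b v b' v' where *: "b \<in> A" "v \<in> bracket_space" "b' \<in> A" "v' \<in> bracket_space"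
    "w = ext_right_mult b + v" "w' = ext_right_mult b' + v'" using w by (metis R_spaceE)
  have eq: "w + w' = ext_right_mult (b + b') + (v + v')"
    unfolding *(5,6) ext_right_mult_add[OF *(1,3)] by (simp only: ac_simps)
  have "R_pairing r (w + w') = g (b + b') + bracket_pairing d (v + v')"
    unfolding eq gd(3)
    by (rule R_pairing_sum[OF gd(1,2) subspace_add[OF subspace_space *(1,3)] X.subspace_add[OF bracket_space_subspace *(2,4)]])
  then show ?thesis
    using dual_add[OF gd(1) *(1,3)] bracket_pairing_add[OF gd(2) *(2,4)]
      R_pairing_sum[OF gd(1,2) *(1,2)] R_pairing_sum[OF gd(1,2) *(3,4)] by (simp add: gd(3) *(5,6))
qed

lemma R_pairing_scale:
  assumes r: "r \<in> R_dual" and w: "w \<in> R_space"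
  shows "R_pairing r (fun_scale ext_scale c w) = c * R_pairing r w"
proof -
  obtain g d where gd: "g \<in> dual" "d \<in> WDer" "r = \<rho> g + d" using r by (rule R_dualE)
  obtain b v where *: "b \<in> A" "v \<in> bracket_space" "w = ext_right_mult b + v" using w by (metis R_spaceE)
  have eq: "fun_scale ext_scale c w = ext_right_mult (c *s b) + fun_scale ext_scale c v"
    unfolding *(3) ext_right_mult_scale[OF *(1)] by (rule X.scale_right_distrib)
  have "R_pairing r (fun_scale ext_scale c w) = g (c *s b) + bracket_pairing d (fun_scale ext_scale c v)"
    unfolding eq gd(3)
    by (rule R_pairing_sum[OF gd(1,2) subspace_scale[OF subspace_space *(1)] X.subspace_scale[OF bracket_space_subspace *(2)]])
  then show ?thesis
    using dual_scale[OF gd(1) *(1)] bracket_pairing_scale[OF gd(2) *(2)]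
      R_pairing_sum[OF gd(1,2) *(1,2)] by (simp add: gd(3) *(3) distrib_left)
qed

text \<open>
  The elements \<open>(f a)' + [f, a]\<close> span \<open>R(A)\<close>; against them \<open>r\<close> need not be split into its
  multiplication and derivation parts.
\<close>

lemma R_pairing_generator:
  assumes "r \<in> R_dual" "f \<in> dual" "a \<in> A"
  shows "R_pairing r (ext_right_mult (action f a) + ext_bracket f a) = r f a"
    and "R_pairing r (ext_right_mult (- action f a) + ext_bracket f a) = R_eps r f a"
proof -
  obtain g d where gd: "g \<in> dual" "d \<in> WDer" "r = \<rho> g + d" using assms(1) by (rule R_dualE)
  have fa: "action f a \<in> A" "- action f a \<in> A"
    using action_in[OF assms(3,2)] subspace_neg[OF subspace_space] by auto
  have g: "g (action f a) = (f \<odot> g) a" "g (- action f a) = - (f \<odot> g) a"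
    using dual_action[OF gd(1) assms(2,3)] J.mult_commute[OF gd(1) assms(2)] dual_diff[OF gd(1) A_0 fa(1)] dual_0[OF gd(1)]
    by simp_all
  show "R_pairing r (ext_right_mult (action f a) + ext_bracket f a) = r f a"
    unfolding gd(3) R_pairing_sum[OF gd(1,2) fa(1) ext_bracket_in[OF assms(2,3)]]
    using assms gd g by (simp add: bracket_pairing_bracket right_mult_apply)
  show "R_pairing r (ext_right_mult (- action f a) + ext_bracket f a) = R_eps r f a"
    unfolding gd(3) R_pairing_sum[OF gd(1,2) fa(2) ext_bracket_in[OF assms(2,3)]] R_eps_sum[OF gd(1,2)]
    using assms gd g by (simp add: bracket_pairing_bracket right_mult_apply)
qed

text \<open>Only values of \<open>r\<close> appear: the multiplication part is \<open>r e\<close>,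
  and \<open>d f a\<close> is \<open>r f a - r e (action f a)\<close>. Linearity of the pairing in
  \<open>r\<close> and the rank computation for the bracket both rest on this form.\<close>

lemma R_pairing_expand:
  assumes r: "r \<in> R_dual" and b: "b \<in> A" and fa: "\<And>i. i < (n::nat) \<Longrightarrow> f i \<in> dual \<and> a i \<in> A"
  shows "R_pairing r (ext_right_mult b + (\<Sum>i<n. ext_bracket (f i) (a i)))
    = r e b + (\<Sum>i<n. r (f i) (a i) - r e (action (f i) (a i)))"
proof -
  obtain g d where gd: "g \<in> dual" "d \<in> WDer" "r = \<rho> g + d" using r by (rule R_dualE)
  have v: "(\<Sum>i<n. ext_bracket (f i) (a i)) \<in> bracket_space"
    by (rule X.subspace_sum[OF bracket_space_subspace]) (use fa in \<open>auto intro: ext_bracket_in\<close>)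
  have re: "r e = g" unfolding gd(3) by (rule R_dual_value[OF gd(1,2)])
  have "R_pairing r (ext_right_mult b + (\<Sum>i<n. ext_bracket (f i) (a i))) = g b + (\<Sum>i<n. d (f i) (a i))"
    unfolding gd(3) R_pairing_sum[OF gd(1,2) b v] by (simp add: bracket_pairing_sum[OF gd(2) fa])
  moreover have "d (f i) (a i) = r (f i) (a i) - r e (action (f i) (a i))" if "i < n" for i
    using fa[OF that] gd J.mult_commute[of g "f i"] unfolding re
    by (simp add: dual_action right_mult_apply)
  ultimately show ?thesis by (simp add: re)
qed

section \<open>The functionals on \<open>L_space\<close>\<close>

lemma L_pairing_apply: "L_pairing (f, r, h) (a, w, c) = f a + R_pairing r w + h c"
  by (simp add: L_pairing_def)

lemma L_functional_in:
  assumes "u \<in> L_dual"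
  shows "L_functional u \<in> functionals L_scale L_space"
proof -
  obtain f r h where u: "u = (f, r, h)" "f \<in> dual" "r \<in> R_dual" "h \<in> dual"
    using assms by (auto simp: L_dual_def)
  have "linear_on L_scale (*) L_space (L_pairing u)"
    unfolding linear_on_def L_space_def u(1) using u(2-4)
    by (auto simp: L_scale_apply L_pairing_apply R_pairing_add R_pairing_scale dual_add dual_scale algebra_simps)
  then show ?thesis
    unfolding L_functional_def by (rule L.functionalsI[OF _ L_space_subspace])
qed

lemma R_pairing_add_left:
  assumes r: "r \<in> R_dual" "s \<in> R_dual" and w: "w \<in> R_space"
  shows "R_pairing (r + s) w = R_pairing r w + R_pairing s w"
proof -
  obtain b v where bv: "b \<in> A" "v \<in> bracket_space" "w = ext_right_mult b + v" using w by (rule R_spaceE)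
  obtain n :: nat and f a where fa: "\<And>i. i < n \<Longrightarrow> f i \<in> dual \<and> a i \<in> A" "v = (\<Sum>i<n. ext_bracket (f i) (a i))"
    by (rule bracket_space_sumE[OF bv(2)]) (rule that)
  show ?thesis
    using R_dual_closures(1)[OF r] r
    by (simp add: bv(3) fa(2) R_pairing_expand[OF _ bv(1) fa(1)] sum.distrib sum_subtractf)
qed

lemma R_pairing_scale_left:
  assumes r: "r \<in> R_dual" and w: "w \<in> R_space"
  shows "R_pairing (fun_scale dual_scale c r) w = c * R_pairing r w"
proof -
  obtain b v where bv: "b \<in> A" "v \<in> bracket_space" "w = ext_right_mult b + v" using w by (rule R_spaceE)
  obtain n :: nat and f a where fa: "\<And>i. i < n \<Longrightarrow> f i \<in> dual \<and> a i \<in> A" "v = (\<Sum>i<n. ext_bracket (f i) (a i))"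
    by (rule bracket_space_sumE[OF bv(2)]) (rule that)
  have fs: "fun_scale dual_scale c r g y = c * r g y" for g y by (simp add: fun_scale_def)
  show ?thesis
    unfolding bv(3) fa(2)
    by (simp add: R_pairing_expand[OF R_dual_closures(4)[OF r] bv(1) fa(1)] R_pairing_expand[OF r bv(1) fa(1)] fs distrib_left sum_distrib_left right_diff_distrib)
qed

lemma L_functional_linear: "linear_on L_dual_scale dual_scale L_dual L_functional"
  unfolding linear_on_def
proof (intro conjI ballI allI)
  fix u v assume uv: "u \<in> L_dual" "v \<in> L_dual"
  then obtain f r h f' r' h' where *: "u = (f, r, h)" "r \<in> R_dual" "v = (f', r', h')" "r' \<in> R_dual"
    by (auto simp: L_dual_def)
  show "L_functional (u + v) = L_functional u + L_functional v"
    using *(2,4) by (auto simp: fun_eq_iff *(1,3) L_functional_def L_space_def L_pairing_apply R_pairing_add_left)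
next
  fix c u assume "u \<in> L_dual"
  then obtain f r h where *: "u = (f, r, h)" "r \<in> R_dual" by (auto simp: L_dual_def)
  show "L_functional (L_dual_scale c u) = dual_scale c (L_functional u)"
    using *(2) by (auto simp: fun_eq_iff *(1) L_functional_def L_space_def L_pairing_apply L_dual_scale_apply
        R_pairing_scale_left fun_scale_def[of "(*)"] distrib_left)
qed

lemma R_space_0: "0 \<in> R_space"
  by (rule X.subspace_0[OF R_space_subspace])

lemma R_pairing_0: "r \<in> R_dual \<Longrightarrow> R_pairing r 0 = 0"
  using R_pairing_add[OF _ R_space_0 R_space_0, of r] by (metis add_cancel_right_right)

lemma R_space_generator: "f \<in> dual \<Longrightarrow> a \<in> A \<Longrightarrow> ext_right_mult (action f a) + ext_bracket f a \<in> R_space"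
  "f \<in> dual \<Longrightarrow> a \<in> A \<Longrightarrow> ext_right_mult (- action f a) + ext_bracket f a \<in> R_space"
  by (intro R_spaceI ext_bracket_in action_in subspace_neg[OF subspace_space]; assumption)+

lemma L_functional_inj: "inj_on L_functional L_dual"
proof (rule inj_onI)
  fix u v assume uv: "u \<in> L_dual" "v \<in> L_dual" and eq: "L_functional u = L_functional v"
  obtain f r h f' r' h' where *: "u = (f, r, h)" "f \<in> dual" "r \<in> R_dual" "h \<in> dual"
    "v = (f', r', h')" "f' \<in> dual" "r' \<in> R_dual" "h' \<in> dual"
    using uv by (auto simp: L_dual_def)
  have eq': "f a + R_pairing r w + h c = f' a + R_pairing r' w + h' c" if "a \<in> A" "w \<in> R_space" "c \<in> A" for a w c
    using fun_cong[OF eq, of "(a, w, c)"] that by (simp add: L_functional_def L_space_def *(1,5) L_pairing_apply)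
  have "f = f'"
    by (rule dual_eqI) (use *(2-8) eq'[OF _ R_space_0 A_0] in \<open>simp_all add: R_pairing_0 dual_0\<close>)
  moreover have "h = h'"
    by (rule dual_eqI) (use *(2-8) eq'[OF A_0 R_space_0] in \<open>simp_all add: R_pairing_0 dual_0\<close>)
  moreover have "r = r'"
  proof (rule operator_eqI[OF R_dual_operator R_dual_operator])
    fix g assume g: "g \<in> dual"
    show "r g = r' g"
    proof (rule dual_eqI)
      show "r g \<in> dual" "r' g \<in> dual" using * g R_dual_operator operator_in by blast+
      fix a assume a: "a \<in> A"
      have "R_pairing r w = R_pairing r' w" if "w \<in> R_space" for w
        using eq'[OF A_0 that A_0] * by (simp add: dual_0)
      \<comment> \<open>The element \<open>(g a)' + [g, a]\<close> returns the value
        \<open>r g a\<close>, so these generators determine \<open>r\<close>.\<close>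
      from this[OF R_space_generator(1)[OF g a]] show "r g a = r' g a"
        using *(3,7) g a by (simp add: R_pairing_generator)
    qed
  qed (use * in auto)
  ultimately show "u = v" by (simp add: *(1,5))
qed

text \<open>\<open>\<Phi>\<close> is restricted to the four summands of \<open>L_space\<close>.
  Those that are copies of \<open>A\<close> give the functionals \<open>f\<close>, \<open>g\<close>,
  \<open>h\<close>; the restriction to \<open>bracket_space\<close> gives a derivation by
  \<open>bracket_functional_weakly_inner\<close>.\<close>

lemma L_functional_surj: "\<Phi> \<in> functionals L_scale L_space \<Longrightarrow> \<exists>u\<in>L_dual. L_functional u = \<Phi>"
proof -
  assume \<Phi>: "\<Phi> \<in> functionals L_scale L_space"
  then have add: "\<And>x y. x \<in> L_space \<Longrightarrow> y \<in> L_space \<Longrightarrow> \<Phi> (x + y) = \<Phi> x + \<Phi> y"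
    and sc: "\<And>c x. x \<in> L_space \<Longrightarrow> \<Phi> (L_scale c x) = c * \<Phi> x"
    and out: "\<And>x. x \<notin> L_space \<Longrightarrow> \<Phi> x = 0"
    by (auto simp: functionals_def linear_on_def)
  have L: "(a, w, c) \<in> L_space \<longleftrightarrow> a \<in> A \<and> w \<in> R_space \<and> c \<in> A" for a w c
    by (auto simp: L_space_def)
  have v_in: "v \<in> R_space" if "v \<in> bracket_space" for v
  proof -
    have "ext_right_mult 0 = 0" using ext_right_mult_scale[OF A_0, of 0] by simp
    then show ?thesis using R_spaceI[OF A_0 that] by (metis add_0_left)
  qed
  have b_in: "ext_right_mult b \<in> R_space" if "b \<in> A" for b
    using R_spaceI[OF that X.subspace_0[OF bracket_space_subspace]] by (metis add_0_right)
  define f where "f = (\<lambda>a. if a \<in> A then \<Phi> (a, 0, 0) else 0)"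
  define g where "g = (\<lambda>b. if b \<in> A then \<Phi> (0, ext_right_mult b, 0) else 0)"
  define h where "h = (\<lambda>c. if c \<in> A then \<Phi> (0, 0, c) else 0)"
  have "linear_on scale (*) A (\<lambda>a. \<Phi> (a, 0, 0))"
    unfolding linear_on_def
  proof (intro conjI ballI allI)
    show "\<Phi> (x + y, 0, 0) = \<Phi> (x, 0, 0) + \<Phi> (y, 0, 0)" if "x \<in> A" "y \<in> A" for x y
      using add[of "(x, 0, 0)" "(y, 0, 0)"] that R_space_0 A_0 by (simp add: L)
    show "\<Phi> (c *s x, 0, 0) = c * \<Phi> (x, 0, 0)" if "x \<in> A" for c x
      using sc[of "(x, 0, 0)" c] that R_space_0 A_0 by (simp add: L L_scale_apply)
  qed
  then have f: "f \<in> dual" unfolding f_def by (rule dual_restrict)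
  have "linear_on scale (*) A (\<lambda>c. \<Phi> (0, 0, c))"
    unfolding linear_on_def
  proof (intro conjI ballI allI)
    show "\<Phi> (0, 0, x + y) = \<Phi> (0, 0, x) + \<Phi> (0, 0, y)" if "x \<in> A" "y \<in> A" for x y
      using add[of "(0, 0, x)" "(0, 0, y)"] that R_space_0 A_0 by (simp add: L)
    show "\<Phi> (0, 0, c *s x) = c * \<Phi> (0, 0, x)" if "x \<in> A" for c x
      using sc[of "(0, 0, x)" c] that R_space_0 A_0 by (simp add: L L_scale_apply)
  qed
  then have h: "h \<in> dual" unfolding h_def by (rule dual_restrict)
  have \<Phi>w_add: "\<Phi> (0, w + w', 0) = \<Phi> (0, w, 0) + \<Phi> (0, w', 0)" if "w \<in> R_space" "w' \<in> R_space" for w w'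
    using add[of "(0, w, 0)" "(0, w', 0)"] that A_0 by (simp add: L)
  have \<Phi>w_scale: "\<Phi> (0, fun_scale ext_scale c w, 0) = c * \<Phi> (0, w, 0)" if "w \<in> R_space" for w c
    using sc[of "(0, w, 0)" c] that A_0 by (simp add: L L_scale_apply)
  have "linear_on scale (*) A (\<lambda>b. \<Phi> (0, ext_right_mult b, 0))"
    unfolding linear_on_def
    by (intro conjI ballI allI) (simp_all only: ext_right_mult_add ext_right_mult_scale \<Phi>w_add \<Phi>w_scale b_in)
  then have g: "g \<in> dual" unfolding g_def by (rule dual_restrict)
  have \<phi>: "linear_on (fun_scale ext_scale) (*) bracket_space (\<lambda>v. \<Phi> (0, v, 0))"
    unfolding linear_on_def by (intro conjI ballI allI) (simp_all only: \<Phi>w_add \<Phi>w_scale v_in)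
  obtain d where d: "d \<in> WDer" "\<forall>f\<in>dual. \<forall>a\<in>A. d f a = \<Phi> (0, ext_bracket f a, 0)"
    using bracket_functional_weakly_inner[OF \<phi>] by blast
  have pair: "bracket_pairing d v = \<Phi> (0, v, 0)" if v: "v \<in> bracket_space" for v
  proof -
    obtain n :: nat and f a where fa: "\<And>i. i < n \<Longrightarrow> f i \<in> dual \<and> a i \<in> A" "v = (\<Sum>i<n. ext_bracket (f i) (a i))"
      by (rule bracket_space_sumE[OF v]) (rule that)
    have "bracket_pairing d v = (\<Sum>i<n. d (f i) (a i))"
      unfolding fa(2) by (rule bracket_pairing_sum[OF d(1) fa(1)])
    also have "\<dots> = (\<Sum>i<n. \<Phi> (0, ext_bracket (f i) (a i), 0))"
      using fa(1) d(2) by (intro sum.cong) auto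
    also have "\<dots> = \<Phi> (0, v, 0)"
      unfolding fa(2)
      by (rule linear_on_sum[OF X.vector_space_axioms vector_space_field \<phi> bracket_space_subspace, symmetric])
         (use fa(1) ext_bracket_in in auto)
    finally show ?thesis .
  qed
  let ?u = "(f, \<rho> g + d, h)"
  have u: "?u \<in> L_dual" unfolding L_dual_def using f h R_dualI[OF g d(1)] by simp
  have "L_functional ?u x = \<Phi> x" for x
  proof (cases "x \<in> L_space")
    case True
    then obtain a w c where x: "x = (a, w, c)" "a \<in> A" "w \<in> R_space" "c \<in> A" by (auto simp: L_space_def)
    obtain b v where bv: "b \<in> A" "v \<in> bracket_space" "w = ext_right_mult b + v" using x(3) by (rule R_spaceE)
    have "R_pairing (\<rho> g + d) w = g b + bracket_pairing d v"
      unfolding bv(3) by (rule R_pairing_sum[OF g d(1) bv(1,2)])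
    also have "\<dots> = \<Phi> (0, w, 0)"
      unfolding bv(3) \<Phi>w_add[OF b_in[OF bv(1)] v_in[OF bv(2)]] pair[OF bv(2)] using bv(1) by (simp add: g_def)
    finally have "L_functional ?u x = \<Phi> (a, 0, 0) + \<Phi> (0, w, 0) + \<Phi> (0, 0, c)"
      using x True by (simp add: L_functional_def L_pairing_apply f_def h_def)
    also have "\<dots> = \<Phi> x"
      using add[of "(a, 0, 0)" "(0, w, 0)"] add[of "(a, w, 0)" "(0, 0, c)"] x R_space_0 A_0 by (simp add: L)
    finally show ?thesis .
  qed (simp add: L_functional_def out)
  then show ?thesis using u by blast
qed

lemma L_functional_bij: "bij_betw L_functional L_dual (functionals L_scale L_space)"
  unfolding bij_betw_def using L_functional_inj L_functional_in L_functional_surj by blast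

section \<open>The comultiplication of \<open>L(A)\<close>\<close>

text \<open>These are the forms obtained from elements of the tensor square of
  \<open>L_space\<close> by pairing with \<open>u \<otimes> v\<close>.\<close>

definition representable where
  "representable \<beta> \<longleftrightarrow> (\<exists>(n::nat) y z. (\<forall>i<n. y i \<in> L_space \<and> z i \<in> L_space) \<and>
     (\<forall>u\<in>L_dual. \<forall>v\<in>L_dual. \<beta> u v = (\<Sum>i<n. L_pairing u (y i) * L_pairing v (z i))))"

definition evaluation where
  "evaluation l \<longleftrightarrow> (\<exists>x\<in>L_space. \<forall>u\<in>L_dual. l u = L_pairing u x)"

lemma representable_0: "representable (\<lambda>u v. 0)"
  unfolding representable_def by (rule exI[of _ 0]) simp

lemma representable_add:
  assumes "representable \<beta>" "representable \<gamma>"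
  shows "representable (\<lambda>u v. \<beta> u v + \<gamma> u v)"
proof -
  obtain n :: nat and y z where 1: "\<forall>i<n. y i \<in> L_space \<and> z i \<in> L_space"
    "\<forall>u\<in>L_dual. \<forall>v\<in>L_dual. \<beta> u v = (\<Sum>i<n. L_pairing u (y i) * L_pairing v (z i))"
    using assms(1) unfolding representable_def by (elim exE conjE)
  obtain m :: nat and y' z' where 2: "\<forall>i<m. y' i \<in> L_space \<and> z' i \<in> L_space"
    "\<forall>u\<in>L_dual. \<forall>v\<in>L_dual. \<gamma> u v = (\<Sum>i<m. L_pairing u (y' i) * L_pairing v (z' i))"
    using assms(2) unfolding representable_def by (elim exE conjE)
  define p where "p = (\<lambda>i. if i < n then (y i, z i) else (y' (i - n), z' (i - n)))"
  have "(\<Sum>i<n+m. L_pairing u (fst (p i)) * L_pairing v (snd (p i))) =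
      (\<Sum>i<n. L_pairing u (y i) * L_pairing v (z i)) + (\<Sum>i<m. L_pairing u (y' i) * L_pairing v (z' i))" for u v
    using sum_append[of "\<lambda>q. L_pairing u (fst q) * L_pairing v (snd q)" n "\<lambda>i. (y i, z i)" "\<lambda>i. (y' i, z' i)" m]
    by (simp add: p_def)
  then show ?thesis unfolding representable_def
    using 1 2 by (intro exI[of _ "n + m"] exI[of _ "\<lambda>i. fst (p i)"] exI[of _ "\<lambda>i. snd (p i)"]) (auto simp: p_def)
qed

lemma representable_mult:
  assumes "evaluation l" "evaluation l'"
  shows "representable (\<lambda>u v. l u * l' v)"
proof -
  obtain x x' where "x \<in> L_space" "\<forall>u\<in>L_dual. l u = L_pairing u x" "x' \<in> L_space" "\<forall>u\<in>L_dual. l' u = L_pairing u x'"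
    using assms unfolding evaluation_def by blast
  then show ?thesis unfolding representable_def
    by (intro exI[of _ 1] exI[of _ "\<lambda>_. x"] exI[of _ "\<lambda>_. x'"]) simp
qed

lemma representable_swap: "representable \<beta> \<Longrightarrow> representable (\<lambda>u v. \<beta> v u)"
proof -
  assume "representable \<beta>"
  then obtain n :: nat and y z where 1: "\<forall>i<n. y i \<in> L_space \<and> z i \<in> L_space"
    "\<forall>u\<in>L_dual. \<forall>v\<in>L_dual. \<beta> u v = (\<Sum>i<n. L_pairing u (y i) * L_pairing v (z i))"
    unfolding representable_def by (elim exE conjE)
  then show ?thesis unfolding representable_def
    by (intro exI[of _ n] exI[of _ z] exI[of _ y]) (simp add: mult.commute)
qed

lemma representable_cong:
  "representable \<beta> \<Longrightarrow> (\<And>u v. u \<in> L_dual \<Longrightarrow> v \<in> L_dual \<Longrightarrow> \<gamma> u v = \<beta> u v) \<Longrightarrow> representable \<gamma>"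
  unfolding representable_def by simp

lemma representable_minus: "representable \<beta> \<Longrightarrow> representable (\<lambda>u v. - \<beta> u v)"
proof -
  assume "representable \<beta>"
  then obtain n :: nat and y z where 1: "\<forall>i<n. y i \<in> L_space \<and> z i \<in> L_space"
    "\<forall>u\<in>L_dual. \<forall>v\<in>L_dual. \<beta> u v = (\<Sum>i<n. L_pairing u (y i) * L_pairing v (z i))"
    unfolding representable_def by (elim exE conjE)
  have y: "L_scale (- 1) (y i) \<in> L_space" if "i < n" for i
    using L.subspace_scale[OF L_space_subspace] 1(1) that by blast
  have "L_pairing u (L_scale (- 1) (y i)) = - L_pairing u (y i)" if "u \<in> L_dual" "i < n" for u i
  proof -
    have "\<forall>c. \<forall>x\<in>L_space. L_functional u (L_scale c x) = c * L_functional u x"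
      using L_functional_in[OF that(1)] unfolding functionals_def linear_on_def by blast
    then have "L_functional u (L_scale (- 1) (y i)) = - 1 * L_functional u (y i)"
      using 1(1) that(2) by blast
    then show ?thesis using y[OF that(2)] 1(1) that(2) by (simp add: L_functional_def del: L.scale_minus_left)
  qed
  then show ?thesis unfolding representable_def
    using 1 y by (intro exI[of _ n] exI[of _ "\<lambda>i. L_scale (- 1) (y i)"] exI[of _ z]) (simp add: sum_negf)
qed

lemma representable_diff: "representable \<beta> \<Longrightarrow> representable \<gamma> \<Longrightarrow> representable (\<lambda>u v. \<beta> u v - \<gamma> u v)"
  using representable_add[OF _ representable_minus] by simp

lemma representable_sum:
  "(\<And>i. i \<in> I \<Longrightarrow> representable (\<beta> i)) \<Longrightarrow> representable (\<lambda>u v. \<Sum>i\<in>I. \<beta> i u v)"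
  by (induction I rule: infinite_finite_induct) (simp_all add: representable_0 representable_add)

lemma evaluation_fst:
  assumes "a \<in> A" shows "evaluation (\<lambda>u. fst u a)"
  unfolding evaluation_def
  by (rule bexI[of _ "(a, 0, 0)"]) (use assms R_space_0 A_0 in \<open>auto simp: L_dual_def L_space_def L_pairing_apply R_pairing_0 dual_0\<close>)

lemma evaluation_snd:
  assumes "c \<in> A" shows "evaluation (\<lambda>u. snd (snd u) c)"
  unfolding evaluation_def
  by (rule bexI[of _ "(0, 0, c)"]) (use assms R_space_0 A_0 in \<open>auto simp: L_dual_def L_space_def L_pairing_apply R_pairing_0 dual_0\<close>)

text \<open>The two points differ in the sign of \<open>(f a)'\<close>, because
  \<open>\<epsilon>\<close> negates the multiplication part of the operator.\<close>

lemma evaluation_mid: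
  assumes "f \<in> dual" "a \<in> A"
  shows "evaluation (\<lambda>u. fst (snd u) f a)" and "evaluation (\<lambda>u. R_eps (fst (snd u)) f a)"
proof -
  let ?x = "(0, ext_right_mult (action f a) + ext_bracket f a, 0)"
    and ?y = "(0, ext_right_mult (- action f a) + ext_bracket f a, 0)"
  have "?x \<in> L_space" "?y \<in> L_space"
    using R_space_generator[OF assms] A_0 by (simp_all add: L_space_def)
  moreover have "\<forall>u\<in>L_dual. fst (snd u) f a = L_pairing u ?x" "\<forall>u\<in>L_dual. R_eps (fst (snd u)) f a = L_pairing u ?y"
    using assms by (auto simp: L_dual_def L_pairing_apply R_pairing_generator dual_0)
  ultimately show "evaluation (\<lambda>u. fst (snd u) f a)" "evaluation (\<lambda>u. R_eps (fst (snd u)) f a)"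
    unfolding evaluation_def by blast+
qed

text \<open>
  On a finite-dimensional subcoalgebra every \<open>r\<close> acts as an element of \<open>(A\<^sup>*)' + IntDer(A\<^sup>*)\<close>,
  so that \<open>\<langle>f r, a\<rangle>\<close> depends on finitely many values of \<open>f\<close> only.
\<close>

lemma R_dual_coefficients:
  assumes a: "a \<in> A"
  obtains E C where "finite E" "E \<subseteq> A" "\<And>u. C u \<in> dual"
    "\<And>r f. r \<in> R_dual \<Longrightarrow> f \<in> dual \<Longrightarrow> r f a = (\<Sum>u\<in>E. f u * r (C u) a)"
proof -
  obtain B where B: "finite_dim_subcoalgebra B" "a \<in> B"
    using finite_dim_subcoalgebra_exists[of "{a}"] a by auto
  have sub: "subcoalgebra B" using B by (simp add: finite_dim_subcoalgebra_def)
  obtain E C where E: "finite E" "E \<subseteq> B" and C: "\<And>u. C u \<in> dual"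
    and "\<And>x. x \<in> B \<Longrightarrow> x = (\<Sum>u\<in>E. C u x *s u)"
    and EC: "\<And>f b. f \<in> dual \<Longrightarrow> b \<in> B \<Longrightarrow> f b = (\<Sum>u\<in>E. dual_scale (f u) (C u)) b"
    by (rule subcoalgebra_dual_basis[OF B(1)]) (rule that)
  show ?thesis
  proof (rule that[OF E(1) _ C])
    show "E \<subseteq> A" using E(2) subcoalgebra_subset[OF sub] by blast
    fix r f assume r: "r \<in> R_dual" and f: "f \<in> dual"
    define f' where "f' = (\<Sum>u\<in>E. dual_scale (f u) (C u))"
    have f': "f' \<in> dual" unfolding f'_def by (rule J.subspace_sum[OF dual_subspace]) (auto intro: C dual_scale_closed)
    have ff': "f - f' \<in> dual" using f f' by (rule dual_diff_closed)
    have zero: "(f - f') b = 0" if "b \<in> B" for b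
      using EC[OF f that] by (simp add: f'_def)
    obtain g d where gd: "g \<in> dual" "d \<in> WDer" "r = \<rho> g + d" using r by (rule R_dualE)
    \<comment> \<open>Both parts of \<open>r\<close> send functionals annihilating \<open>B\<close>
      to functionals that vanish at \<open>a\<close>; hence \<open>r f a\<close> depends on
      \<open>f\<close> only through its values on \<open>E\<close>.\<close>
    have z1: "d (f - f') a = 0" by (rule weakly_inner_vanish[OF B(1) gd(2) ff' zero B(2)])
    have z2: "((f - f') \<odot> g) a = 0" by (rule dual_mult_vanish[OF sub ff' zero gd(1) B(2)])
    have "r (f - f') a = 0"
      unfolding gd(3) plus_fun_apply right_mult_apply[OF ff'] z1 z2 by simp
    then have "r f a = r f' a" using operator_diff[OF R_dual_operator[OF r] f f'] by simp
    also have "\<dots> = (\<Sum>u\<in>E. f u * r (C u) a)"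
      unfolding f'_def
      using operator_sum[OF R_dual_operator[OF r], of E "\<lambda>u. dual_scale (f u) (C u)"]
        operator_scale[OF R_dual_operator[OF r] C] C dual_scale_closed
      by (simp add: sum_fun_apply fun_scale_def[of "(*)" _ "r _"])
    finally show "r f a = (\<Sum>u\<in>E. f u * r (C u) a)" .
  qed
qed

text \<open>By \<open>R_dual_coefficients\<close> the term \<open>r2 a1\<close> at \<open>a\<close>
  is a finite sum of values of \<open>a1\<close> times values of \<open>r2\<close>; the term
  \<open>r1 a2\<close> is the same form with the arguments exchanged.\<close>

lemma representable_fst:
  assumes a: "a \<in> A" shows "representable (\<lambda>u v. fst (L_bracket u v) a)"
proof -
  obtain E C where E: "finite E" "E \<subseteq> A" "\<And>q. C q \<in> dual"
    "\<And>r f. r \<in> R_dual \<Longrightarrow> f \<in> dual \<Longrightarrow> r f a = (\<Sum>q\<in>E. f q * r (C q) a)"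
    by (rule R_dual_coefficients[OF a]) (rule that)
  have "representable (\<lambda>u v. \<Sum>q\<in>E. fst u q * fst (snd v) (C q) a)"
    by (intro representable_sum representable_mult evaluation_fst evaluation_mid E(3) a) (use E(2) in blast)
  from representable_diff[OF this representable_swap[OF this]] show ?thesis
    by (rule representable_cong) (auto simp: L_dual_def L_bracket_apply E(4)[symmetric])
qed

lemma representable_snd:
  assumes a: "a \<in> A" shows "representable (\<lambda>u v. snd (snd (L_bracket u v)) a)"
proof -
  obtain E C where E: "finite E" "E \<subseteq> A" "\<And>q. C q \<in> dual"
    "\<And>r f. r \<in> R_dual \<Longrightarrow> f \<in> dual \<Longrightarrow> r f a = (\<Sum>q\<in>E. f q * r (C q) a)"
    by (rule R_dual_coefficients[OF a]) (rule that)
  have "representable (\<lambda>u v. \<Sum>q\<in>E. snd (snd u) q * R_eps (fst (snd v)) (C q) a)"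
    by (intro representable_sum representable_mult evaluation_snd evaluation_mid E(3) a) (use E(2) in blast)
  from representable_diff[OF this representable_swap[OF this]] show ?thesis
    \<comment> \<open>\<open>R_eps r\<close> is again in \<open>R_dual\<close>, so the same
      coefficients apply to it.\<close>
    by (rule representable_cong) (auto simp: L_dual_def L_bracket_apply E(4)[symmetric] R_eps_in)
qed

text \<open>With \<open>g\<close> and \<open>h\<close> the variable functionals, the terms
  \<open>f (g h)\<close>, \<open>(f g) h\<close>, \<open>(f h) g\<close> at \<open>a\<close> become
  sums of values of \<open>g\<close> times values of \<open>h\<close> once the fixed
  \<open>f\<close> is moved onto points: the first needs the comultiplication of
  \<open>action f a\<close>, the others that of \<open>a\<close> with \<open>f\<close> acting on its
  left factors.\<close>

lemma representable_nabla:
  assumes f: "f \<in> dual" and a: "a \<in> A"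
  shows "representable (\<lambda>u v. nabla (fst u) (snd (snd v)) f a)"
proof -
  obtain n :: nat and x y where xy: "\<And>i. i < n \<Longrightarrow> x i \<in> A \<and> y i \<in> A"
    "\<And>f g. f \<in> dual \<Longrightarrow> g \<in> dual \<Longrightarrow> (f \<odot> g) a = (\<Sum>i<n. f (x i) * g (y i))"
    "\<And>f. f \<in> dual \<Longrightarrow> action f a = (\<Sum>i<n. f (y i) *s x i)"
    by (rule comultE[OF subcoalgebra_space a]) (rule that)
  obtain m :: nat and x' y' where xy': "\<And>i. i < m \<Longrightarrow> x' i \<in> A \<and> y' i \<in> A"
    "\<And>g h. g \<in> dual \<Longrightarrow> h \<in> dual \<Longrightarrow> (g \<odot> h) (action f a) = (\<Sum>i<m. g (x' i) * h (y' i))"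
    "\<And>g. g \<in> dual \<Longrightarrow> action g (action f a) = (\<Sum>i<m. g (y' i) *s x' i)"
    by (rule comultE[OF subcoalgebra_space action_in[OF a f]]) (rule that)
  let ?\<beta> = "\<lambda>u v. (\<Sum>i<m. fst u (x' i) * snd (snd v) (y' i))
    - ((\<Sum>i<n. fst u (action f (x i)) * snd (snd v) (y i)) - (\<Sum>i<n. fst u (y i) * snd (snd v) (action f (x i))))"
  have "representable ?\<beta>"
    by (intro representable_diff representable_sum representable_mult evaluation_fst evaluation_snd action_in f)
       (use xy(1) xy'(1) in auto)
  then show ?thesis
  proof (rule representable_cong)
    fix u v assume "u \<in> L_dual" "v \<in> L_dual"
    then have g: "fst u \<in> dual" and h: "snd (snd v) \<in> dual" by (auto simp: L_dual_def)
    have 1: "(f \<odot> (fst u \<odot> snd (snd v))) a = (\<Sum>i<m. fst u (x' i) * snd (snd v) (y' i))"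
      using dual_action[OF dual_mult_closed[OF g h] f a] J.mult_commute[OF f dual_mult_closed[OF g h]] xy'(2)[OF g h] by simp
    have fx: "(f \<odot> k) (x i) = k (action f (x i))" if "i < n" "k \<in> dual" for k i
      using dual_action[OF that(2) f, of "x i"] J.mult_commute[OF f that(2)] xy(1)[OF that(1)] by simp
    have 2: "((f \<odot> fst u) \<odot> snd (snd v)) a = (\<Sum>i<n. fst u (action f (x i)) * snd (snd v) (y i))"
      unfolding xy(2)[OF dual_mult_closed[OF f g] h] by (intro sum.cong) (auto simp: fx g)
    have 3: "((f \<odot> snd (snd v)) \<odot> fst u) a = (\<Sum>i<n. fst u (y i) * snd (snd v) (action f (x i)))"
      unfolding xy(2)[OF dual_mult_closed[OF f h] g] by (intro sum.cong) (auto simp: fx h)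
    show "nabla (fst u) (snd (snd v)) f a = ?\<beta> u v"
      unfolding nabla_apply[OF g h f] by (simp add: 1 2 3)
  qed
qed

lemma representable_mid:
  assumes f: "f \<in> dual" and a: "a \<in> A"
  shows "representable (\<lambda>u v. fst (snd (L_bracket u v)) f a)"
proof -
  obtain E C where E: "finite E" "E \<subseteq> A" "\<And>q. C q \<in> dual"
    "\<And>r f. r \<in> R_dual \<Longrightarrow> f \<in> dual \<Longrightarrow> r f a = (\<Sum>q\<in>E. f q * r (C q) a)"
    by (rule R_dual_coefficients[OF a]) (rule that)
  \<comment> \<open>The commutator at \<open>f\<close> is \<open>r2 (r1 f) - r1 (r2 f)\<close>.
    Expanding \<open>r2\<close> in its argument \<open>r1 f\<close> splits the operators into values
    of \<open>r1 f\<close> on \<open>E\<close> and values of \<open>r2\<close> at the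
    \<open>C q\<close>.\<close>
  have c: "representable (\<lambda>u v. \<Sum>q\<in>E. fst (snd u) f q * fst (snd v) (C q) a)"
    by (intro representable_sum representable_mult evaluation_mid E(3) a f) (use E(2) in blast)
  note n = representable_nabla[OF f a]
  have "fst (snd (L_bracket u v)) f a = (nabla (fst u) (snd (snd v)) f a - nabla (fst v) (snd (snd u)) f a)
      + ((\<Sum>q\<in>E. fst (snd u) f q * fst (snd v) (C q) a) - (\<Sum>q\<in>E. fst (snd v) f q * fst (snd u) (C q) a))"
    if "u \<in> L_dual" "v \<in> L_dual" for u v
  proof -
    obtain a1 r1 b1 a2 r2 b2 where uv: "u = (a1, r1, b1)" "v = (a2, r2, b2)"
      by (metis prod_cases3)
    have r: "r1 \<in> R_dual" "r2 \<in> R_dual" using that by (auto simp: uv L_dual_def)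
    note rf = r[THEN R_dual_operator, THEN operator_in, OF f]
    show ?thesis
      unfolding uv L_bracket_apply fst_conv snd_conv E(4)[OF r(2) rf(1), symmetric] E(4)[OF r(1) rf(2), symmetric]
      by (simp add: op_commutator_def)
  qed
  from representable_cong[OF representable_add[OF representable_diff[OF n representable_swap[OF n]]
      representable_diff[OF c representable_swap[OF c]]] this]
  show ?thesis .
qed

lemma representable_bracket:
  assumes x: "x \<in> L_space"
  shows "representable (\<lambda>u v. L_pairing (L_bracket u v) x)"
proof -
  obtain a w c where xw: "x = (a, w, c)" "a \<in> A" "w \<in> R_space" "c \<in> A"
    using x by (auto simp: L_space_def)
  obtain b v where bv: "b \<in> A" "v \<in> bracket_space" "w = ext_right_mult b + v" using xw(3) by (rule R_spaceE)
  obtain n :: nat and f a' where fa: "\<And>i. i < n \<Longrightarrow> f i \<in> dual \<and> a' i \<in> A" "v = (\<Sum>i<n. ext_bracket (f i) (a' i))"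
    by (rule bracket_space_sumE[OF bv(2)]) (rule that)
  let ?s = "\<lambda>u v. fst (snd (L_bracket u v))"
  have "representable (\<lambda>u v. fst (L_bracket u v) a
     + (?s u v e b + (\<Sum>i<n. ?s u v (f i) (a' i) - ?s u v e (action (f i) (a' i)))) + snd (snd (L_bracket u v)) c)"
    by (intro representable_add representable_sum representable_diff representable_fst representable_mid representable_snd
        unit_in bv(1) xw action_in) (use fa(1) in auto)
  then show ?thesis
  proof (rule representable_cong)
    fix u v assume "u \<in> L_dual" "v \<in> L_dual"
    from L_bracket_closed[OF this] obtain f' r h where L: "L_bracket u v = (f', r, h)" "r \<in> R_dual"
      by (auto simp: L_dual_def)
    show "L_pairing (L_bracket u v) x = fst (L_bracket u v) a
     + (?s u v e b + (\<Sum>i<n. ?s u v (f i) (a' i) - ?s u v e (action (f i) (a' i)))) + snd (snd (L_bracket u v)) c"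
      unfolding L(1) xw(1) L_pairing_apply bv(3) fa(2) by (simp add: R_pairing_expand[OF L(2) bv(1) fa(1)])
  qed
qed

text \<open>The bracket is transported to functionals along the inverse \<open>\<psi>\<close> of
  \<open>L_functional\<close>; its values have finite rank by \<open>representable_bracket\<close>,
  so \<open>comult_exists\<close> applies. The Lie axioms of the dual are then those of
  \<open>L_bracket\<close>.\<close>

theorem lie_coalgebra_exists:
  "\<exists>\<Delta>L. lie_coalgebra L_scale L_space \<Delta>L \<and>
    algebra_iso L_dual_scale L_dual L_bracket dual_scale (coalgebra.dual L_scale L_space)
      (coalgebra.dual_mult L_scale L_space \<Delta>L) L_functional"
proof -
  define \<psi> where "\<psi> = inv_into L_dual L_functional"
  define B where "B = (\<lambda>f g. L_functional (L_bracket (\<psi> f) (\<psi> g)))"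
  let ?F = "functionals L_scale L_space"
  have \<psi>: "\<psi> f \<in> L_dual" "L_functional (\<psi> f) = f" if "f \<in> ?F" for f
    using that bij_betw_inv_into_right[OF L_functional_bij] bij_betw_inv_into[OF L_functional_bij]
    by (auto simp: \<psi>_def bij_betw_def)
  have \<psi>L: "\<psi> (L_functional u) = u" if "u \<in> L_dual" for u
    unfolding \<psi>_def by (rule bij_betw_inv_into_left[OF L_functional_bij that])
  have B_in: "B f g \<in> ?F" if "f \<in> ?F" "g \<in> ?F" for f g
    unfolding B_def using that by (intro L_functional_in L_bracket_closed \<psi>)
  have "\<exists>\<Delta>. coalgebra L_scale L_space \<Delta> \<and> (\<forall>f\<in>?F. \<forall>g\<in>?F. \<forall>x\<in>L_space.
       tensor_lift L_scale L_scale L_space L_space (\<lambda>x y. f x * g y) (\<Delta> x) = B f g x)"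
  proof (rule L.comult_exists[OF L_space_subspace])
    show "linear_on L_scale (*) L_space (B f g)" if "f \<in> ?F" "g \<in> ?F" for f g
      using B_in[OF that] by (simp add: functionals_def)
    fix x assume x: "x \<in> L_space"
    obtain n :: nat and y z where yz: "\<forall>i<n. y i \<in> L_space \<and> z i \<in> L_space"
      "\<forall>u\<in>L_dual. \<forall>v\<in>L_dual. L_pairing (L_bracket u v) x = (\<Sum>i<n. L_pairing u (y i) * L_pairing v (z i))"
      using representable_bracket[OF x] unfolding representable_def by (elim exE conjE)
    have "B f g x = (\<Sum>i<n. f (y i) * g (z i))" if "f \<in> ?F" "g \<in> ?F" for f g
    proof -
      have ev: "h q = L_pairing (\<psi> h) q" if "h \<in> ?F" "q \<in> L_space" for h q
        using fun_cong[OF \<psi>(2)[OF that(1)], of q] that(2) by (simp add: L_functional_def)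
      have "B f g x = L_pairing (L_bracket (\<psi> f) (\<psi> g)) x"
        using x by (simp add: B_def L_functional_def)
      also have "\<dots> = (\<Sum>i<n. L_pairing (\<psi> f) (y i) * L_pairing (\<psi> g) (z i))"
        using yz(2) \<psi>(1) that by blast
      also have "\<dots> = (\<Sum>i<n. f (y i) * g (z i))"
        using yz(1) that by (intro sum.cong) (auto simp: ev)
      finally show ?thesis .
    qed
    with yz(1) show "\<exists>(n::nat) y z. (\<forall>i<n. y i \<in> L_space \<and> z i \<in> L_space) \<and>
      (\<forall>f\<in>?F. \<forall>g\<in>?F. B f g x = (\<Sum>i<n. f (y i) * g (z i)))" by blast
  qed
  then obtain \<Delta>L where co: "coalgebra L_scale L_space \<Delta>L" and
    lift: "\<And>f g x. f \<in> ?F \<Longrightarrow> g \<in> ?F \<Longrightarrow> x \<in> L_space \<Longrightarrow>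
       tensor_lift L_scale L_scale L_space L_space (\<lambda>x y. f x * g y) (\<Delta>L x) = B f g x" by blast
  interpret C: coalgebra L_scale L_space \<Delta>L by (rule co)
  have dual: "C.dual = ?F" by (rule C.dual_eq_functionals)
  have mult: "C.dual_mult f g = B f g" if "f \<in> ?F" "g \<in> ?F" for f g
    using lift[OF that] B_in[OF that] by (auto simp: C.dual_mult_def functionals_def)
  have hom: "L_functional (L_bracket u v) = C.dual_mult (L_functional u) (L_functional v)"
    if "u \<in> L_dual" "v \<in> L_dual" for u v
    using that by (simp add: mult L_functional_in B_def \<psi>L)
  have L0: "L_functional 0 = 0"
  proof -
    have "L_functional (L_bracket 0 0) = 0"
      by (auto simp: L_bracket_self fun_eq_iff L_functional_def zero_prod_def L_space_def L_pairing_apply)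
         (use R_pairing_scale_left[OF R_dual_closures(5), of _ 0] in simp)
    then show ?thesis by (simp add: L_bracket_self)
  qed
  have add: "L_functional (u + v) = L_functional u + L_functional v" if "u \<in> L_dual" "v \<in> L_dual" for u v
    using L_functional_linear that unfolding linear_on_def by blast
  have L_add: "u + v \<in> L_dual" if "u \<in> L_dual" "v \<in> L_dual" for u v
    using that unfolding L_dual_def by (auto intro!: dual_add_closed R_dual_closures(1))
  have "lie_algebra dual_scale C.dual C.dual_mult"
  proof (intro lie_algebra.intro lie_algebra_axioms.intro)
    show "nonassoc_algebra dual_scale C.dual C.dual_mult" by (rule C.dual_nonassoc_algebra)
    show "C.dual_mult x x = 0" if "x \<in> C.dual" for x
      using that by (simp add: dual mult B_def L_bracket_self L0)
    fix x y z assume "x \<in> C.dual" "y \<in> C.dual" "z \<in> C.dual"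
    then have xyz: "x \<in> ?F" "y \<in> ?F" "z \<in> ?F" by (simp_all add: dual)
    let ?t = "\<lambda>x y z. L_bracket (L_bracket (\<psi> x) (\<psi> y)) (\<psi> z)"
    have t: "C.dual_mult (C.dual_mult x y) z = L_functional (?t x y z)" "?t x y z \<in> L_dual"
      if "x \<in> ?F" "y \<in> ?F" "z \<in> ?F" for x y z
      using hom[OF L_bracket_closed[OF \<psi>(1)[OF that(1)] \<psi>(1)[OF that(2)]] \<psi>(1)[OF that(3)]]
        hom[OF \<psi>(1)[OF that(1)] \<psi>(1)[OF that(2)]] \<psi> that L_bracket_closed by simp_all
    have "C.dual_mult (C.dual_mult x y) z + C.dual_mult (C.dual_mult y z) x + C.dual_mult (C.dual_mult z x) y
      = L_functional (?t x y z + ?t y z x + ?t z x y)"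
      using xyz by (simp only: t add L_add)
    also have "\<dots> = 0"
      unfolding L_bracket_jacobi[OF \<psi>(1)[OF xyz(1)] \<psi>(1)[OF xyz(2)] \<psi>(1)[OF xyz(3)]] by (rule L0)
    finally show "C.dual_mult (C.dual_mult x y) z + C.dual_mult (C.dual_mult y z) x + C.dual_mult (C.dual_mult z x) y = 0" .
  qed
  then have "lie_coalgebra L_scale L_space \<Delta>L"
    by (intro lie_coalgebra.intro lie_coalgebra_axioms.intro co)
  moreover have "algebra_iso L_dual_scale L_dual L_bracket dual_scale C.dual C.dual_mult L_functional"
    unfolding algebra_iso_def dual using L_functional_linear L_functional_bij hom by blast
  ultimately show ?thesis by blast
qed

end

theorem theorem1:
  fixes scale :: "'k::field \<Rightarrow> 'a::ab_group_add \<Rightarrow> 'a"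
    and A :: "'a set"
    and \<Delta> :: "'a \<Rightarrow> ('a, 'a, 'k) tensor"
  assumes "CHAR('k) \<noteq> 2"
    and "jordan_coalgebra scale A \<Delta>"
    and "\<exists>e \<in> coalgebra.dual scale A. \<forall>f \<in> coalgebra.dual scale A.
           coalgebra.dual_mult scale A \<Delta> e f = f \<and> coalgebra.dual_mult scale A \<Delta> f e = f"
  shows "\<exists>\<Delta>L.
    lie_coalgebra (coalgebra.L_scale scale) (coalgebra.L_space scale A \<Delta>) \<Delta>L \<and>
    algebra_iso
      coalgebra.L_dual_scale (coalgebra.L_dual scale A \<Delta>) (coalgebra.L_bracket scale A \<Delta>)
      dual_scale
      (coalgebra.dual (coalgebra.L_scale scale) (coalgebra.L_space scale A \<Delta>))
      (coalgebra.dual_mult (coalgebra.L_scale scale) (coalgebra.L_space scale A \<Delta>) \<Delta>L)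
      (coalgebra.L_functional scale A \<Delta>)"
proof -
  interpret jordan_coalgebra scale A \<Delta> by (rule assms(2))
  obtain e where e: "e \<in> dual" "\<And>f. f \<in> dual \<Longrightarrow> dual_mult e f = f" using assms(3) by blast
  have "(2::'k) \<noteq> 0"
  proof
    assume "(2::'k) = 0"
    then have "of_nat 2 = (0::'k)" by simp
    \<comment> \<open>The divisors of 2 are 1 and 2, and a field does not have characteristic
      1.\<close>
    then have "CHAR('k) dvd 2" by (simp only: of_nat_eq_0_iff_char_dvd)
    moreover from this have "CHAR('k) \<le> 2" "CHAR('k) \<noteq> 0" by (auto dest: dvd_imp_le intro: gr0I)
    ultimately have "CHAR('k) = 1 \<or> CHAR('k) = 2" by linarith
    then show False using assms(1) CHAR_not_1 by auto
  qed
  then interpret unital_jordan_coalgebra scale A \<Delta> e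
    by unfold_locales (use e in auto)
  show ?thesis by (rule lie_coalgebra_exists)
qed

end
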